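(* The following gives a complete list of the idempotent states on $U_0(2)$. (1) The idempotent states induced by the Haar measures on the two-dimensional torus $\mathbb{T}^2$ and its closed subgroups. If $\rho$ denotes the Haar measure of $\mathbb{T}^2$ or one of its closed subgroups, then the corresponding idempotent state $\phi_\rho$ is given by $$\phi_\rho\big((a^* )^rc^ka^sv^\ell\big)=\delta_{0k}\int_{\mathbb{T}^2}w_1^{s-r}w_2^\ell\,d\rho(w_1,w_2)$$ for $r,s\in\mathbb{Z}_+$, $k,\ell\in\mathbb{Z}$. This includes the counit of $U_0(2)$, for the trivial subgroup $\{1\}$ of $\mathbb{T}^2$. (2) The family $\Psi_{n,m}=\psi_n\otimes\phi_m$, $n\in\mathbb{Z}_+$, $m\in\mathbb{N}\cup\{\infty\}$. Here $\phi_m$ is an idempotent state on $C(U(1))$, namely the Haar measure on $U(1)$ for $m=\infty$ and the idempotent state induced by the Haar measure of $\mathbb{Z}_m$ for $m\in\mathbb{N}$; and $\psi_n$, $n\in\mathbb{Z}_+$, is the idempotent state on $SU_0(2)$ defined by $$\psi_n\big((\alpha^* )^r\gamma^k\alpha^s\big)=\begin{cases}1&\text{if } r=s\le n\text{ and }k=0,\\0&\text{else}\end{cases}$$ for $r,s\in\mathbb{Z}_+$, $k\in\mathbb{Z}$.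
   Context: $\mathbb{Z}_+=\{0,1,2,\dots\}$, $\mathbb{N}=\{1,2,\dots\}$. Convention: for $k>0$, $c^{-k}:=(c^* )^k$, $\gamma^{-k}:=(\gamma^* )^k$, and $v^{-k}:=(v^* )^k$. $\mathrm{Pol}(U_0(2))$ is the $*$-bialgebra generated by $a,c,v$ with relations $av=va$, $cv=vc$, $cc^*=c^*c$, $vv^*=v^*v=1$, $ac=ac^*=0$, $aa^*=1$, $a^*a+c^*c=1$, coproduct $\Delta(a)=a\otimes a$, $\Delta(c)=c\otimes a+a^*v^*\otimes c$, $\Delta(v)=v\otimes v$, counit $\varepsilon(a)=\varepsilon(v)=1$, $\varepsilon(c)=0$. $C(U_0(2))$ is its universal enveloping $C^*$-algebra with the extended coproduct (a $C^*$-bialgebra: a unital $C^*$-algebra with a coassociative unital $*$-homomorphism $\Delta:\mathsf{A}\to\mathsf{A}\otimes\mathsf{A}$). An idempotent state on it is a state $\phi$ with $(\phi\otimes\phi)\circ\Delta=\phi$. $C(SU_0(2))$ is the universal $C^*$-algebra generated by $\alpha,\gamma$ with $\alpha\gamma=\alpha\gamma^*=0$, $\gamma\gamma^*=\gamma^*\gamma$, $\alpha\alpha^*=1$, $\alpha^*\alpha+\gamma^*\gamma=1$, with coproduct $\Delta(\alpha)=\alpha\otimes\alpha$, $\Delta(\gamma)=\gamma\otimes\alpha+\alpha^*\otimes\gamma$. As $C^*$-algebras $C(U_0(2))\cong C(SU_0(2))\otimes C(U(1))$ via $a\mapsto\alpha\otimes1$, $c\mapsto\gamma\otimes1$, $v\mapsto1\otimes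 w$ ($w$ the coordinate function on $U(1)$); $\psi_n\otimes\phi_m$ is understood via this identification. The elements $(a^* )^rc^ka^sv^\ell$ ($r,s\in\mathbb{Z}_+$, $k,\ell\in\mathbb{Z}$) span $\mathrm{Pol}(U_0(2))$. The states in (1) are the compositions of $\pi_{\mathbb{T}^2}:C(U_0(2))\to C(\mathbb{T}^2)$, $a\mapsto w_1$, $c\mapsto0$, $v\mapsto w_2$, with integration against $\rho$, where $w_1,w_2$ are the coordinate functions on $\mathbb{T}^2$. $\mathbb{Z}_m\subset U(1)$ is the group of $m$-th roots of unity. *)

theory Defs
  imports
    "HOL-Analysis.Analysis"
    "HOL-Probability.Probability_Measure"
    "HOL-Algebra.Group"
    "HOL-Library.Poly_Mapping"
    "HOL-Library.Extended_Nat"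
begin

section \<open>Unital \<open>C\<^sup>*\<close>-algebras\<close>

(* Unital and nonzero (real_normed_algebra_1 has norm 1 = 1). *)
class cstar_algebra = real_normed_algebra_1 + banach +
  fixes scaleC :: "complex \<Rightarrow> 'a \<Rightarrow> 'a"  (infixr \<open>*\<^sub>C\<close> 75)
    and star :: "'a \<Rightarrow> 'a"  (\<open>_\<^sup>\<star>\<close> [1000] 1000)
  assumes scaleC_add_right: "z *\<^sub>C (x + y) = z *\<^sub>C x + z *\<^sub>C y"
    and scaleC_add_left: "(z + z') *\<^sub>C x = z *\<^sub>C x + z' *\<^sub>C x"
    and scaleC_scaleC: "z *\<^sub>C z' *\<^sub>C x = (z * z') *\<^sub>C x"
    and scaleC_of_real: "complex_of_real r *\<^sub>C x = r *\<^sub>R x"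
    and scaleC_mult_left: "(z *\<^sub>C x) * y = z *\<^sub>C (x * y)"
    and scaleC_mult_right: "x * (z *\<^sub>C y) = z *\<^sub>C (x * y)"
    and norm_scaleC: "norm (z *\<^sub>C x) = cmod z * norm x"
    and star_star: "(x\<^sup>\<star>)\<^sup>\<star> = x"
    and star_add: "(x + y)\<^sup>\<star> = x\<^sup>\<star> + y\<^sup>\<star>"
    and star_scaleC: "(z *\<^sub>C x)\<^sup>\<star> = cnj z *\<^sub>C x\<^sup>\<star>"
    and star_mult: "(x * y)\<^sup>\<star> = y\<^sup>\<star> * x\<^sup>\<star>"
    and cstar_identity: "norm (x\<^sup>\<star> * x) = (norm x)\<^sup>2"

instantiation complex :: cstar_algebra
begin

definition scaleC_complex :: "complex \<Rightarrow> complex \<Rightarrow> complex" where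
  "scaleC_complex z x = z * x"

definition star_complex :: "complex \<Rightarrow> complex" where
  "star_complex = cnj"

instance
  by standard
    (auto simp: scaleC_complex_def star_complex_def algebra_simps norm_mult power2_eq_square
      scaleR_conv_of_real)

end

setup_lifting type_definition_bcontfun

instantiation bcontfun :: (metric_space, cstar_algebra) cstar_algebra
begin

lift_definition one_bcontfun :: "'a \<Rightarrow>\<^sub>C 'b" is "\<lambda>_. 1"
  by (rule const_bcontfun)

lift_definition times_bcontfun :: "('a \<Rightarrow>\<^sub>C 'b) \<Rightarrow> ('a \<Rightarrow>\<^sub>C 'b) \<Rightarrow> ('a \<Rightarrow>\<^sub>C 'b)"
  is "\<lambda>f g x. f x * g x"
proof -
  fix f g :: "'a \<Rightarrow> 'b"
  assume f: "f \<in> bcontfun" and g: "g \<in> bcontfun"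
  obtain B where B: "\<And>x. norm (f x) \<le> B"
    using f by (auto simp: bcontfun_def bounded_iff)
  obtain C where C: "\<And>x. norm (g x) \<le> C"
    using g by (auto simp: bcontfun_def bounded_iff)
  have "norm (f x * g x) \<le> B * C" for x
    using norm_mult_ineq[of "f x" "g x"] mult_mono[OF B C, of x x]
      norm_ge_zero[of "f x"] B[of x] by (smt (verit) norm_ge_zero)
  then show "(\<lambda>x. f x * g x) \<in> bcontfun"
    using f g by (intro bcontfun_normI) (auto simp: bcontfun_def intro!: continuous_intros)
qed

lift_definition scaleC_bcontfun :: "complex \<Rightarrow> ('a \<Rightarrow>\<^sub>C 'b) \<Rightarrow> ('a \<Rightarrow>\<^sub>C 'b)"
  is "\<lambda>z f x. z *\<^sub>C f x"
proof -
  fix z and f :: "'a \<Rightarrow> 'b"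
  assume f: "f \<in> bcontfun"
  have eq: "(\<lambda>x. z *\<^sub>C f x) = (\<lambda>x. f x * (z *\<^sub>C 1))"
    by (simp add: scaleC_mult_right)
  obtain B where "\<And>x. norm (f x) \<le> B"
    using f by (auto simp: bcontfun_def bounded_iff)
  then have "norm (z *\<^sub>C f x) \<le> cmod z * B" for x
    by (simp add: norm_scaleC mult_left_mono)
  then show "(\<lambda>x. z *\<^sub>C f x) \<in> bcontfun"
    using f by (intro bcontfun_normI, unfold eq) (auto simp: bcontfun_def intro!: continuous_intros)
qed

lift_definition star_bcontfun :: "('a \<Rightarrow>\<^sub>C 'b) \<Rightarrow> ('a \<Rightarrow>\<^sub>C 'b)" is "\<lambda>f x. (f x)\<^sup>\<star>"
proof -
  have norm_star: "norm (y\<^sup>\<star>) = norm y" for y :: 'b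
  proof -
    have le: "norm u \<le> norm (u\<^sup>\<star>)" for u :: 'b
    proof (cases "u = 0")
      case False
      have "norm u * norm u \<le> norm (u\<^sup>\<star>) * norm u"
        using norm_mult_ineq[of "u\<^sup>\<star>" u] by (simp add: cstar_identity power2_eq_square)
      then show ?thesis using False by simp
    qed simp
    show ?thesis using le[of y] le[of "y\<^sup>\<star>"] by (simp add: star_star)
  qed
  have diff: "y\<^sup>\<star> - y'\<^sup>\<star> = (y - y')\<^sup>\<star>" for y y' :: 'b
    using star_add[of "y - y'" y'] by (simp add: algebra_simps)
  have cont: "continuous_on UNIV (star :: 'b \<Rightarrow> 'b)"
    by (rule continuous_on_iff[THEN iffD2]) (auto simp: dist_norm diff norm_star)
  fix f :: "'a \<Rightarrow> 'b"
  assume f: "f \<in> bcontfun"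
  obtain B where "\<And>x. norm (f x) \<le> B"
    using f by (auto simp: bcontfun_def bounded_iff)
  then show "(\<lambda>x. (f x)\<^sup>\<star>) \<in> bcontfun"
    using f cont
    by (intro bcontfun_normI[where b = B])
      (auto simp: bcontfun_def norm_star intro: continuous_on_compose2)
qed

instance
proof
  have "apply_bcontfun (0 :: 'a \<Rightarrow>\<^sub>C 'b) undefined \<noteq> apply_bcontfun 1 undefined"
    by (simp add: one_bcontfun.rep_eq)
  then show "(0 :: 'a \<Rightarrow>\<^sub>C 'b) \<noteq> 1" by metis
next
  show "norm (1 :: 'a \<Rightarrow>\<^sub>C 'b) = 1"
  proof (rule antisym)
    show "norm (1 :: 'a \<Rightarrow>\<^sub>C 'b) \<le> 1" by (rule norm_bound) (simp add: one_bcontfun.rep_eq)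
    show "1 \<le> norm (1 :: 'a \<Rightarrow>\<^sub>C 'b)"
      using norm_bounded[of "1 :: 'a \<Rightarrow>\<^sub>C 'b" undefined] by (simp add: one_bcontfun.rep_eq)
  qed
next
  fix f g :: "'a \<Rightarrow>\<^sub>C 'b"
  show "norm (f * g) \<le> norm f * norm g"
  proof (rule norm_bound)
    fix x
    have "norm (apply_bcontfun (f * g) x) \<le> norm (apply_bcontfun f x) * norm (apply_bcontfun g x)"
      by (simp add: times_bcontfun.rep_eq norm_mult_ineq)
    also have "\<dots> \<le> norm f * norm g" by (intro mult_mono norm_bounded) auto
    finally show "norm (apply_bcontfun (f * g) x) \<le> norm f * norm g" .
  qed
next
  fix z and f :: "'a \<Rightarrow>\<^sub>C 'b"
  have le: "norm (u *\<^sub>C h) \<le> cmod u * norm h" for u and h :: "'a \<Rightarrow>\<^sub>C 'b"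
    by (rule norm_bound) (simp add: scaleC_bcontfun.rep_eq norm_scaleC norm_bounded mult_left_mono)
  have inv: "inverse z *\<^sub>C z *\<^sub>C f = f" if "z \<noteq> 0"
    using that scaleC_of_real[where 'a = 'b, of 1]
    by (intro bcontfun_eqI) (simp add: scaleC_bcontfun.rep_eq scaleC_scaleC)
  show "norm (z *\<^sub>C f) = cmod z * norm f"
  proof (cases "z = 0")
    case True
    then show ?thesis using le[of z f] by simp
  next
    case False
    have "norm f \<le> cmod (inverse z) * norm (z *\<^sub>C f)"
      using le[of "inverse z" "z *\<^sub>C f"] inv[OF False] by simp
    then have "cmod z * norm f \<le> cmod z * (cmod (inverse z) * norm (z *\<^sub>C f))"
      by (rule mult_left_mono) simp
    moreover have "cmod z * (cmod (inverse z) * norm (z *\<^sub>C f)) = norm (z *\<^sub>C f)"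
      using False by (simp add: norm_inverse mult.assoc [symmetric])
    ultimately have "cmod z * norm f \<le> norm (z *\<^sub>C f)" by simp
    then show ?thesis using le[of z f] by simp
  qed
next
  fix f :: "'a \<Rightarrow>\<^sub>C 'b"
  show "norm (f\<^sup>\<star> * f) = (norm f)\<^sup>2"
  proof (rule antisym)
    have sq: "norm (apply_bcontfun (f\<^sup>\<star> * f) x) = (norm (apply_bcontfun f x))\<^sup>2" for x
      by (simp add: times_bcontfun.rep_eq star_bcontfun.rep_eq cstar_identity)
    show "norm (f\<^sup>\<star> * f) \<le> (norm f)\<^sup>2"
      by (rule norm_bound) (simp add: sq norm_bounded power_mono)
    have "norm f \<le> sqrt (norm (f\<^sup>\<star> * f))"
    proof (rule norm_bound)
      fix x
      show "norm (apply_bcontfun f x) \<le> sqrt (norm (f\<^sup>\<star> * f))"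
        using norm_bounded[of "f\<^sup>\<star> * f" x] by (intro real_le_rsqrt) (simp add: sq)
    qed
    then show "(norm f)\<^sup>2 \<le> norm (f\<^sup>\<star> * f)"
      using power_mono[of "norm f" "sqrt (norm (f\<^sup>\<star> * f))" 2] by simp
  qed
qed (auto intro!: bcontfun_eqI simp: one_bcontfun.rep_eq times_bcontfun.rep_eq
      scaleC_bcontfun.rep_eq star_bcontfun.rep_eq algebra_simps scaleC_add_left scaleC_add_right
      scaleC_scaleC scaleC_of_real scaleC_mult_left scaleC_mult_right star_star star_add
      star_scaleC star_mult)

end

section \<open>Homomorphisms, functionals and states\<close>

(* Boundedness is automatic for *-homomorphisms between C*-algebras and for positive functionals;
   it is listed so that both notions come with it. *)
definition unital_star_hom :: "('a::cstar_algebra \<Rightarrow> 'b::cstar_algebra) \<Rightarrow> bool" where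
  "unital_star_hom h \<longleftrightarrow> bounded_linear h \<and> (\<forall>z x. h (z *\<^sub>C x) = z *\<^sub>C h x) \<and>
     (\<forall>x y. h (x * y) = h x * h y) \<and> (\<forall>x. h (x\<^sup>\<star>) = (h x)\<^sup>\<star>) \<and> h 1 = 1"

definition bounded_functional :: "('a::cstar_algebra \<Rightarrow> complex) \<Rightarrow> bool" where
  "bounded_functional \<phi> \<longleftrightarrow> bounded_linear \<phi> \<and> (\<forall>z x. \<phi> (z *\<^sub>C x) = z * \<phi> x)"

definition state :: "('a::cstar_algebra \<Rightarrow> complex) \<Rightarrow> bool" where
  "state \<phi> \<longleftrightarrow> bounded_functional \<phi> \<and> (\<forall>x. \<phi> (x\<^sup>\<star> * x) \<in> \<real>\<^sub>\<ge>\<^sub>0) \<and> \<phi> 1 = 1"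

(* The convention x^{-k} = (x^* )^k for k > 0. *)
definition spow :: "'a::cstar_algebra \<Rightarrow> int \<Rightarrow> 'a" where
  "spow x k = (if 0 \<le> k then x ^ nat k else (x\<^sup>\<star>) ^ nat (- k))"

section \<open>Minimal tensor products\<close>

(* Finite sums of elementary tensors are represented by lists of pairs. *)
definition tensor_sum :: "('a \<Rightarrow> 'b \<Rightarrow> 't::comm_monoid_add) \<Rightarrow> ('a \<times> 'b) list \<Rightarrow> 't" where
  "tensor_sum t xs = (\<Sum>(a, b)\<leftarrow>xs. t a b)"

definition tensor_list_mult ::
    "('a::times \<times> 'b::times) list \<Rightarrow> ('a \<times> 'b) list \<Rightarrow> ('a \<times> 'b) list" where
  "tensor_list_mult xs ys = [(a * a', b * b'). (a, b) \<leftarrow> xs, (a', b') \<leftarrow> ys]"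

(* The value (\<phi> \<otimes> \<psi>)(x^* x) for x = \<Sum> a \<otimes> b in the algebraic tensor product, that is, the squared
   norm of (\<pi>_\<phi> \<otimes> \<pi>_\<psi>)(x) (\<Omega>_\<phi> \<otimes> \<Omega>_\<psi>) for the GNS representations of \<phi> and \<psi>. *)
definition product_sqnorm ::
    "('a::cstar_algebra \<Rightarrow> complex) \<Rightarrow> ('b::cstar_algebra \<Rightarrow> complex) \<Rightarrow> ('a \<times> 'b) list \<Rightarrow> real" where
  "product_sqnorm \<phi> \<psi> xs = Re (\<Sum>(a, b)\<leftarrow>xs. \<Sum>(a', b')\<leftarrow>xs. \<phi> (a\<^sup>\<star> * a') * \<psi> (b\<^sup>\<star> * b'))"

(* The supremum of the operator norms of (\<pi>_\<phi> \<otimes> \<pi>_\<psi>)(x) over all pairs of states; each operator norm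
   is computed on the dense set of vectors (\<pi>_\<phi> \<otimes> \<pi>_\<psi>)(y) (\<Omega>_\<phi> \<otimes> \<Omega>_\<psi>). As the direct sum of all GNS
   representations is faithful, this is the spatial norm. *)
definition spatial_norm :: "('a::cstar_algebra \<times> 'b::cstar_algebra) list \<Rightarrow> real" where
  "spatial_norm xs = Sup {sqrt (product_sqnorm \<phi> \<psi> (tensor_list_mult xs ys)) | \<phi> \<psi> ys.
     state \<phi> \<and> state \<psi> \<and> product_sqnorm \<phi> \<psi> ys = 1}"

(* 't together with t is (a model of) the C*-algebra 'a \<otimes> 'b, the completion of the algebraic tensor
   product in the spatial norm; t a b is the elementary tensor. *)
definition min_tensor ::
    "('a::cstar_algebra \<Rightarrow> 'b::cstar_algebra \<Rightarrow> 't::cstar_algebra) \<Rightarrow> bool" where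
  "min_tensor t \<longleftrightarrow>
     (\<forall>a a' b. t (a + a') b = t a b + t a' b) \<and>
     (\<forall>a b b'. t a (b + b') = t a b + t a b') \<and>
     (\<forall>z a b. t (z *\<^sub>C a) b = z *\<^sub>C t a b \<and> t a (z *\<^sub>C b) = z *\<^sub>C t a b) \<and>
     (\<forall>a a' b b'. t a b * t a' b' = t (a * a') (b * b')) \<and>
     (\<forall>a b. (t a b)\<^sup>\<star> = t (a\<^sup>\<star>) (b\<^sup>\<star>)) \<and>
     t 1 1 = 1 \<and>
     (\<forall>xs. norm (tensor_sum t xs) = spatial_norm xs) \<and>
     closure (range (tensor_sum t)) = UNIV"

definition product_functional :: "('a \<Rightarrow> 'b \<Rightarrow> 't::cstar_algebra) \<Rightarrow>
    ('a \<Rightarrow> complex) \<Rightarrow> ('b \<Rightarrow> complex) \<Rightarrow> 't \<Rightarrow> complex" where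
  "product_functional t \<phi> \<psi> =
     (THE \<omega>. bounded_functional \<omega> \<and> (\<forall>a b. \<omega> (t a b) = \<phi> a * \<psi> b))"

definition idempotent_state ::
    "('a \<Rightarrow> 'a \<Rightarrow> 't::cstar_algebra) \<Rightarrow> ('a::cstar_algebra \<Rightarrow> 't) \<Rightarrow> ('a \<Rightarrow> complex) \<Rightarrow> bool" where
  "idempotent_state t \<Delta> \<phi> \<longleftrightarrow> state \<phi> \<and> product_functional t \<phi> \<phi> \<circ> \<Delta> = \<phi>"

section \<open>Universal \<open>C\<^sup>*\<close>-algebras given by generators and relations\<close>

(* Words in the letters x and x^*, for x a generator; the letter (x, True) is x^*. *)
datatype 'g star_word = Word (letters: "('g \<times> bool) list")

instantiation star_word :: (type) monoid_add
begin

definition zero_star_word :: "'a star_word" where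
  "0 = Word []"

definition plus_star_word :: "'a star_word \<Rightarrow> 'a star_word \<Rightarrow> 'a star_word" where
  "u + v = Word (letters u @ letters v)"

instance
  by standard (auto simp: zero_star_word_def plus_star_word_def)

end

(* The free unital *-algebra, as the monoid algebra of words (whence the ring structure);
   scalars are embedded as multiples of the empty word. *)
type_synonym 'g free_star_algebra = "'g star_word \<Rightarrow>\<^sub>0 complex"

definition free_gen :: "'g \<Rightarrow> 'g free_star_algebra" where
  "free_gen i = Poly_Mapping.single (Word [(i, False)]) 1"

definition free_scaleC :: "complex \<Rightarrow> 'g free_star_algebra \<Rightarrow> 'g free_star_algebra" where
  "free_scaleC z x = Poly_Mapping.single 0 z * x"

definition free_star :: "'g free_star_algebra \<Rightarrow> 'g free_star_algebra" where
  "free_star x = (\<Sum>u\<in>Poly_Mapping.keys x.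
     Poly_Mapping.single (Word (rev (map (\<lambda>(i, b). (i, \<not> b)) (letters u))))
       (cnj (Poly_Mapping.lookup x u)))"

definition free_eval :: "('g \<Rightarrow> 'a::cstar_algebra) \<Rightarrow> 'g free_star_algebra \<Rightarrow> 'a" where
  "free_eval f x = (\<Sum>u\<in>Poly_Mapping.keys x.
     Poly_Mapping.lookup x u *\<^sub>C (\<Prod>(i, b)\<leftarrow>letters u. if b then (f i)\<^sup>\<star> else f i))"

definition cstar_seminorm :: "('g free_star_algebra \<Rightarrow> real) \<Rightarrow> bool" where
  "cstar_seminorm p \<longleftrightarrow>
     (\<forall>x y. p (x + y) \<le> p x + p y) \<and> (\<forall>z x. p (free_scaleC z x) = cmod z * p x) \<and>
     (\<forall>x y. p (x * y) \<le> p x * p y) \<and> (\<forall>x. p (free_star x * x) = (p x)\<^sup>2)"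

(* 'a together with the elements f i is (a model of) the universal C*-algebra with generators f i
   and relations r = 0 for r \<in> R; equivalently, the enveloping C*-algebra of the *-algebra
   presented by R, whose C*-seminorms are the C*-seminorms on the free *-algebra that vanish on R:
   it is the completion in the largest of these. *)
definition universal_cstar ::
    "'g free_star_algebra set \<Rightarrow> ('g \<Rightarrow> 'a::cstar_algebra) \<Rightarrow> bool" where
  "universal_cstar R f \<longleftrightarrow>
     (\<forall>r\<in>R. free_eval f r = 0) \<and>
     closure (range (free_eval f)) = UNIV \<and>
     (\<forall>p. cstar_seminorm p \<and> (\<forall>r\<in>R. p r = 0) \<longrightarrow> (\<forall>x. p x \<le> norm (free_eval f x)))"

section \<open>The circle, the torus and Haar measures of closed subgroups\<close>

typedef circle = "{z :: complex. cmod z = 1}" morphisms circle_val to_circle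
  by (rule exI[of _ 1]) simp

setup_lifting type_definition_circle

instantiation circle :: metric_space
begin

definition dist_circle :: "circle \<Rightarrow> circle \<Rightarrow> real" where
  "dist_circle x y = dist (circle_val x) (circle_val y)"

definition uniformity_circle :: "(circle \<times> circle) filter" where
  "uniformity_circle = (INF e\<in>{0 <..}. principal {(x, y). dist x y < e})"

definition open_circle :: "circle set \<Rightarrow> bool" where
  "open_circle S = (\<forall>x\<in>S. \<forall>\<^sub>F (x', y) in uniformity. x' = x \<longrightarrow> y \<in> S)"

instance
  by standard
    (auto simp: dist_circle_def uniformity_circle_def open_circle_def circle_val_inject
      dist_triangle2)

end

lift_definition circle_one :: circle is 1
  by simp

lift_definition circle_mult :: "circle \<Rightarrow> circle \<Rightarrow> circle" is "(*)"
  by (simp add: norm_mult)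

lifting_update circle.lifting
lifting_forget circle.lifting

definition circle_group :: "circle monoid" where
  "circle_group = \<lparr>carrier = UNIV, mult = circle_mult, one = circle_one\<rparr>"

definition torus_group :: "(circle \<times> circle) monoid" where
  "torus_group = circle_group \<times>\<times> circle_group"

(* Normalized Haar measure of the subgroup H, as a Borel measure on the ambient group. *)
definition haar_measure_of ::
    "('a::topological_space) monoid \<Rightarrow> 'a set \<Rightarrow> 'a measure \<Rightarrow> bool" where
  "haar_measure_of G H \<mu> \<longleftrightarrow> sets \<mu> = sets borel \<and> prob_space \<mu> \<and> emeasure \<mu> H = 1 \<and>
     (\<forall>h\<in>H. distr \<mu> borel (\<lambda>x. h \<otimes>\<^bsub>G\<^esub> x) = \<mu>)"

lemma circle_val_norm [simp]: "cmod (circle_val x) = 1"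
  using circle_val[of x] by simp

lemma continuous_on_circle_val [continuous_intros]:
  "continuous_on A g \<Longrightarrow> continuous_on A (\<lambda>x. circle_val (g x))"
proof -
  have "continuous_on UNIV circle_val"
    by (rule continuous_on_iff[THEN iffD2]) (auto simp: dist_circle_def)
  then show "continuous_on A g \<Longrightarrow> continuous_on A (\<lambda>x. circle_val (g x))"
    by (rule continuous_on_compose2) auto
qed

lemma continuous_on_circle_mult [continuous_intros]:
  assumes "continuous_on A f" "continuous_on A g"
  shows "continuous_on A (\<lambda>x. circle_mult (f x) (g x))"
proof -
  have "continuous_on A (\<lambda>x. circle_val (f x) * circle_val (g x))"
    using assms by (intro continuous_intros)
  then have "continuous_on A (\<lambda>x. circle_val (circle_mult (f x) (g x)))"
    by (simp add: circle_mult.rep_eq)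
  then show ?thesis
    by (simp add: continuous_on_def tendsto_iff dist_circle_def)
qed

lift_definition circle_coord :: "circle \<Rightarrow>\<^sub>C complex" is circle_val
  by (rule bcontfun_normI[where b = 1]) (auto intro!: continuous_intros)

definition torus_coord1 :: "(circle \<times> circle) \<Rightarrow>\<^sub>C complex" where
  "torus_coord1 = Bcontfun (\<lambda>z. circle_val (fst z))"

definition torus_coord2 :: "(circle \<times> circle) \<Rightarrow>\<^sub>C complex" where
  "torus_coord2 = Bcontfun (\<lambda>z. circle_val (snd z))"

(* C(U(1)) \<otimes> C(U(1)) is realized as C(U(1) \<times> U(1)). *)
definition circle_tensor ::
    "(circle \<Rightarrow>\<^sub>C complex) \<Rightarrow> (circle \<Rightarrow>\<^sub>C complex) \<Rightarrow> ((circle \<times> circle) \<Rightarrow>\<^sub>C complex)" where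
  "circle_tensor f g = Bcontfun (\<lambda>z. apply_bcontfun f (fst z) * apply_bcontfun g (snd z))"

definition circle_coproduct ::
    "(circle \<Rightarrow>\<^sub>C complex) \<Rightarrow> ((circle \<times> circle) \<Rightarrow>\<^sub>C complex)" where
  "circle_coproduct f = Bcontfun (\<lambda>z. apply_bcontfun f (circle_mult (fst z) (snd z)))"

lemma apply_torus_coord1 [simp]: "apply_bcontfun torus_coord1 z = circle_val (fst z)"
  unfolding torus_coord1_def
  by (subst Bcontfun_inverse)
    (auto intro!: bcontfun_normI[where b = 1] continuous_intros)

lemma apply_torus_coord2 [simp]: "apply_bcontfun torus_coord2 z = circle_val (snd z)"
  unfolding torus_coord2_def
  by (subst Bcontfun_inverse)
    (auto intro!: bcontfun_normI[where b = 1] continuous_intros)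

lemma apply_circle_tensor [simp]:
  "apply_bcontfun (circle_tensor f g) z = apply_bcontfun f (fst z) * apply_bcontfun g (snd z)"
proof -
  have "continuous_on UNIV (\<lambda>z :: circle \<times> circle. apply_bcontfun h (fst z))"
    and "continuous_on UNIV (\<lambda>z :: circle \<times> circle. apply_bcontfun h (snd z))"
    for h :: "circle \<Rightarrow>\<^sub>C complex"
    by (rule continuous_on_compose2[of UNIV "apply_bcontfun h"]; auto intro!: continuous_intros)+
  moreover have "norm (apply_bcontfun f (fst z) * apply_bcontfun g (snd z)) \<le> norm f * norm g"
    for z :: "circle \<times> circle"
    by (simp add: norm_mult mult_mono norm_bounded)
  ultimately have "(\<lambda>z. apply_bcontfun f (fst z) * apply_bcontfun g (snd z)) \<in> bcontfun"
    by (intro bcontfun_normI) (auto intro!: continuous_intros)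
  then show ?thesis by (simp add: circle_tensor_def Bcontfun_inverse)
qed

lemma apply_circle_coproduct [simp]:
  "apply_bcontfun (circle_coproduct f) z = apply_bcontfun f (circle_mult (fst z) (snd z))"
proof -
  have "continuous_on UNIV (\<lambda>z. apply_bcontfun f (circle_mult (fst z) (snd z)))"
    by (rule continuous_on_compose2[of UNIV "apply_bcontfun f"]) (auto intro!: continuous_intros)
  then have "(\<lambda>z. apply_bcontfun f (circle_mult (fst z) (snd z))) \<in> bcontfun"
    by (rule bcontfun_normI) (rule norm_bounded)
  then show ?thesis by (simp add: circle_coproduct_def Bcontfun_inverse)
qed

(* The group of m-th roots of unity, and the whole circle for m = \<infinity>. *)
definition circle_subgroup :: "enat \<Rightarrow> circle set" where
  "circle_subgroup m = (case m of enat k \<Rightarrow> {z. circle_val z ^ k = 1} | \<infinity> \<Rightarrow> UNIV)"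

definition circle_state :: "enat \<Rightarrow> (circle \<Rightarrow>\<^sub>C complex) \<Rightarrow> complex" where
  "circle_state m f =
     (\<integral>z. apply_bcontfun f z \<partial>(THE \<mu>. haar_measure_of circle_group (circle_subgroup m) \<mu>))"

section \<open>The quantum semigroups \<open>U\<^sub>0(2)\<close> and \<open>SU\<^sub>0(2)\<close>\<close>

datatype U02_gen = Ga | Gc | Gv

definition U02_relations :: "U02_gen free_star_algebra set" where
  "U02_relations =
    (let a = free_gen Ga; c = free_gen Gc; v = free_gen Gv;
         a' = free_star a; c' = free_star c; v' = free_star v
     in {a * v - v * a, c * v - v * c, c * c' - c' * c, v * v' - 1, v' * v - 1,
         a * c, a * c', a * a' - 1, a' * a + c' * c - 1})"

definition C_U02 :: "'a::cstar_algebra \<Rightarrow> 'a \<Rightarrow> 'a \<Rightarrow> bool" where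
  "C_U02 a c v \<longleftrightarrow>
     universal_cstar U02_relations (\<lambda>i. case i of Ga \<Rightarrow> a | Gc \<Rightarrow> c | Gv \<Rightarrow> v)"

definition U02_coproduct :: "('a::cstar_algebra \<Rightarrow> 'a \<Rightarrow> 't::cstar_algebra) \<Rightarrow>
    'a \<Rightarrow> 'a \<Rightarrow> 'a \<Rightarrow> 'a \<Rightarrow> 't" where
  "U02_coproduct t a c v = (THE \<Delta>. unital_star_hom \<Delta> \<and>
     \<Delta> a = t a a \<and> \<Delta> c = t c a + t (a\<^sup>\<star> * v\<^sup>\<star>) c \<and> \<Delta> v = t v v)"

definition U02_counit :: "'a::cstar_algebra \<Rightarrow> 'a \<Rightarrow> 'a \<Rightarrow> 'a \<Rightarrow> complex" where
  "U02_counit a c v = (THE \<epsilon>. unital_star_hom \<epsilon> \<and> \<epsilon> a = 1 \<and> \<epsilon> c = 0 \<and> \<epsilon> v = 1)"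

definition U02_to_torus ::
    "'a::cstar_algebra \<Rightarrow> 'a \<Rightarrow> 'a \<Rightarrow> 'a \<Rightarrow> ((circle \<times> circle) \<Rightarrow>\<^sub>C complex)" where
  "U02_to_torus a c v = (THE \<pi>. unital_star_hom \<pi> \<and>
     \<pi> a = torus_coord1 \<and> \<pi> c = 0 \<and> \<pi> v = torus_coord2)"

definition torus_state :: "'a::cstar_algebra \<Rightarrow> 'a \<Rightarrow> 'a \<Rightarrow>
    (circle \<times> circle) measure \<Rightarrow> 'a \<Rightarrow> complex" where
  "torus_state a c v \<rho> x = (\<integral>z. apply_bcontfun (U02_to_torus a c v x) z \<partial>\<rho>)"

datatype SU02_gen = Galpha | Ggamma

definition SU02_relations :: "SU02_gen free_star_algebra set" where
  "SU02_relations =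
    (let \<alpha> = free_gen Galpha; \<gamma> = free_gen Ggamma; \<alpha>' = free_star \<alpha>; \<gamma>' = free_star \<gamma>
     in {\<alpha> * \<gamma>, \<alpha> * \<gamma>', \<gamma> * \<gamma>' - \<gamma>' * \<gamma>, \<alpha> * \<alpha>' - 1, \<alpha>' * \<alpha> + \<gamma>' * \<gamma> - 1})"

definition C_SU02 :: "'b::cstar_algebra \<Rightarrow> 'b \<Rightarrow> bool" where
  "C_SU02 \<alpha> \<gamma> \<longleftrightarrow>
     universal_cstar SU02_relations (\<lambda>i. case i of Galpha \<Rightarrow> \<alpha> | Ggamma \<Rightarrow> \<gamma>)"

definition SU02_coproduct :: "('b::cstar_algebra \<Rightarrow> 'b \<Rightarrow> 't::cstar_algebra) \<Rightarrow>
    'b \<Rightarrow> 'b \<Rightarrow> 'b \<Rightarrow> 't" where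
  "SU02_coproduct t \<alpha> \<gamma> = (THE \<Delta>. unital_star_hom \<Delta> \<and>
     \<Delta> \<alpha> = t \<alpha> \<alpha> \<and> \<Delta> \<gamma> = t \<gamma> \<alpha> + t (\<alpha>\<^sup>\<star>) \<gamma>)"

definition SU02_state :: "'b::cstar_algebra \<Rightarrow> 'b \<Rightarrow> nat \<Rightarrow> 'b \<Rightarrow> complex" where
  "SU02_state \<alpha> \<gamma> n = (THE \<psi>. state \<psi> \<and>
     (\<forall>r s k. \<psi> ((\<alpha>\<^sup>\<star>) ^ r * spow \<gamma> k * \<alpha> ^ s) = (if r = s \<and> s \<le> n \<and> k = 0 then 1 else 0)))"

(* The identification C(U_0(2)) \<cong> C(SU_0(2)) \<otimes> C(U(1)), with t the elementary tensors of the latter. *)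
definition U02_identification ::
    "('b::cstar_algebra \<Rightarrow> (circle \<Rightarrow>\<^sub>C complex) \<Rightarrow> 't::cstar_algebra) \<Rightarrow>
     'a::cstar_algebra \<Rightarrow> 'a \<Rightarrow> 'a \<Rightarrow> 'b \<Rightarrow> 'b \<Rightarrow> 'a \<Rightarrow> 't" where
  "U02_identification t a c v \<alpha> \<gamma> = (THE \<theta>. unital_star_hom \<theta> \<and>
     \<theta> a = t \<alpha> 1 \<and> \<theta> c = t \<gamma> 1 \<and> \<theta> v = t 1 circle_coord)"

definition U02_Psi ::
    "('b::cstar_algebra \<Rightarrow> (circle \<Rightarrow>\<^sub>C complex) \<Rightarrow> 't::cstar_algebra) \<Rightarrow>
     'a::cstar_algebra \<Rightarrow> 'a \<Rightarrow> 'a \<Rightarrow> 'b \<Rightarrow> 'b \<Rightarrow> nat \<Rightarrow> enat \<Rightarrow> 'a \<Rightarrow> complex" where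
  "U02_Psi t a c v \<alpha> \<gamma> n m =
     product_functional t (SU02_state \<alpha> \<gamma> n) (circle_state m) \<circ> U02_identification t a c v \<alpha> \<gamma>"

end

theory Submission
  imports Defs "HOL-Probability.Probability_Mass_Function"
begin

text \<open>
  The elements \<open>(a\<^sup>\<star>)\<^sup>r a\<^sup>s v\<^sup>l\<close> are group-like, so an idempotent state \<open>\<phi>\<close> takes only the values 0 and 1
  on them, and \<open>r \<mapsto> \<phi> ((a\<^sup>\<star>)\<^sup>r a\<^sup>r)\<close> is a decreasing sequence starting at 1. If it is constantly 1, then
  \<open>\<phi>\<close> kills \<open>c\<^sup>\<star>c = 1 - a\<^sup>\<star>a\<close> together with its translates by powers of \<open>a\<close>, hence factors through
  the torus, and the elements with value 1 form a subgroup of \<open>\<int>\<^sup>2\<close>, the annihilator of a closed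
  subgroup of the torus. If it drops to 0 after \<open>r = n\<close>, then \<open>a\<^sup>n\<^sup>+\<^sup>1\<close> lies in the left kernel of \<open>\<phi>\<close>.
  As \<open>(c \<otimes> a) (a\<^sup>\<star>v\<^sup>\<star> \<otimes> c) = 0\<close>, the coproduct of \<open>c\<^sup>k\<close> is \<open>\<Sum>\<^sub>i (a\<^sup>\<star>v\<^sup>\<star>)\<^sup>i c\<^sup>k\<^sup>-\<^sup>i \<otimes> c\<^sup>i a\<^sup>k\<^sup>-\<^sup>i\<close>, and every
  term of the resulting formula for \<open>\<phi> ((a\<^sup>\<star>)\<^sup>n c\<^sup>k a\<^sup>n v\<^sup>l)\<close> vanishes, which leaves \<open>\<psi>\<^sub>n \<otimes> \<phi>\<^sub>m\<close>. The same
  formula shows that both families consist of idempotent states.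
\<close>

section \<open>States on unital \<open>C\<^sup>*\<close>-algebras\<close>

text \<open>The objects of the statement are given by definite descriptions, so each has to be shown
  to exist, and this takes most of the length. Homomorphisms come from the maximality of the
  universal norm among C*-seminorms, product functionals from a direct bound by the spatial norm,
  and \<open>\<psi>\<^sub>n\<close> from a representation whose operator norm is one of the
  competing seminorms. Values 0 and 1 arise because idempotence on a group-like element reads
  \<open>m = m * m\<close>; their sequence decreases because the
  \<open>(a\<^sup>\<star>) ^ r * a ^ r\<close> are decreasing projections. Once it drops, no
  \<open>a ^ j\<close> times a power of \<open>v\<close> with \<open>j > 0\<close> has value 1: it
  would lie in the multiplicative domain, and the value 1 would persist for its powers until they
  reach the left kernel. The coproduct of \<open>c ^ k\<close> is needed only at the corner
  \<open>r = s = n\<close>: below it, equality of consecutive values kills the words through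
  \<open>c\<^sup>\<star> * c\<close>, and beyond it the left kernel does. In the torus case no
  subgroup is recovered from the state: one with the prescribed annihilator is built by hand, and
  agreement on monomials does the rest.\<close>

lemma scaleC_one_left [simp]: "1 *\<^sub>C x = (x :: 'a::cstar_algebra)"
  using scaleC_of_real[of 1 x] by simp

lemma scaleC_zero_left [simp]: "0 *\<^sub>C x = (0 :: 'a::cstar_algebra)"
  using scaleC_of_real[of 0 x] by simp

lemma scaleC_zero_right [simp]: "z *\<^sub>C (0 :: 'a::cstar_algebra) = 0"
  using scaleC_add_right[of z "0::'a" 0] by simp

lemma scaleR_eq_scaleC: "r *\<^sub>R (x :: 'a::cstar_algebra) = complex_of_real r *\<^sub>C x"
  by (simp add: scaleC_of_real)

lemma bounded_linear_scaleC: "bounded_linear (\<lambda>x :: 'a::cstar_algebra. z *\<^sub>C x)"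
proof (rule bounded_linear_intro[where K = "cmod z"])
  show "z *\<^sub>C (r *\<^sub>R x) = r *\<^sub>R (z *\<^sub>C x)" for r and x :: 'a
    by (simp add: scaleR_eq_scaleC scaleC_scaleC mult.commute)
qed (auto simp: scaleC_add_right norm_scaleC)

lemma scaleC_diff_right: "z *\<^sub>C (x - y) = z *\<^sub>C x - z *\<^sub>C (y :: 'a::cstar_algebra)"
  using linear_diff[OF bounded_linear.linear[OF bounded_linear_scaleC]] .

lemma star_zero [simp]: "(0 :: 'a::cstar_algebra)\<^sup>\<star> = 0"
  using star_add[of "0::'a" 0] by simp

lemma star_one [simp]: "(1 :: 'a::cstar_algebra)\<^sup>\<star> = 1"
  using star_mult[of "(1 :: 'a)\<^sup>\<star>" 1] by (simp add: star_star)

lemma star_power: "(x ^ n)\<^sup>\<star> = ((x :: 'a::cstar_algebra)\<^sup>\<star>) ^ n"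
  by (induction n) (simp_all add: star_mult power_commutes)

lemma norm_star [simp]: "norm (x\<^sup>\<star>) = norm (x :: 'a::cstar_algebra)"
proof -
  have le: "norm u \<le> norm (u\<^sup>\<star>)" for u :: 'a
  proof (cases "u = 0")
    case False
    have "norm u * norm u \<le> norm (u\<^sup>\<star>) * norm u"
      using norm_mult_ineq[of "u\<^sup>\<star>" u] by (simp add: cstar_identity power2_eq_square)
    then show ?thesis using False by simp
  qed simp
  show ?thesis using le[of x] le[of "x\<^sup>\<star>"] by (simp add: star_star)
qed

lemma bounded_linear_star: "bounded_linear (star :: 'a::cstar_algebra \<Rightarrow> 'a)"
  by (rule bounded_linear_intro[where K = 1])
    (auto simp: star_add star_scaleC scaleR_eq_scaleC)

lemma star_diff: "(x - y)\<^sup>\<star> = (x :: 'a::cstar_algebra)\<^sup>\<star> - y\<^sup>\<star>"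
  using linear_diff[OF bounded_linear.linear[OF bounded_linear_star]] .

lemma star_sum: "(\<Sum>i\<in>I. f i)\<^sup>\<star> = (\<Sum>i\<in>I. (f i :: 'a::cstar_algebra)\<^sup>\<star>)"
  using linear_sum[OF bounded_linear.linear[OF bounded_linear_star]] .

lemma continuous_on_scaleC [continuous_intros]:
  "continuous_on S f \<Longrightarrow> continuous_on S (\<lambda>x. z *\<^sub>C (f x :: 'a::cstar_algebra))"
  by (rule bounded_linear.continuous_on[OF bounded_linear_scaleC])

lemma continuous_on_star [continuous_intros]:
  "continuous_on S f \<Longrightarrow> continuous_on S (\<lambda>x. (f x :: 'a::cstar_algebra)\<^sup>\<star>)"
  by (rule bounded_linear.continuous_on[OF bounded_linear_star])

text \<open>The discriminant argument, phrased for the values \<open>P = \<langle>x, x\<rangle>\<close>, \<open>Q = \<langle>y, y\<rangle>\<close> and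
  \<open>R = \<langle>x, y\<rangle>\<close> of a semi-inner product, so that it also applies to forms on formal sums that
  do not make up a vector space type.\<close>

lemma cauchy_schwarz_scalar:
  fixes P Q :: real and R :: complex
  assumes nonneg: "\<And>z. P + 2 * Re (z * R) + (cmod z)\<^sup>2 * Q \<ge> 0" and "P \<ge> 0" "Q \<ge> 0"
  shows "(cmod R)\<^sup>2 \<le> P * Q"
proof (cases "Q = 0")
  case False
  have "0 \<le> P + 2 * Re (- (cnj R / of_real Q) * R) + (cmod (cnj R / of_real Q))\<^sup>2 * Q"
    using nonneg[of "- (cnj R / of_real Q)"] by simp
  also have "- (cnj R / of_real Q) * R = of_real (- (cmod R)\<^sup>2 / Q)"
    by (simp add: complex_norm_square mult.commute del: of_real_power)
  also have "(cmod (cnj R / of_real Q))\<^sup>2 * Q = (cmod R)\<^sup>2 / Q"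
    using \<open>Q \<ge> 0\<close> False by (simp add: norm_divide power_divide power2_eq_square)
  finally have "(cmod R)\<^sup>2 / Q \<le> P" by simp
  then show ?thesis using \<open>Q \<ge> 0\<close> False by (simp add: field_simps)
next
  case True
  have "R = 0"
  proof (rule ccontr)
    assume "R \<noteq> 0"
    \<comment> \<open>For \<open>Q = 0\<close> the expression is affine in \<open>z\<close>; this
      multiple of \<open>cnj R\<close> brings it down to \<open>- P - 2\<close>.\<close>
    define z where "z = - of_real ((P + 1) / (cmod R)\<^sup>2) * cnj R"
    have "z * R = - of_real ((P + 1) / (cmod R)\<^sup>2) * of_real ((cmod R)\<^sup>2)"
      unfolding z_def complex_norm_square by (simp add: mult_ac)
    also have "\<dots> = of_real (- (P + 1))"
      using \<open>R \<noteq> 0\<close> by simp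
    finally have "Re (z * R) = - (P + 1)" by simp
    then show False using nonneg[of z] True \<open>P \<ge> 0\<close> by simp
  qed
  then show ?thesis using assms by simp
qed

context
  fixes \<phi> :: "'a::cstar_algebra \<Rightarrow> complex"
  assumes bf: "bounded_functional \<phi>"
begin

lemma functional_linear: "bounded_linear \<phi>"
  using bf by (simp add: bounded_functional_def)

lemma functional_add: "\<phi> (x + y) = \<phi> x + \<phi> y"
  using linear_add[OF bounded_linear.linear[OF functional_linear]] .

lemma functional_diff: "\<phi> (x - y) = \<phi> x - \<phi> y"
  using linear_diff[OF bounded_linear.linear[OF functional_linear]] .

lemma functional_zero: "\<phi> 0 = 0"
  using linear_0[OF bounded_linear.linear[OF functional_linear]] .

lemma functional_sum: "\<phi> (\<Sum>i\<in>I. f i) = (\<Sum>i\<in>I. \<phi> (f i))"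
  using linear_sum[OF bounded_linear.linear[OF functional_linear]] .

lemma functional_scaleC: "\<phi> (z *\<^sub>C x) = z * \<phi> x"
  using bf by (simp add: bounded_functional_def)

lemma continuous_on_functional: "continuous_on S f \<Longrightarrow> continuous_on S (\<lambda>x. \<phi> (f x))"
  by (rule bounded_linear.continuous_on[OF functional_linear])

end

context
  fixes \<phi> :: "'a::cstar_algebra \<Rightarrow> complex"
  assumes st: "state \<phi>"
begin

lemma state_functional: "bounded_functional \<phi>"
  using st by (simp add: state_def)

lemmas state_add = functional_add[OF state_functional]
lemmas state_diff = functional_diff[OF state_functional]
lemmas state_zero = functional_zero[OF state_functional]
lemmas state_sum = functional_sum[OF state_functional]
lemmas state_scaleC = functional_scaleC[OF state_functional]

lemma state_one: "\<phi> 1 = 1"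
  using st by (simp add: state_def)

lemma state_pos: "\<phi> (x\<^sup>\<star> * x) \<in> \<real>\<^sub>\<ge>\<^sub>0"
  using st by (simp add: state_def)

lemma state_pos_Re: "Re (\<phi> (x\<^sup>\<star> * x)) \<ge> 0" "Im (\<phi> (x\<^sup>\<star> * x)) = 0"
  using state_pos[of x] by (auto simp: nonneg_Reals_def)

text \<open>Polarization: positivity at \<open>1 + x\<close> and at \<open>1 + \<i>x\<close>.\<close>

lemma state_star: "\<phi> (x\<^sup>\<star>) = cnj (\<phi> x)"
proof -
  have *: "Im (\<phi> ((1 + z *\<^sub>C x)\<^sup>\<star> * (1 + z *\<^sub>C x))) = Im (z * \<phi> x + cnj z * \<phi> (x\<^sup>\<star>))" for z
  proof -
    have "(1 + z *\<^sub>C x)\<^sup>\<star> * (1 + z *\<^sub>C x)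
        = 1 + z *\<^sub>C x + cnj z *\<^sub>C x\<^sup>\<star> + (z *\<^sub>C x)\<^sup>\<star> * (z *\<^sub>C x)"
      by (simp add: star_add star_scaleC distrib_left distrib_right)
    then show ?thesis using state_pos_Re(2)[of "z *\<^sub>C x"]
      by (simp add: state_add state_scaleC state_one)
  qed
  have "Im (\<phi> x + \<phi> (x\<^sup>\<star>)) = 0" "Re (\<phi> x) - Re (\<phi> (x\<^sup>\<star>)) = 0"
    using *[of 1] *[of \<i>] state_pos_Re(2)[of "1 + x"] state_pos_Re(2)[of "1 + \<i> *\<^sub>C x"] by simp_all
  then show ?thesis by (simp add: complex_eq_iff)
qed

lemma state_cauchy_schwarz: "(cmod (\<phi> (x\<^sup>\<star> * y)))\<^sup>2 \<le> Re (\<phi> (x\<^sup>\<star> * x)) * Re (\<phi> (y\<^sup>\<star> * y))"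
proof (rule cauchy_schwarz_scalar)
  fix z
  have "(x + z *\<^sub>C y)\<^sup>\<star> * (x + z *\<^sub>C y)
      = x\<^sup>\<star> * x + z *\<^sub>C (x\<^sup>\<star> * y) + cnj z *\<^sub>C (x\<^sup>\<star> * y)\<^sup>\<star> + (z * cnj z) *\<^sub>C (y\<^sup>\<star> * y)"
    by (simp add: star_add star_scaleC star_mult star_star distrib_left distrib_right
        scaleC_mult_left scaleC_mult_right scaleC_scaleC scaleC_add_right mult.commute add.assoc)
  then have "\<phi> ((x + z *\<^sub>C y)\<^sup>\<star> * (x + z *\<^sub>C y)) = \<phi> (x\<^sup>\<star> * x) + (z * \<phi> (x\<^sup>\<star> * y)
      + cnj (z * \<phi> (x\<^sup>\<star> * y))) + complex_of_real ((cmod z)\<^sup>2) * \<phi> (y\<^sup>\<star> * y)"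
    by (simp only: state_add state_scaleC state_star complex_norm_square complex_cnj_mult add.assoc)
  then show "0 \<le> Re (\<phi> (x\<^sup>\<star> * x)) + 2 * Re (z * \<phi> (x\<^sup>\<star> * y)) + (cmod z)\<^sup>2 * Re (\<phi> (y\<^sup>\<star> * y))"
    using state_pos_Re(1)[of "x + z *\<^sub>C y"] by (simp del: of_real_power)
qed (auto simp: state_pos_Re)

text \<open>Cauchy--Schwarz: an element of length zero for \<open>\<phi>\<close> spoils every
  product that ends in it. Together with its mirror image this produces the zeros among the values
  of an idempotent state.\<close>

lemma state_null_right:
  assumes "\<phi> (y\<^sup>\<star> * y) = 0"
  shows "\<phi> (x * y) = 0"
  using state_cauchy_schwarz[of "x\<^sup>\<star>" y] assms by (simp add: star_star)

lemma state_null_left: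
  assumes "\<phi> (y * y\<^sup>\<star>) = 0"
  shows "\<phi> (y * x) = 0"
  using state_cauchy_schwarz[of "y\<^sup>\<star>" x] assms by (simp add: star_star)

text \<open>Here \<open>\<phi> ((u - 1)\<^sup>\<star> (u - 1)) \<le> 0\<close>, so \<open>u\<close> lies in the multiplicative domain of \<open>\<phi>\<close>.\<close>

lemma state_absorb_right:
  assumes "\<phi> u = 1" "Re (\<phi> (u\<^sup>\<star> * u)) \<le> 1"
  shows "\<phi> (x * u) = \<phi> x"
proof -
  have "(u - 1)\<^sup>\<star> * (u - 1) = u\<^sup>\<star> * u - u\<^sup>\<star> - u + 1"
    by (simp add: star_diff algebra_simps)
  then have "\<phi> ((u - 1)\<^sup>\<star> * (u - 1)) = \<phi> (u\<^sup>\<star> * u) - 1"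
    using assms by (simp add: state_add state_diff state_star state_one)
  then have "\<phi> ((u - 1)\<^sup>\<star> * (u - 1)) = 0"
    using assms(2) state_pos_Re[of "u - 1"] by (simp add: complex_eq_iff)
  from state_null_right[OF this, of x] show ?thesis
    by (simp add: algebra_simps state_diff)
qed

end

section \<open>Extension from dense subspaces\<close>

lemma continuous_eq_on_dense:
  fixes f g :: "'a::topological_space \<Rightarrow> 'b::t2_space"
  assumes "closure S = UNIV" "continuous_on UNIV f" "continuous_on UNIV g"
    and "\<And>x. x \<in> S \<Longrightarrow> f x = g x"
  shows "f = g"
proof -
  have "closure S \<subseteq> {x. f x = g x}"
    using assms by (intro closure_minimal closed_Collect_eq) auto
  then show ?thesis using assms(1) by auto
qed

lemma linear_span_subset:
  assumes "linear h" "\<And>b. b \<in> B \<Longrightarrow> h b \<in> span B'" "x \<in> span B"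
  shows "h x \<in> span B'"
proof -
  have "h x \<in> span (h ` B)" using assms(3) linear_span_image[OF assms(1)] by blast
  moreover have "span (h ` B) \<subseteq> span B'" using assms(2) by (intro span_minimal) auto
  ultimately show ?thesis by blast
qed

text \<open>Nothing is assumed about \<open>f\<close> outside the subspace. On it the bound gives
  uniform continuity, completeness of the target gives an extension, and additivity passes to the
  closure in one variable at a time.\<close>

lemma bounded_linear_extension:
  fixes f :: "'a::real_normed_vector \<Rightarrow> 'b::banach"
  assumes sub: "subspace S" and dense: "closure S = UNIV"
    and add: "\<And>x y. x \<in> S \<Longrightarrow> y \<in> S \<Longrightarrow> f (x + y) = f x + f y"
    and scale: "\<And>r x. x \<in> S \<Longrightarrow> f (r *\<^sub>R x) = r *\<^sub>R f x"
    and bound: "\<And>x. x \<in> S \<Longrightarrow> norm (f x) \<le> norm x"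
  obtains g where "bounded_linear g" "\<And>x. x \<in> S \<Longrightarrow> g x = f x"
proof -
  have diff: "f (x - y) = f x - f y" if "x \<in> S" "y \<in> S" for x y
    using add[of x "- y"] scale[of y "-1"] that subspace_neg[OF sub] by simp
  have "uniformly_continuous_on S f"
    unfolding uniformly_continuous_on_def dist_norm
  proof (intro allI impI)
    fix e :: real assume "e > 0"
    show "\<exists>d>0. \<forall>x\<in>S. \<forall>x'\<in>S. norm (x' - x) < d \<longrightarrow> norm (f x' - f x) < e"
      using \<open>e > 0\<close> bound[OF subspace_diff[OF sub]] diff by (metis le_less_trans)
  qed
  then obtain g where ug: "uniformly_continuous_on (closure S) g" and g: "\<And>x. x \<in> S \<Longrightarrow> f x = g x"
    by (rule uniformly_continuous_on_extension_on_closure) (rule that, assumption, fast)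
  have cg: "continuous_on UNIV g"
    using uniformly_continuous_imp_continuous[OF ug] dense by simp
  have cg': "continuous_on UNIV (\<lambda>x. g (h x))" if "continuous_on UNIV h" for h :: "'a \<Rightarrow> 'a"
    by (rule continuous_on_compose2[OF cg that]) auto
  have "(\<lambda>x. g (x + y)) = (\<lambda>x. g x + g y)" if "y \<in> S" for y
    by (rule continuous_eq_on_dense[OF dense])
      (auto intro!: continuous_intros cg cg' simp: that add subspace_add[OF sub] simp flip: g)
  then have "(\<lambda>y. g (x + y)) = (\<lambda>y. g x + g y)" for x
    by (intro continuous_eq_on_dense[OF dense])
      (auto intro!: continuous_intros cg cg' dest: fun_cong)
  then have g_add: "g (x + y) = g x + g y" for x y
    by (auto dest: fun_cong)
  have "(\<lambda>x. g (r *\<^sub>R x)) = (\<lambda>x. r *\<^sub>R g x)" for r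
    by (rule continuous_eq_on_dense[OF dense])
      (auto intro!: continuous_intros cg cg' simp: scale subspace_scale[OF sub] simp flip: g)
  then have g_scale: "g (r *\<^sub>R x) = r *\<^sub>R g x" for r x
    by (auto dest: fun_cong)
  have "closure S \<subseteq> {x. norm (g x) \<le> norm x}"
    by (intro closure_minimal closed_Collect_le continuous_intros cg) (auto simp: bound simp flip: g)
  then have "norm (g x) \<le> norm x * 1" for x
    using dense by auto
  then have "bounded_linear g"
    by (intro bounded_linear_intro[where K = 1] g_add g_scale)
  then show ?thesis using g that by metis
qed

text \<open>The type \<open>'x\<close> consists of formal expressions (elements of a free algebra,
  lists of tensors) that \<open>e\<close> evaluates; \<open>add\<close> and \<open>scale\<close>
  need not satisfy any laws. The bound makes \<open>F\<close> constant on the fibres of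
  \<open>e\<close>, because the formal difference of two points of a fibre has
  \<open>e\<close>-value 0.\<close>

lemma bounded_linear_factor:
  fixes e :: "'x \<Rightarrow> 'a::real_normed_vector" and F :: "'x \<Rightarrow> 'b::banach"
    and add :: "'x \<Rightarrow> 'x \<Rightarrow> 'x" and scale :: "real \<Rightarrow> 'x \<Rightarrow> 'x"
  assumes dense: "closure (range e) = UNIV"
    and e_add: "\<And>x y. e (add x y) = e x + e y" and e_scale: "\<And>r x. e (scale r x) = r *\<^sub>R e x"
    and F_add: "\<And>x y. F (add x y) = F x + F y" and F_scale: "\<And>r x. F (scale r x) = r *\<^sub>R F x"
    and bound: "\<And>x. norm (F x) \<le> norm (e x)"
  obtains h where "bounded_linear h" "\<And>x. h (e x) = F x"
proof -
  define G where "G y = F (inv_into UNIV e y)" for y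
  have G: "G (e x) = F x" for x
  proof -
    define x' where "x' = inv_into UNIV e (e x)"
    have "e x' = e x" by (simp add: x'_def f_inv_into_f)
    then have "norm (F x' - F x) \<le> 0"
      using bound[of "add x' (scale (-1) x)"] by (simp add: e_add e_scale F_add F_scale)
    then show ?thesis by (simp add: G_def x'_def)
  qed
  have sub: "subspace (range e)"
  proof (rule subspaceI)
    show "0 \<in> range e" using e_scale[of 0] by (metis scaleR_zero_left rangeI)
    show "x + y \<in> range e" if "x \<in> range e" "y \<in> range e" for x y
      using that by (auto simp flip: e_add)
    show "r *\<^sub>R x \<in> range e" if "x \<in> range e" for r x
      using that by (auto simp flip: e_scale)
  qed
  obtain h where "bounded_linear h" "\<And>x. x \<in> range e \<Longrightarrow> h x = G x"
  proof (rule bounded_linear_extension[OF sub dense])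
    show "norm (G x) \<le> norm x" if "x \<in> range e" for x
      using that bound by (auto simp: G)
    show "G (x + y) = G x + G y" if "x \<in> range e" "y \<in> range e" for x y
      using that by (auto simp: G F_add simp flip: e_add)
    show "G (r *\<^sub>R x) = r *\<^sub>R G x" if "x \<in> range e" for r x
      using that by (auto simp: G F_scale simp flip: e_scale)
  qed blast
  then show ?thesis using that by (simp add: G)
qed

text \<open>Positivity is checked on expressions only: each \<open>x\<^sup>\<star> * x\<close> in
  the range of \<open>e\<close> must have some representative with a nonnegative value. Closedness
  of the nonnegative reals carries this to the completion.\<close>

lemma state_factor:
  fixes e :: "'x \<Rightarrow> 'a::cstar_algebra" and F :: "'x \<Rightarrow> complex"
    and add :: "'x \<Rightarrow> 'x \<Rightarrow> 'x" and scale :: "complex \<Rightarrow> 'x \<Rightarrow> 'x"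
  assumes dense: "closure (range e) = UNIV"
    and e_add: "\<And>x y. e (add x y) = e x + e y" and e_scale: "\<And>z x. e (scale z x) = z *\<^sub>C e x"
    and F_add: "\<And>x y. F (add x y) = F x + F y" and F_scale: "\<And>z x. F (scale z x) = z * F x"
    and bound: "\<And>x. cmod (F x) \<le> norm (e x)"
    and pos: "\<And>x. \<exists>y. (e x)\<^sup>\<star> * e x = e y \<and> F y \<in> \<real>\<^sub>\<ge>\<^sub>0"
    and one: "e u = 1" "F u = 1"
  obtains \<omega> where "state \<omega>" "\<And>x. \<omega> (e x) = F x"
proof -
  obtain \<omega> where \<omega>: "bounded_linear \<omega>" and \<omega>F: "\<And>x. \<omega> (e x) = F x"
  proof (rule bounded_linear_factor[of e add "\<lambda>r. scale (complex_of_real r)" F])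
  qed (simp_all only: dense e_add e_scale F_add F_scale bound scaleR_eq_scaleC[where 'a = 'a]
      scaleR_conv_of_real[where 'a = complex])
  have cont: "continuous_on UNIV (\<lambda>x. \<omega> (k x))" if "continuous_on UNIV k" for k :: "'a \<Rightarrow> 'a"
    by (rule bounded_linear.continuous_on[OF \<omega> that])
  have "\<omega> (z *\<^sub>C e x) = z * \<omega> (e x)" for z x
    by (simp only: e_scale[symmetric] \<omega>F F_scale)
  then have "(\<lambda>x. \<omega> (z *\<^sub>C x)) = (\<lambda>x. z * \<omega> x)" for z
    by (intro continuous_eq_on_dense[OF dense]) (auto intro!: continuous_intros cont)
  then have "bounded_functional \<omega>"
    using \<omega> by (auto simp: bounded_functional_def fun_eq_iff)
  moreover have "closure (range e) \<subseteq> {x. \<omega> (x\<^sup>\<star> * x) \<in> \<real>\<^sub>\<ge>\<^sub>0}"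
  proof (rule closure_minimal)
    show "closed {x. \<omega> (x\<^sup>\<star> * x) \<in> \<real>\<^sub>\<ge>\<^sub>0}"
      using continuous_closed_preimage[OF cont[of "\<lambda>x. x\<^sup>\<star> * x"] closed_UNIV closed_nonneg_Reals_complex]
      by (simp add: vimage_def continuous_intros)
    show "range e \<subseteq> {x. \<omega> (x\<^sup>\<star> * x) \<in> \<real>\<^sub>\<ge>\<^sub>0}"
    proof clarify
      fix x
      obtain y where "(e x)\<^sup>\<star> * e x = e y" "F y \<in> \<real>\<^sub>\<ge>\<^sub>0" using pos by blast
      then show "\<omega> ((e x)\<^sup>\<star> * e x) \<in> \<real>\<^sub>\<ge>\<^sub>0" by (simp add: \<omega>F)
    qed
  qed
  moreover have "\<omega> 1 = 1" using \<omega>F[of u] one by simp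
  ultimately have "state \<omega>" using dense by (auto simp: state_def)
  then show ?thesis using \<omega>F that by blast
qed

section \<open>Evaluation of the free \<open>*\<close>-algebra and universal \<open>C\<^sup>*\<close>-algebras\<close>

text \<open>Reduces identities in the free algebra to single words, by adding one key of the finite
  support at a time.\<close>

lemma poly_mapping_additive_eqI:
  fixes f g :: "('k \<Rightarrow>\<^sub>0 'v::comm_monoid_add) \<Rightarrow> 'c::ab_group_add"
  assumes f: "\<And>x y. f (x + y) = f x + f y" and g: "\<And>x y. g (x + y) = g x + g y"
    and single: "\<And>u z. f (Poly_Mapping.single u z) = g (Poly_Mapping.single u z)"
  shows "f x = g x"
proof (induction x rule: update_induct)
  case const
  then show ?case using f[of 0 0] g[of 0 0] by simp
next
  case (update x u z)
  have "Poly_Mapping.update u z x = x + Poly_Mapping.single u z"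
    using update(1)
    by (intro poly_mapping_eqI) (auto simp: lookup_update lookup_add lookup_single when_def in_keys_iff)
  then show ?case using update f g single by simp
qed

text \<open>Keys of \<open>x + y\<close> can disappear by cancellation, so all three sums are first
  enlarged to the union of both key sets, where zero coefficients contribute nothing.\<close>

lemma sum_keys_add:
  fixes F :: "'k \<Rightarrow> 'v::comm_monoid_add \<Rightarrow> 'c::comm_monoid_add"
  assumes zero: "\<And>u. F u 0 = 0" and add: "\<And>u a b. F u (a + b) = F u a + F u b"
  shows "(\<Sum>u\<in>Poly_Mapping.keys (x + y). F u (Poly_Mapping.lookup (x + y) u)) =
    (\<Sum>u\<in>Poly_Mapping.keys x. F u (Poly_Mapping.lookup x u)) +
    (\<Sum>u\<in>Poly_Mapping.keys y. F u (Poly_Mapping.lookup y u))"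
proof -
  let ?K = "Poly_Mapping.keys x \<union> Poly_Mapping.keys y"
  have *: "(\<Sum>u\<in>Poly_Mapping.keys w. F u (Poly_Mapping.lookup w u)) =
      (\<Sum>u\<in>?K. F u (Poly_Mapping.lookup w u))" if "Poly_Mapping.keys w \<subseteq> ?K" for w
    using that by (intro sum.mono_neutral_left) (auto simp: in_keys_iff zero)
  show ?thesis
    by (subst (1 2 3) *)
      (auto simp: lookup_add add sum.distrib dest: subsetD[OF Poly_Mapping.keys_add])
qed

lemma sum_keys_single:
  fixes F :: "'k \<Rightarrow> 'v::comm_monoid_add \<Rightarrow> 'c::comm_monoid_add"
  assumes "\<And>u. F u 0 = 0"
  shows "(\<Sum>u\<in>Poly_Mapping.keys (Poly_Mapping.single k z).
    F u (Poly_Mapping.lookup (Poly_Mapping.single k z) u)) = F k z"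
  using assms by (cases "z = 0") auto

abbreviation word_star :: "'g star_word \<Rightarrow> 'g star_word" where
  "word_star u \<equiv> Word (rev (map (\<lambda>(i, b). (i, \<not> b)) (letters u)))"

lemma free_star_add: "free_star (x + y) = free_star x + free_star y"
  unfolding free_star_def by (rule sum_keys_add) (simp_all add: single_add)

lemma free_star_single:
  "free_star (Poly_Mapping.single u z) = Poly_Mapping.single (word_star u) (cnj z)"
  unfolding free_star_def by (rule sum_keys_single) simp

definition word_eval :: "('g \<Rightarrow> 'a::cstar_algebra) \<Rightarrow> 'g star_word \<Rightarrow> 'a" where
  "word_eval f u = (\<Prod>(i, b)\<leftarrow>letters u. if b then (f i)\<^sup>\<star> else f i)"

lemma word_eval_zero: "word_eval f 0 = 1"
  by (simp add: word_eval_def zero_star_word_def)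

lemma word_eval_add: "word_eval f (u + w) = word_eval f u * word_eval f w"
  by (simp add: word_eval_def plus_star_word_def)

lemma word_eval_star: "word_eval f (word_star u) = (word_eval f u)\<^sup>\<star>"
proof -
  have "(\<Prod>(i, b)\<leftarrow>rev (map (\<lambda>(i, b). (i, \<not> b)) xs). if b then (f i)\<^sup>\<star> else f i) =
      (\<Prod>(i, b)\<leftarrow>xs. if b then (f i)\<^sup>\<star> else f i)\<^sup>\<star>" for xs
    by (induction xs) (auto simp: star_mult star_star)
  then show ?thesis by (simp add: word_eval_def)
qed

context
  fixes f :: "'g \<Rightarrow> 'a::cstar_algebra"
begin

lemma free_eval_alt: "free_eval f x = (\<Sum>u\<in>Poly_Mapping.keys x. Poly_Mapping.lookup x u *\<^sub>C word_eval f u)"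
  by (simp add: free_eval_def word_eval_def)

lemma free_eval_add: "free_eval f (x + y) = free_eval f x + free_eval f y"
  unfolding free_eval_alt by (rule sum_keys_add) (simp_all add: scaleC_add_left)

lemma free_eval_single: "free_eval f (Poly_Mapping.single u z) = z *\<^sub>C word_eval f u"
  unfolding free_eval_alt by (rule sum_keys_single) simp

lemma free_eval_diff: "free_eval f (x - y) = free_eval f x - free_eval f y"
  using free_eval_add[of "x - y" y] by simp

lemma free_eval_one: "free_eval f 1 = 1"
  using free_eval_single[of 0 1] by (simp add: word_eval_zero)

lemma free_eval_mult: "free_eval f (x * y) = free_eval f x * free_eval f y"
proof (rule poly_mapping_additive_eqI[where x = x])
  fix u z
  show "free_eval f (Poly_Mapping.single u z * y) = free_eval f (Poly_Mapping.single u z) * free_eval f y"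
    by (rule poly_mapping_additive_eqI[where x = y])
      (simp_all add: free_eval_add distrib_left mult_single free_eval_single word_eval_add
        scaleC_mult_left scaleC_mult_right scaleC_scaleC mult.commute)
qed (simp_all add: free_eval_add distrib_right)

lemma free_eval_star: "free_eval f (free_star x) = (free_eval f x)\<^sup>\<star>"
  by (rule poly_mapping_additive_eqI[where x = x])
    (simp_all add: free_star_add free_eval_add star_add free_star_single free_eval_single
      word_eval_star star_scaleC)

lemma free_eval_scaleC: "free_eval f (free_scaleC z x) = z *\<^sub>C free_eval f x"
  by (simp add: free_scaleC_def free_eval_mult free_eval_single word_eval_zero scaleC_mult_left)

lemma free_eval_gen: "free_eval f (free_gen i) = f i"
  by (simp add: free_gen_def free_eval_single word_eval_def)

text \<open>The source of competitors for the universal norm: every choice of elements in a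
  C*-algebra yields one.\<close>

lemma cstar_seminorm_free_eval: "cstar_seminorm (\<lambda>x. norm (free_eval f x))"
  unfolding cstar_seminorm_def
  by (auto simp: free_eval_add free_eval_mult free_eval_star free_eval_scaleC norm_triangle_ineq
      norm_mult_ineq cstar_identity norm_scaleC)

end

context
  fixes h :: "'a::cstar_algebra \<Rightarrow> 'b::cstar_algebra"
  assumes hom: "unital_star_hom h"
begin

lemma hom_bounded_linear: "bounded_linear h"
  using hom by (simp add: unital_star_hom_def)

lemma hom_scaleC: "h (z *\<^sub>C x) = z *\<^sub>C h x"
  using hom by (simp add: unital_star_hom_def)

lemma hom_mult: "h (x * y) = h x * h y"
  using hom by (simp add: unital_star_hom_def)

lemma hom_star: "h (x\<^sup>\<star>) = (h x)\<^sup>\<star>"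
  using hom by (simp add: unital_star_hom_def)

lemma hom_one: "h 1 = 1"
  using hom by (simp add: unital_star_hom_def)

lemma hom_sum: "h (\<Sum>i\<in>I. f i) = (\<Sum>i\<in>I. h (f i))"
  using linear_sum[OF bounded_linear.linear[OF hom_bounded_linear]] .

lemma hom_power: "h (x ^ n) = h x ^ n"
  by (induction n) (simp_all add: hom_one hom_mult)

lemma hom_spow: "h (spow x k) = spow (h x) k"
  by (simp add: spow_def hom_power hom_star)

lemma hom_word_eval: "h (word_eval f u) = word_eval (\<lambda>i. h (f i)) u"
proof -
  have "h (\<Prod>(i, b)\<leftarrow>xs. if b then (f i)\<^sup>\<star> else f i) =
      (\<Prod>(i, b)\<leftarrow>xs. if b then (h (f i))\<^sup>\<star> else h (f i))" for xs
    by (induction xs) (auto simp: hom_mult hom_one hom_star)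
  then show ?thesis by (simp add: word_eval_def)
qed

lemma hom_free_eval: "h (free_eval f x) = free_eval (\<lambda>i. h (f i)) x"
  by (simp add: free_eval_alt hom_sum hom_scaleC hom_word_eval)

lemma continuous_on_hom: "continuous_on S h"
  by (rule bounded_linear.continuous_on[OF hom_bounded_linear]) (rule continuous_on_id)

lemma state_hom:
  assumes "state \<phi>"
  shows "state (\<lambda>x. \<phi> (h x))"
proof -
  have "bounded_linear (\<lambda>x. \<phi> (h x))"
    using bounded_linear_compose[OF functional_linear[OF state_functional[OF assms]] hom_bounded_linear] .
  then show ?thesis using assms
    by (simp add: state_def bounded_functional_def hom_scaleC hom_mult hom_star hom_one)
qed

end

context
  fixes R :: "'g free_star_algebra set" and f :: "'g \<Rightarrow> 'a::cstar_algebra"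
  assumes univ: "universal_cstar R f"
begin

lemma universal_dense: "closure (range (free_eval f)) = UNIV"
  using univ by (simp add: universal_cstar_def)

text \<open>The norm pulled back along \<open>g\<close> is a C*-seminorm that vanishes on
  \<open>R\<close>, so the universal norm dominates it and evaluation at \<open>g\<close> factors
  through evaluation at \<open>f\<close>. The algebraic laws extend from the dense range,
  multiplicativity in one variable after the other.\<close>

lemma universal_hom_exists:
  fixes g :: "'g \<Rightarrow> 'b::cstar_algebra"
  assumes "\<And>r. r \<in> R \<Longrightarrow> free_eval g r = 0"
  shows "\<exists>h. unital_star_hom h \<and> (\<forall>i. h (f i) = g i)"
proof -
  have le: "norm (free_eval g x) \<le> norm (free_eval f x)" for x
  proof -
    have "\<forall>p. cstar_seminorm p \<and> (\<forall>r\<in>R. p r = 0) \<longrightarrow> (\<forall>x. p x \<le> norm (free_eval f x))"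
      using univ by (simp add: universal_cstar_def)
    from this[THEN spec, of "\<lambda>x. norm (free_eval g x)"] show ?thesis
      using assms cstar_seminorm_free_eval[of g] by simp
  qed
  obtain h where h: "bounded_linear h" and hf: "\<And>x. h (free_eval f x) = free_eval g x"
  proof (rule bounded_linear_factor[of "free_eval f" "(+)"
        "\<lambda>r. free_scaleC (complex_of_real r)" "free_eval g"])
  qed (auto simp: universal_dense free_eval_add free_eval_scaleC scaleR_eq_scaleC le)
  have ch: "continuous_on UNIV (\<lambda>x. h (k x))" if "continuous_on UNIV k" for k :: "'a \<Rightarrow> 'a"
    by (rule bounded_linear.continuous_on[OF h that])
  have *: "k = k'" if "continuous_on UNIV k" "continuous_on UNIV k'"
      "\<And>x. k (free_eval f x) = k' (free_eval f x)" for k k' :: "'a \<Rightarrow> 'b"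
    using that by (intro continuous_eq_on_dense[OF universal_dense]) auto
  have "(\<lambda>x. h (z *\<^sub>C x)) = (\<lambda>x. z *\<^sub>C h x)" for z
    by (rule *) (auto intro!: continuous_intros ch simp: hf simp flip: free_eval_scaleC)
  moreover have "(\<lambda>x. h (x\<^sup>\<star>)) = (\<lambda>x. (h x)\<^sup>\<star>)"
    by (rule *) (auto intro!: continuous_intros ch simp: hf simp flip: free_eval_star)
  moreover have "(\<lambda>x. h (x * y)) = (\<lambda>x. h x * h y)" for y
  proof (rule *)
    fix x
    have "(\<lambda>y. h (free_eval f x * y)) = (\<lambda>y. h (free_eval f x) * h y)"
      by (rule *) (auto intro!: continuous_intros ch simp: hf simp flip: free_eval_mult)
    then show "h (free_eval f x * y) = h (free_eval f x) * h y" by (rule fun_cong)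
  qed (auto intro!: continuous_intros ch)
  moreover have "h 1 = 1" using hf[of 1] by (simp add: free_eval_one)
  ultimately have "unital_star_hom h"
    using h by (auto simp: unital_star_hom_def fun_eq_iff)
  moreover have "h (f i) = g i" for i using hf[of "free_gen i"] by (simp add: free_eval_gen)
  ultimately show ?thesis by blast
qed

lemma universal_hom_ex1:
  fixes g :: "'g \<Rightarrow> 'b::cstar_algebra"
  assumes "\<And>r. r \<in> R \<Longrightarrow> free_eval g r = 0"
  shows "\<exists>!h. unital_star_hom h \<and> (\<forall>i. h (f i) = g i)"
proof (rule ex_ex1I[OF universal_hom_exists[OF assms]])
  fix h h' :: "'a \<Rightarrow> 'b"
  assume h: "unital_star_hom h \<and> (\<forall>i. h (f i) = g i)" and h': "unital_star_hom h' \<and> (\<forall>i. h' (f i) = g i)"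
  then have *: "unital_star_hom h" "unital_star_hom h'" by simp_all
  show "h = h'"
    by (rule continuous_eq_on_dense[OF universal_dense])
      (use h h' in \<open>auto simp: continuous_on_hom * hom_free_eval[OF *(1)] hom_free_eval[OF *(2)]\<close>)
qed

end

section \<open>Product functionals on minimal tensor products\<close>

text \<open>If \<open>s 1\<close> exceeded \<open>N * K\<close>, then \<open>t = s 1 / N\<close>
  would exceed \<open>K\<close>, and repeated squaring would force
  \<open>s (2 ^ j) \<ge> N * t ^ (2 ^ j)\<close>, which outgrows \<open>M * K ^ (2 ^ j)\<close> for
  any \<open>M\<close>. So a crude constant \<open>M\<close> costs nothing.\<close>

lemma power_doubling_bound:
  fixes s :: "nat \<Rightarrow> real"
  assumes sq: "\<And>n. (s n)\<^sup>2 \<le> N * s (2 * n)" and bound: "\<And>n. s n \<le> M * K ^ n"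
    and "N \<ge> 0" "K \<ge> 0"
  shows "s 1 \<le> N * K"
proof (rule ccontr)
  assume "\<not> s 1 \<le> N * K"
  then have s1: "s 1 > N * K" by simp
  moreover have "N * K \<ge> 0" using assms by simp
  ultimately have "s 1 > 0" by linarith
  then have "N > 0" using sq[of 1] \<open>N \<ge> 0\<close> by (cases "N = 0") auto
  define t where "t = s 1 / N"
  have "t > K" using s1 \<open>N > 0\<close> by (simp add: t_def field_simps)
  have lower: "N * t ^ (2 ^ j) \<le> s (2 ^ j)" for j
  proof (induction j)
    case 0
    then show ?case using \<open>N > 0\<close> by (simp add: t_def)
  next
    case (Suc j)
    have "N * (N * t ^ (2 ^ Suc j)) = (N * t ^ (2 ^ j))\<^sup>2"
    proof -
      have "t ^ (2 ^ Suc j) = (t ^ (2 ^ j))\<^sup>2" by (simp add: mult.commute flip: power_mult)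
      then show ?thesis by (simp add: power2_eq_square)
    qed
    also have "\<dots> \<le> (s (2 ^ j))\<^sup>2"
      using Suc \<open>N > 0\<close> \<open>t > K\<close> \<open>K \<ge> 0\<close> by (intro power_mono) auto
    also have "\<dots> \<le> N * s (2 ^ Suc j)" using sq[of "2 ^ j"] by simp
    finally show ?case using \<open>N > 0\<close> by simp
  qed
  have key: "N * t ^ (2 ^ j) \<le> M * K ^ (2 ^ j)" for j
    using lower[of j] bound[of "2 ^ j"] by linarith
  show False
  proof (cases "K = 0")
    case True
    then show ?thesis using key[of 0] \<open>N > 0\<close> \<open>t > K\<close> by (simp add: mult_le_0_iff)
  next
    case False
    then have "K > 0" using \<open>K \<ge> 0\<close> by simp
    then have "t / K > 1" using \<open>t > K\<close> by simp
    then obtain n where n: "M / N < (t / K) ^ n" using real_arch_pow by blast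
    also have "\<dots> \<le> (t / K) ^ (2 ^ n)"
      using \<open>t / K > 1\<close> less_exp[of n] by (intro power_increasing) auto
    finally show ?thesis using key[of n] \<open>K > 0\<close> \<open>N > 0\<close> by (simp add: field_simps power_divide)
  qed
qed

text \<open>Positivity of \<open>\<phi> \<otimes> \<psi>\<close> on the algebraic tensor product, by Gram--Schmidt in the first leg:
  splitting off the \<open>\<phi>\<close>-component along the last \<open>a\<close> leaves a sum with one term less.\<close>

lemma product_form_pos:
  fixes a :: "nat \<Rightarrow> 'a::cstar_algebra" and b :: "nat \<Rightarrow> 'b::cstar_algebra"
  assumes \<phi>: "state \<phi>" and \<psi>: "state \<psi>"
  shows "(\<Sum>i<n. \<Sum>j<n. \<phi> ((a i)\<^sup>\<star> * a j) * \<psi> ((b i)\<^sup>\<star> * b j)) \<in> \<real>\<^sub>\<ge>\<^sub>0"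
proof (induction n arbitrary: a)
  case 0
  then show ?case by simp
next
  case (Suc n)
  define q where "q = Re (\<phi> ((a n)\<^sup>\<star> * a n))"
  define c where "c i = \<phi> ((a n)\<^sup>\<star> * a i)" for i
  have cn: "c n = of_real q" using state_pos_Re[OF \<phi>, of "a n"] by (simp add: c_def q_def complex_eq_iff)
  have cnj_c: "\<phi> ((a i)\<^sup>\<star> * a n) = cnj (c i)" for i
    using state_star[OF \<phi>, of "(a n)\<^sup>\<star> * a i"] by (simp add: c_def star_mult star_star)
  have "q \<ge> 0" using state_pos_Re[OF \<phi>] by (simp add: q_def)
  show ?case
  proof (cases "q = 0")
    case True
    \<comment> \<open>A null vector \<open>a n\<close> is orthogonal to all \<open>a i\<close>, so
      the last row and column of the double sum vanish.\<close>
    have c0: "c i = 0" for i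
    proof -
      have "\<phi> ((a n)\<^sup>\<star> * ((a n)\<^sup>\<star>)\<^sup>\<star>) = 0" using True cn by (simp add: c_def star_star)
      from state_null_left[OF \<phi> this] show ?thesis by (simp add: c_def)
    qed
    then have "\<phi> ((a n)\<^sup>\<star> * a i) = 0" "\<phi> ((a i)\<^sup>\<star> * a n) = 0" for i
      using cnj_c[of i] by (simp_all add: c_def)
    then show ?thesis using Suc by simp
  next
    case False
    define a' where "a' i = a i - (c i / of_real q) *\<^sub>C a n" for i
    \<comment> \<open>Substituting \<open>a i = a' i + (c i / q) *\<^sub>C a n\<close> collects the
      part along \<open>a n\<close> into the tensor of \<open>a n\<close> with \<open>B / q\<close>;
      its squared length is \<open>\<psi> (B\<^sup>\<star> * B) / q\<close>.\<close>
    define B where "B = (\<Sum>i<Suc n. c i *\<^sub>C b i)"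
    have a'n: "a' n = 0" using False by (simp add: a'_def cn)
    have a': "\<phi> ((a' i)\<^sup>\<star> * a' j) = \<phi> ((a i)\<^sup>\<star> * a j) - cnj (c i) * c j / of_real q" for i j
    proof -
      have "(a' i)\<^sup>\<star> * a' j = (a i)\<^sup>\<star> * a j - (c j / of_real q) *\<^sub>C ((a i)\<^sup>\<star> * a n)
          - (cnj (c i) / of_real q) *\<^sub>C ((a n)\<^sup>\<star> * a j)
          + (cnj (c i) / of_real q * (c j / of_real q)) *\<^sub>C ((a n)\<^sup>\<star> * a n)"
        by (simp add: a'_def star_diff star_scaleC algebra_simps scaleC_diff_right scaleC_mult_left
            scaleC_mult_right scaleC_scaleC)
      then have "\<phi> ((a' i)\<^sup>\<star> * a' j) = \<phi> ((a i)\<^sup>\<star> * a j) - c j / of_real q * cnj (c i)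
          - cnj (c i) / of_real q * c j + cnj (c i) / of_real q * (c j / of_real q) * cnj (c n)"
        by (simp only: state_add[OF \<phi>] state_diff[OF \<phi>] state_scaleC[OF \<phi>] cnj_c c_def[symmetric])
      then show ?thesis using False by (simp add: cn)
    qed
    have B: "\<psi> (B\<^sup>\<star> * B) = (\<Sum>i<Suc n. \<Sum>j<Suc n. cnj (c i) * c j * \<psi> ((b i)\<^sup>\<star> * b j))"
      unfolding B_def
      by (simp only: star_sum sum_product state_sum[OF \<psi>] star_scaleC scaleC_mult_left
          scaleC_mult_right state_scaleC[OF \<psi>] mult_ac)
    have "(\<Sum>i<Suc n. \<Sum>j<Suc n. \<phi> ((a i)\<^sup>\<star> * a j) * \<psi> ((b i)\<^sup>\<star> * b j)) =
        (\<Sum>i<Suc n. \<Sum>j<Suc n. \<phi> ((a' i)\<^sup>\<star> * a' j) * \<psi> ((b i)\<^sup>\<star> * b j)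
          + cnj (c i) * c j * \<psi> ((b i)\<^sup>\<star> * b j) / of_real q)"
      by (intro sum.cong refl) (simp add: a' left_diff_distrib)
    also have "\<dots> = (\<Sum>i<Suc n. \<Sum>j<Suc n. \<phi> ((a' i)\<^sup>\<star> * a' j) * \<psi> ((b i)\<^sup>\<star> * b j))
        + \<psi> (B\<^sup>\<star> * B) / of_real q"
      by (simp only: B sum.distrib sum_divide_distrib)
    also have "(\<Sum>i<Suc n. \<Sum>j<Suc n. \<phi> ((a' i)\<^sup>\<star> * a' j) * \<psi> ((b i)\<^sup>\<star> * b j)) =
        (\<Sum>i<n. \<Sum>j<n. \<phi> ((a' i)\<^sup>\<star> * a' j) * \<psi> ((b i)\<^sup>\<star> * b j))"
      by (simp add: a'n state_zero[OF \<phi>])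
    finally show ?thesis using Suc[of a'] state_pos[OF \<psi>, of B] \<open>q \<ge> 0\<close>
      by (simp add: nonneg_Reals_add_I nonneg_Reals_divide_I)
  qed
qed

section \<open>The semi-inner product that two states induce on formal tensors\<close>

definition product_form :: "('a::cstar_algebra \<Rightarrow> complex) \<Rightarrow> ('b::cstar_algebra \<Rightarrow> complex) \<Rightarrow>
    ('a \<times> 'b) list \<Rightarrow> ('a \<times> 'b) list \<Rightarrow> complex" where
  "product_form \<phi> \<psi> xs ys = (\<Sum>(a, b)\<leftarrow>xs. \<Sum>(a', b')\<leftarrow>ys. \<phi> (a\<^sup>\<star> * a') * \<psi> (b\<^sup>\<star> * b'))"

context
  fixes \<phi> :: "'a::cstar_algebra \<Rightarrow> complex" and \<psi> :: "'b::cstar_algebra \<Rightarrow> complex"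
  assumes \<phi>: "state \<phi>" and \<psi>: "state \<psi>"
begin

abbreviation tensor_act :: "'a \<Rightarrow> 'b \<Rightarrow> ('a \<times> 'b) list \<Rightarrow> ('a \<times> 'b) list" where
  "tensor_act a b \<equiv> map (\<lambda>(a', b'). (a * a', b * b'))"

abbreviation tensor_scale :: "complex \<Rightarrow> ('a \<times> 'b) list \<Rightarrow> ('a \<times> 'b) list" where
  "tensor_scale z \<equiv> map (\<lambda>(a, b). (z *\<^sub>C a, b))"

lemma product_form_Nil [simp]: "product_form \<phi> \<psi> [] ys = 0" "product_form \<phi> \<psi> xs [] = 0"
  by (induction xs) (auto simp: product_form_def)

lemma product_form_append_left: "product_form \<phi> \<psi> (xs @ xs') ys = product_form \<phi> \<psi> xs ys + product_form \<phi> \<psi> xs' ys"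
  by (simp add: product_form_def)

lemma product_form_append_right: "product_form \<phi> \<psi> xs (ys @ ys') = product_form \<phi> \<psi> xs ys + product_form \<phi> \<psi> xs ys'"
  by (induction xs) (auto simp: product_form_def)

lemma product_form_single: "product_form \<phi> \<psi> [(a, b)] [(a', b')] = \<phi> (a\<^sup>\<star> * a') * \<psi> (b\<^sup>\<star> * b')"
  by (simp add: product_form_def)

lemma product_form_Cons_left: "product_form \<phi> \<psi> (x # xs) ys = product_form \<phi> \<psi> [x] ys + product_form \<phi> \<psi> xs ys"
  using product_form_append_left[of "[x]" xs ys] by simp

lemma product_form_Cons_right: "product_form \<phi> \<psi> xs (y # ys) = product_form \<phi> \<psi> xs [y] + product_form \<phi> \<psi> xs ys"
  using product_form_append_right[of xs "[y]" ys] by simp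

lemma product_form_cnj: "cnj (product_form \<phi> \<psi> xs ys) = product_form \<phi> \<psi> ys xs"
proof (induction xs)
  case (Cons x xs)
  have "cnj (product_form \<phi> \<psi> [x] ys) = product_form \<phi> \<psi> ys [x]"
  proof (induction ys)
    case (Cons y ys)
    have "cnj (product_form \<phi> \<psi> [x] [y]) = product_form \<phi> \<psi> [y] [x]"
      by (cases x; cases y)
        (simp add: product_form_single star_mult star_star flip: state_star[OF \<phi>] state_star[OF \<psi>])
    then show ?case using Cons product_form_Cons_left[of y ys] product_form_Cons_right[of _ y ys] by simp
  qed simp
  then show ?case using Cons product_form_Cons_left[of x xs] product_form_Cons_right[of _ x xs] by simp
qed simp

lemma product_form_scale_right: "product_form \<phi> \<psi> xs (tensor_scale z ys) = z * product_form \<phi> \<psi> xs ys"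
proof (induction xs)
  case (Cons x xs)
  have "product_form \<phi> \<psi> [x] (tensor_scale z ys) = z * product_form \<phi> \<psi> [x] ys"
    by (induction ys)
      (auto simp: product_form_def scaleC_mult_right state_scaleC[OF \<phi>] algebra_simps split: prod.splits)
  then show ?case using Cons
    by (simp add: product_form_Cons_left[of x xs] distrib_left)
qed simp

lemma product_form_scale_left: "product_form \<phi> \<psi> (tensor_scale z xs) ys = cnj z * product_form \<phi> \<psi> xs ys"
  using product_form_scale_right[of ys z xs]
  by (metis complex_cnj_cnj complex_cnj_mult product_form_cnj)

text \<open>Left multiplication has the expected adjoint; thus \<open>a\<^sup>\<star> * a\<close>
  tensor \<open>b\<^sup>\<star> * b\<close> acts symmetrically, and its powers can be distributed
  over both arguments.\<close>

lemma product_form_act: "product_form \<phi> \<psi> (tensor_act a b xs) ys = product_form \<phi> \<psi> xs (tensor_act (a\<^sup>\<star>) (b\<^sup>\<star>) ys)"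
proof (induction xs)
  case (Cons x xs)
  have "product_form \<phi> \<psi> (tensor_act a b [x]) ys = product_form \<phi> \<psi> [x] (tensor_act (a\<^sup>\<star>) (b\<^sup>\<star>) ys)"
    by (induction ys) (auto simp: product_form_def star_mult mult.assoc split: prod.splits)
  then show ?case using Cons
    using product_form_append_left[of "[x]" xs]
      product_form_append_left[of "tensor_act a b [x]" "tensor_act a b xs"] by simp
qed simp

lemma product_form_self: "product_form \<phi> \<psi> xs xs \<in> \<real>\<^sub>\<ge>\<^sub>0"
  using product_form_pos[OF \<phi> \<psi>, of "\<lambda>i. fst (xs ! i)" "\<lambda>i. snd (xs ! i)" "length xs"]
  by (simp add: product_form_def sum_list_sum_nth case_prod_beta atLeast0LessThan)

lemma product_sqnorm_alt: "product_sqnorm \<phi> \<psi> xs = Re (product_form \<phi> \<psi> xs xs)"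
  by (simp add: product_sqnorm_def product_form_def)

lemma product_sqnorm_nonneg: "product_sqnorm \<phi> \<psi> xs \<ge> 0"
  using product_form_self[of xs] by (auto simp: product_sqnorm_alt nonneg_Reals_def)

lemma product_form_cauchy_schwarz:
  "(cmod (product_form \<phi> \<psi> xs ys))\<^sup>2 \<le> product_sqnorm \<phi> \<psi> xs * product_sqnorm \<phi> \<psi> ys"
proof (rule cauchy_schwarz_scalar)
  fix z
  let ?w = "xs @ tensor_scale z ys"
  have "product_form \<phi> \<psi> ?w ?w = product_form \<phi> \<psi> xs xs + (z * product_form \<phi> \<psi> xs ys + cnj (z * product_form \<phi> \<psi> xs ys))
      + complex_of_real ((cmod z)\<^sup>2) * product_form \<phi> \<psi> ys ys"
    unfolding product_form_append_left product_form_append_right product_form_scale_left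
      product_form_scale_right complex_norm_square
    by (simp add: product_form_cnj algebra_simps)
  then show "0 \<le> product_sqnorm \<phi> \<psi> xs + 2 * Re (z * product_form \<phi> \<psi> xs ys) + (cmod z)\<^sup>2 * product_sqnorm \<phi> \<psi> ys"
    using product_sqnorm_nonneg[of ?w] by (simp add: product_sqnorm_alt del: of_real_power)
qed (auto simp: product_sqnorm_nonneg)

lemma product_sqnorm_triangle:
  "sqrt (product_sqnorm \<phi> \<psi> (xs @ ys)) \<le> sqrt (product_sqnorm \<phi> \<psi> xs) + sqrt (product_sqnorm \<phi> \<psi> ys)"
proof (rule real_le_lsqrt)
  have "product_sqnorm \<phi> \<psi> (xs @ ys) =
      product_sqnorm \<phi> \<psi> xs + product_sqnorm \<phi> \<psi> ys + 2 * Re (product_form \<phi> \<psi> xs ys)"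
    using arg_cong[OF product_form_cnj[of xs ys], of Re]
    by (simp add: product_sqnorm_alt product_form_append_left product_form_append_right)
  also have "Re (product_form \<phi> \<psi> xs ys) \<le> sqrt (product_sqnorm \<phi> \<psi> xs * product_sqnorm \<phi> \<psi> ys)"
    using complex_Re_le_cmod[of "product_form \<phi> \<psi> xs ys"] real_le_rsqrt[OF product_form_cauchy_schwarz[of xs ys]]
    by linarith
  finally show "product_sqnorm \<phi> \<psi> (xs @ ys) \<le>
      (sqrt (product_sqnorm \<phi> \<psi> xs) + sqrt (product_sqnorm \<phi> \<psi> ys))\<^sup>2"
    by (simp add: power2_sum product_sqnorm_nonneg real_sqrt_mult)
qed (auto simp: product_sqnorm_nonneg)

text \<open>Only the growth rate matters: \<open>M\<close> may depend on both lists but not on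
  \<open>n\<close>. Boundedness of the states and submultiplicativity of the norms settle single
  tensors, and sums follow by induction.\<close>

lemma product_form_power_bound:
  "\<exists>M. \<forall>n. cmod (product_form \<phi> \<psi> xs (tensor_act (k ^ n) (l ^ n) ys)) \<le> M * (norm k * norm l) ^ n"
proof -
  obtain C where C: "\<And>x. cmod (\<phi> x) \<le> norm x * C"
    using bounded_linear.bounded[OF functional_linear[OF state_functional[OF \<phi>]]] by blast
  obtain D where D: "\<And>x. cmod (\<psi> x) \<le> norm x * D"
    using bounded_linear.bounded[OF functional_linear[OF state_functional[OF \<psi>]]] by blast
  have "C \<ge> 0" "D \<ge> 0" using C[of 1] D[of 1] by (auto intro: order_trans[OF norm_ge_zero])
  have single: "cmod (product_form \<phi> \<psi> [(a, b)] (tensor_act (k ^ n) (l ^ n) [(a', b')])) \<le>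
      (norm a * norm a' * C * (norm b * norm b' * D)) * (norm k * norm l) ^ n" for a b a' b' n
  proof -
    have "norm (a\<^sup>\<star> * (k ^ n * a')) \<le> norm a * (norm k ^ n * norm a')"
      using norm_mult_ineq[of "a\<^sup>\<star>" "k ^ n * a'"] norm_mult_ineq[of "k ^ n" a'] norm_power_ineq[of k n]
      by (smt (verit) mult_left_mono mult_right_mono norm_ge_zero norm_star)
    then have 1: "cmod (\<phi> (a\<^sup>\<star> * (k ^ n * a'))) \<le> norm a * (norm k ^ n * norm a') * C"
      using C \<open>C \<ge> 0\<close> by (meson mult_right_mono order_trans)
    have "norm (b\<^sup>\<star> * (l ^ n * b')) \<le> norm b * (norm l ^ n * norm b')"
      using norm_mult_ineq[of "b\<^sup>\<star>" "l ^ n * b'"] norm_mult_ineq[of "l ^ n" b'] norm_power_ineq[of l n]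
      by (smt (verit) mult_left_mono mult_right_mono norm_ge_zero norm_star)
    then have 2: "cmod (\<psi> (b\<^sup>\<star> * (l ^ n * b'))) \<le> norm b * (norm l ^ n * norm b') * D"
      using D \<open>D \<ge> 0\<close> by (meson mult_right_mono order_trans)
    show ?thesis
      using mult_mono'[OF 1 2] by (simp add: product_form_single norm_mult power_mult_distrib mult_ac)
  qed
  show ?thesis
  proof (induction xs)
    case (Cons x xs)
    have "\<exists>M. \<forall>n. cmod (product_form \<phi> \<psi> [x] (tensor_act (k ^ n) (l ^ n) ys)) \<le> M * (norm k * norm l) ^ n"
    proof (induction ys)
      case (Cons y ys)
      then obtain M where M: "\<And>n. cmod (product_form \<phi> \<psi> [x] (tensor_act (k ^ n) (l ^ n) ys)) \<le>
          M * (norm k * norm l) ^ n" by blast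
      obtain a b a' b' where xy: "x = (a, b)" "y = (a', b')" by fastforce
      let ?M = "norm a * norm a' * C * (norm b * norm b' * D)"
      have "cmod (product_form \<phi> \<psi> [x] (tensor_act (k ^ n) (l ^ n) (y # ys))) \<le>
          (?M + M) * (norm k * norm l) ^ n" for n
        using norm_triangle_le[OF add_mono[OF single[of a b n a' b'] M[of n]]]
          product_form_Cons_right[of "[x]" "(k ^ n * a', l ^ n * b')" "tensor_act (k ^ n) (l ^ n) ys"]
        by (simp add: xy distrib_right)
      then show ?case by blast
    qed (auto intro: exI[of _ 0])
    then obtain M where M: "\<And>n. cmod (product_form \<phi> \<psi> [x] (tensor_act (k ^ n) (l ^ n) ys)) \<le>
        M * (norm k * norm l) ^ n" by blast
    from Cons obtain M' where M': "\<And>n. cmod (product_form \<phi> \<psi> xs (tensor_act (k ^ n) (l ^ n) ys)) \<le>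
        M' * (norm k * norm l) ^ n" by blast
    have "cmod (product_form \<phi> \<psi> (x # xs) (tensor_act (k ^ n) (l ^ n) ys)) \<le> (M + M') * (norm k * norm l) ^ n" for n
      using norm_triangle_le[OF add_mono[OF M[of n] M'[of n]]]
        product_form_Cons_left[of x xs "tensor_act (k ^ n) (l ^ n) ys"] by (simp add: distrib_right)
    then show ?case by blast
  qed (auto intro: exI[of _ 0])
qed

text \<open>\<open>\<phi> \<otimes> \<psi> (y\<^sup>\<star> h\<^sup>n y)\<close> for \<open>h = a\<^sup>\<star>a \<otimes> b\<^sup>\<star>b\<close> grows at most like \<open>norm h ^ n\<close>; iterating the
  Cauchy--Schwarz inequality turns this into the bound at \<open>n = 1\<close>, without functional calculus.\<close>

lemma product_sqnorm_act:
  "product_sqnorm \<phi> \<psi> (tensor_act a b ys) \<le> (norm a * norm b)\<^sup>2 * product_sqnorm \<phi> \<psi> ys"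
proof -
  define k l where "k = a\<^sup>\<star> * a" and "l = b\<^sup>\<star> * b"
  have sa: "k\<^sup>\<star> = k" "l\<^sup>\<star> = l" unfolding k_def l_def by (simp_all add: star_mult star_star)
  define s where "s n = Re (product_form \<phi> \<psi> ys (tensor_act (k ^ n) (l ^ n) ys))" for n
  have comp: "tensor_act c d (tensor_act c' d' ys) = tensor_act (c * c') (d * d') ys" for c d c' d'
    by (auto simp: mult.assoc)
  have "s 1 \<le> product_sqnorm \<phi> \<psi> ys * (norm k * norm l)"
  proof -
    obtain M where M: "\<And>n. cmod (product_form \<phi> \<psi> ys (tensor_act (k ^ n) (l ^ n) ys)) \<le> M * (norm k * norm l) ^ n"
      using product_form_power_bound by blast
    show ?thesis
    proof (rule power_doubling_bound)
      fix n
      let ?y = "tensor_act (k ^ n) (l ^ n) ys"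
      have "(s n)\<^sup>2 \<le> (cmod (product_form \<phi> \<psi> ys ?y))\<^sup>2"
        unfolding s_def using abs_Re_le_cmod by (intro power2_le_iff_abs_le[THEN iffD2]) auto
      also have "\<dots> \<le> product_sqnorm \<phi> \<psi> ys * product_sqnorm \<phi> \<psi> ?y"
        by (rule product_form_cauchy_schwarz)
      \<comment> \<open>As \<open>k\<close> and \<open>l\<close> are self-adjoint, the
        \<open>n\<close> factors on the left argument move over to the right one.\<close>
      also have "product_sqnorm \<phi> \<psi> ?y = s (2 * n)"
        by (simp only: product_sqnorm_alt s_def product_form_act comp star_power sa mult_2 power_add)
      finally show "(s n)\<^sup>2 \<le> product_sqnorm \<phi> \<psi> ys * s (2 * n)" .
      show "s n \<le> M * (norm k * norm l) ^ n"
        using M[of n] complex_Re_le_cmod[of "product_form \<phi> \<psi> ys ?y"] unfolding s_def by linarith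
    qed (auto simp: product_sqnorm_nonneg)
  qed
  moreover have "s 1 = product_sqnorm \<phi> \<psi> (tensor_act a b ys)"
    by (simp only: product_sqnorm_alt s_def product_form_act comp power_one_right k_def l_def)
  moreover have "norm k * norm l = (norm a * norm b)\<^sup>2"
    by (simp add: k_def l_def cstar_identity power_mult_distrib)
  ultimately show ?thesis by (simp add: mult.commute)
qed

text \<open>The bound does not depend on the states, and on \<open>ys\<close> only through its
  length. It makes the set in \<open>spatial_norm\<close> bounded above, so that its
  \<open>Sup\<close> is a genuine supremum.\<close>

lemma product_sqnorm_mult_bound:
  "sqrt (product_sqnorm \<phi> \<psi> (tensor_list_mult xs ys)) \<le>
    (\<Sum>(a, b)\<leftarrow>xs. norm a * norm b) * sqrt (product_sqnorm \<phi> \<psi> ys)"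
proof (induction xs)
  case Nil
  then show ?case by (simp add: tensor_list_mult_def product_sqnorm_alt)
next
  case (Cons x xs)
  obtain a b where x: "x = (a, b)" by fastforce
  have "tensor_list_mult (x # xs) ys = tensor_act a b ys @ tensor_list_mult xs ys"
    by (simp add: tensor_list_mult_def x case_prod_beta)
  moreover have "sqrt (product_sqnorm \<phi> \<psi> (tensor_act a b ys)) \<le> norm a * norm b * sqrt (product_sqnorm \<phi> \<psi> ys)"
    using real_sqrt_le_mono[OF product_sqnorm_act[of a b ys]] by (simp add: real_sqrt_mult)
  ultimately show ?case
    using product_sqnorm_triangle[of "tensor_act a b ys" "tensor_list_mult xs ys"] Cons
    by (simp add: x distrib_right)
qed

end

section \<open>The spatial norm and the existence of product states\<close>

lemma spatial_norm_upper:
  assumes "state \<phi>" "state \<psi>" "product_sqnorm \<phi> \<psi> ys = 1"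
  shows "sqrt (product_sqnorm \<phi> \<psi> (tensor_list_mult xs ys)) \<le> spatial_norm xs"
  unfolding spatial_norm_def
proof (rule cSup_upper)
  show "bdd_above {sqrt (product_sqnorm \<phi> \<psi> (tensor_list_mult xs ys)) |\<phi> \<psi> ys.
      state \<phi> \<and> state \<psi> \<and> product_sqnorm \<phi> \<psi> ys = 1}"
  proof (rule bdd_aboveI[where M = "\<Sum>(a, b)\<leftarrow>xs. norm a * norm b"])
    fix x
    assume "x \<in> {sqrt (product_sqnorm \<phi> \<psi> (tensor_list_mult xs ys)) |\<phi> \<psi> ys.
      state \<phi> \<and> state \<psi> \<and> product_sqnorm \<phi> \<psi> ys = 1}"
    then obtain \<phi> \<psi> ys where "x = sqrt (product_sqnorm \<phi> \<psi> (tensor_list_mult xs ys))"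
      "state \<phi>" "state \<psi>" "product_sqnorm \<phi> \<psi> ys = 1" by blast
    then show "x \<le> (\<Sum>(a, b)\<leftarrow>xs. norm a * norm b)"
      using product_sqnorm_mult_bound[of \<phi> \<psi> xs ys] by simp
  qed
qed (use assms in blast)

abbreviation tensor_functional :: "('a \<Rightarrow> complex) \<Rightarrow> ('b \<Rightarrow> complex) \<Rightarrow> ('a \<times> 'b) list \<Rightarrow> complex" where
  "tensor_functional \<phi> \<psi> xs \<equiv> \<Sum>(a, b)\<leftarrow>xs. \<phi> a * \<psi> b"

text \<open>The list \<open>[(1, 1)]\<close> represents the cyclic unit vector, and the functional
  is the matrix coefficient of \<open>xs\<close> at it, so Cauchy--Schwarz and one admissible choice
  in the supremum suffice.\<close>

lemma tensor_functional_le_spatial_norm: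
  assumes \<phi>: "state \<phi>" and \<psi>: "state \<psi>"
  shows "cmod (tensor_functional \<phi> \<psi> xs) \<le> spatial_norm xs"
proof -
  have one: "product_sqnorm \<phi> \<psi> [(1, 1)] = 1"
    by (simp add: product_sqnorm_def state_one[OF \<phi>] state_one[OF \<psi>])
  have "tensor_list_mult xs [(1, 1)] = xs"
    by (induction xs) (auto simp: tensor_list_mult_def)
  then have "sqrt (product_sqnorm \<phi> \<psi> xs) \<le> spatial_norm xs"
    using spatial_norm_upper[OF \<phi> \<psi> one, of xs] by simp
  moreover have "product_form \<phi> \<psi> [(1, 1)] xs = tensor_functional \<phi> \<psi> xs"
    by (simp add: product_form_def)
  then have "cmod (tensor_functional \<phi> \<psi> xs) \<le> sqrt (product_sqnorm \<phi> \<psi> xs)"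
    using product_form_cauchy_schwarz[OF \<phi> \<psi>, of "[(1, 1)]" xs] one by (intro real_le_rsqrt) simp
  ultimately show ?thesis by linarith
qed

context
  fixes t :: "'a::cstar_algebra \<Rightarrow> 'b::cstar_algebra \<Rightarrow> 't::cstar_algebra"
  assumes t: "min_tensor t"
begin

lemma tensor_add_left: "t (a + a') b = t a b + t a' b"
  using t by (simp add: min_tensor_def)

lemma tensor_add_right: "t a (b + b') = t a b + t a b'"
  using t by (simp add: min_tensor_def)

lemma tensor_scaleC_left: "t (z *\<^sub>C a) b = z *\<^sub>C t a b"
  using t by (simp add: min_tensor_def)

lemma tensor_mult: "t a b * t a' b' = t (a * a') (b * b')"
  using t by (simp add: min_tensor_def)

lemma tensor_star: "(t a b)\<^sup>\<star> = t (a\<^sup>\<star>) (b\<^sup>\<star>)"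
  using t by (simp add: min_tensor_def)

lemma tensor_one: "t 1 1 = 1"
  using t by (simp add: min_tensor_def)

lemma tensor_zero_left: "t 0 b = 0"
  using tensor_add_left[of 0 0 b] by simp

lemma tensor_zero_right: "t a 0 = 0"
  using tensor_add_right[of a 0 0] by simp

lemma tensor_diff_left: "t (a - a') b = t a b - t a' b"
  using tensor_add_left[of "a - a'" a' b] by (simp add: algebra_simps)

lemma tensor_diff_right: "t a (b - b') = t a b - t a b'"
  using tensor_add_right[of a "b - b'" b'] by (simp add: algebra_simps)

lemma tensor_power: "t a b ^ n = t (a ^ n) (b ^ n)"
  by (induction n) (simp_all add: tensor_one tensor_mult)

lemma tensor_spow: "spow (t a b) k = t (spow a k) (spow b k)"
  by (simp add: spow_def tensor_power tensor_star)

lemma tensor_dense: "closure (range (tensor_sum t)) = UNIV"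
  using t by (simp add: min_tensor_def)

lemma tensor_norm: "norm (tensor_sum t xs) = spatial_norm xs"
  using t by (simp add: min_tensor_def)

lemma tensor_sum_append: "tensor_sum t (xs @ ys) = tensor_sum t xs + tensor_sum t ys"
  by (simp add: tensor_sum_def)

lemma tensor_sum_scale: "tensor_sum t (map (\<lambda>(a, b). (z *\<^sub>C a, b)) xs) = z *\<^sub>C tensor_sum t xs"
  by (induction xs) (auto simp: tensor_sum_def tensor_scaleC_left scaleC_add_right)

lemma tensor_sum_mult: "tensor_sum t (tensor_list_mult xs ys) = tensor_sum t xs * tensor_sum t ys"
proof (induction xs)
  case (Cons x xs)
  obtain a b where x: "x = (a, b)" by fastforce
  have "tensor_sum t (map (\<lambda>(a', b'). (a * a', b * b')) ys) = t a b * tensor_sum t ys"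
    by (induction ys) (auto simp: tensor_sum_def tensor_mult distrib_left)
  then show ?case using Cons
    by (simp add: tensor_list_mult_def x tensor_sum_append case_prod_beta)
      (simp add: tensor_sum_def distrib_right)
qed (simp add: tensor_list_mult_def tensor_sum_def)

lemma tensor_sum_star: "(tensor_sum t xs)\<^sup>\<star> = tensor_sum t (map (\<lambda>(a, b). (a\<^sup>\<star>, b\<^sup>\<star>)) xs)"
  by (induction xs) (auto simp: tensor_sum_def star_add tensor_star)

lemma functional_tensor_eqI:
  assumes \<omega>: "bounded_functional \<omega>" and \<omega>': "bounded_functional \<omega>'"
    and eq: "\<And>a b. \<omega> (t a b) = \<omega>' (t a b)"
  shows "\<omega> = \<omega>'"
proof (rule continuous_eq_on_dense[OF tensor_dense])
  have "\<omega> (tensor_sum t xs) = \<omega>' (tensor_sum t xs)" for xs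
    by (induction xs)
      (auto simp: tensor_sum_def functional_zero[OF \<omega>] functional_zero[OF \<omega>']
        functional_add[OF \<omega>] functional_add[OF \<omega>'] eq)
  then show "x \<in> range (tensor_sum t) \<Longrightarrow> \<omega> x = \<omega>' x" for x by auto
qed (intro continuous_on_functional[OF \<omega>] continuous_on_functional[OF \<omega>'] continuous_on_id)+

lemma product_state:
  assumes \<phi>: "state \<phi>" and \<psi>: "state \<psi>"
  shows "state (product_functional t \<phi> \<psi>)" (is ?state)
    and "product_functional t \<phi> \<psi> (t a b) = \<phi> a * \<psi> b" (is ?val)
proof -
  let ?F = "tensor_functional \<phi> \<psi>"
  have F_add: "?F (xs @ ys) = ?F xs + ?F ys" for xs ys by simp
  have F_scale: "?F (map (\<lambda>(a, b). (z *\<^sub>C a, b)) xs) = z * ?F xs" for z xs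
    by (induction xs) (auto simp: state_scaleC[OF \<phi>] distrib_left)
  obtain \<omega> where st: "state \<omega>" and \<omega>F: "\<And>xs. \<omega> (tensor_sum t xs) = ?F xs"
  proof (rule state_factor[of "tensor_sum t" "(@)" "\<lambda>z. map (\<lambda>(a, b). (z *\<^sub>C a, b))" ?F "[(1, 1)]"])
    show "cmod (?F xs) \<le> norm (tensor_sum t xs)" for xs
      using tensor_functional_le_spatial_norm[OF \<phi> \<psi>] by (simp add: tensor_norm)
    fix xs :: "('a \<times> 'b) list"
    let ?ys = "tensor_list_mult (map (\<lambda>(a, b). (a\<^sup>\<star>, b\<^sup>\<star>)) xs) xs"
    \<comment> \<open>The second list is kept independent of \<open>xs\<close>, because the
      induction runs over the first one only.\<close>
    have "?F (tensor_list_mult (map (\<lambda>(a, b). (a\<^sup>\<star>, b\<^sup>\<star>)) xs) ys) = product_form \<phi> \<psi> xs ys" for ys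
      by (induction xs)
        (auto simp: product_form_def tensor_list_mult_def comp_def case_prod_unfold)
    then have "?F ?ys \<in> \<real>\<^sub>\<ge>\<^sub>0" by (simp add: product_form_self[OF \<phi> \<psi>])
    then show "\<exists>ys. (tensor_sum t xs)\<^sup>\<star> * tensor_sum t xs = tensor_sum t ys \<and> ?F ys \<in> \<real>\<^sub>\<ge>\<^sub>0"
      by (intro exI[of _ ?ys] conjI) (simp_all only: tensor_sum_star tensor_sum_mult)
    show "tensor_sum t [(1, 1)] = 1" "?F [(1, 1)] = 1"
      by (simp_all add: tensor_sum_def tensor_one state_one[OF \<phi>] state_one[OF \<psi>])
  qed (simp_all only: tensor_dense tensor_sum_append tensor_sum_scale F_add F_scale)
  have bf: "bounded_functional \<omega>" by (rule state_functional[OF st])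
  have val: "\<omega> (t a b) = \<phi> a * \<psi> b" for a b
    using \<omega>F[of "[(a, b)]"] by (simp add: tensor_sum_def)
  have "product_functional t \<phi> \<psi> = \<omega>"
    unfolding product_functional_def
    by (rule the_equality) (auto simp: bf val intro!: functional_tensor_eqI)
  then show ?state ?val using st val by simp_all
qed

end

section \<open>Subgroups of \<open>\<int>\<close> and of \<open>\<int>\<^sup>2\<close>\<close>

text \<open>Division with remainder by the least positive element. The trivial subgroup is covered
  by \<open>p = 0\<close>, since only 0 is divisible by 0.\<close>

lemma int_subgroup_cyclic:
  fixes G :: "int set"
  assumes zero: "0 \<in> G" and add: "\<And>i j. i \<in> G \<Longrightarrow> j \<in> G \<Longrightarrow> i + j \<in> G" and uminus: "\<And>i. i \<in> G \<Longrightarrow> - i \<in> G"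
  obtains p :: nat where "\<And>l. l \<in> G \<longleftrightarrow> int p dvd l"
proof (cases "G = {0}")
  case True
  then show ?thesis using that[of 0] by simp
next
  case False
  then obtain i where "i \<in> G" "i \<noteq> 0" using zero by blast
  then have ex: "\<exists>n::nat. n > 0 \<and> int n \<in> G"
    using uminus[of i] by (intro exI[of _ "nat \<bar>i\<bar>"]) (auto simp: abs_if)
  define p where "p = (LEAST n::nat. n > 0 \<and> int n \<in> G)"
  have p: "p > 0" "int p \<in> G" using LeastI_ex[OF ex] by (simp_all add: p_def)
  have nat_mult: "int n * int p \<in> G" for n :: nat
    by (induction n) (simp_all add: zero add p distrib_right)
  have mult: "k * int p \<in> G" for k :: int
    using nat_mult[of "nat k"] uminus[OF nat_mult[of "nat (- k)"]] by (cases "k \<ge> 0") auto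
  have "int p dvd l" if "l \<in> G" for l
  proof -
    have "l mod int p = l + (- (l div int p)) * int p" by (simp add: minus_div_mult_eq_mod[symmetric])
    then have "l mod int p \<in> G" using add[OF that mult[of "- (l div int p)"]] by simp
    moreover have "l mod int p \<ge> 0" "l mod int p < int p" using p(1) by simp_all
    ultimately have "nat (l mod int p) = 0"
      using not_less_Least[of "nat (l mod int p)" "\<lambda>n. n > 0 \<and> int n \<in> G"]
      unfolding p_def[symmetric] by (metis gr0I int_nat_eq nat_less_iff)
    then show ?thesis using \<open>l mod int p \<ge> 0\<close> by (simp add: dvd_eq_mod_eq_0)
  qed
  moreover have "l \<in> G" if "int p dvd l" for l
    using that mult by (auto simp: dvd_def mult.commute)
  ultimately show ?thesis using that by blast
qed

text \<open>Hermite normal form: \<open>p\<close> generates the projection of \<open>L\<close> to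
  the first coordinate, \<open>(p, q)\<close> is a lift of it, and \<open>s\<close> generates the
  kernel of the projection. For \<open>p = 0\<close> the conventions on \<open>dvd\<close> and
  \<open>div\<close> turn the condition into \<open>j = 0\<close> and
  \<open>s dvd l\<close>.\<close>

lemma int2_subgroup_basis:
  fixes L :: "(int \<times> int) set"
  assumes zero: "(0, 0) \<in> L" and add: "\<And>i j k l. (i, j) \<in> L \<Longrightarrow> (k, l) \<in> L \<Longrightarrow> (i + k, j + l) \<in> L"
    and uminus: "\<And>i j. (i, j) \<in> L \<Longrightarrow> (- i, - j) \<in> L"
  obtains p s :: nat and q :: int
  where "\<And>j l. (j, l) \<in> L \<longleftrightarrow> int p dvd j \<and> int s dvd l - q * (j div int p)"
proof -
  obtain p :: nat where p: "\<And>j. j \<in> {j. \<exists>l. (j, l) \<in> L} \<longleftrightarrow> int p dvd j"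
    by (rule int_subgroup_cyclic[of "{j. \<exists>l. (j, l) \<in> L}"]) (use zero add uminus in blast)+
  obtain s :: nat where s: "\<And>l. l \<in> {l. (0, l) \<in> L} \<longleftrightarrow> int s dvd l"
    by (rule int_subgroup_cyclic[of "{l. (0, l) \<in> L}"])
      (use zero add[of 0 _ 0] uminus[of 0] in auto)
  obtain q where q: "(int p, q) \<in> L" using p[of "int p"] by auto
  have nat_mult: "(int n * int p, int n * q) \<in> L" for n :: nat
    by (induction n) (use zero add[OF q] in \<open>auto simp: distrib_right\<close>)
  have mult: "(k * int p, k * q) \<in> L" for k :: int
    using nat_mult[of "nat k"] uminus[OF nat_mult[of "nat (- k)"]] by (cases "k \<ge> 0") auto
  have "(j, l) \<in> L \<longleftrightarrow> int p dvd j \<and> int s dvd l - q * (j div int p)" for j l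
  proof (cases "int p dvd j")
    case True
    then have j: "j = (j div int p) * int p" by simp
    have "(j, l) \<in> L \<longleftrightarrow> (0, l - q * (j div int p)) \<in> L"
    proof
      assume "(j, l) \<in> L"
      from add[OF this mult[of "- (j div int p)"]] show "(0, l - q * (j div int p)) \<in> L"
        using True by (simp add: mult.commute)
    next
      assume "(0, l - q * (j div int p)) \<in> L"
      from add[OF this mult[of "j div int p"]] show "(j, l) \<in> L"
        using True by (simp add: mult.commute)
    qed
    then show ?thesis using s True by simp
  qed (use p in auto)
  then show ?thesis using that by blast
qed

section \<open>The algebra \<open>Pol(U\<^sub>0(2))\<close>\<close>

lemma spow_zero [simp]: "spow x 0 = 1"
  by (simp add: spow_def)

lemma spow_of_nat: "spow x (int n) = x ^ n"
  by (simp add: spow_def)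

lemma spow_uminus: "spow x (- k) = spow (x\<^sup>\<star>) k"
  by (simp add: spow_def star_star)

lemma star_spow: "(spow x k)\<^sup>\<star> = spow x (- k)"
  by (auto simp: spow_def star_power star_star)

text \<open>Factors \<open>x\<close> and \<open>x\<^sup>\<star>\<close> cancel only up to
  \<open>p\<close>. This is visible at \<open>k = -1\<close> alone, where the product is
  \<open>p\<close> instead of \<open>spow x 0 = 1\<close>; for smaller \<open>k\<close> a remaining
  \<open>x\<^sup>\<star>\<close> absorbs \<open>p\<close>. The cases of interest are unitary
  elements and \<open>c\<close>.\<close>

lemma mult_spow:
  assumes "x * x\<^sup>\<star> = p" and "p * x\<^sup>\<star> = x\<^sup>\<star>"
  shows "x * spow x k = (if k = -1 then p else spow x (k + 1))"
proof -
  consider n where "k = int n" | "k = -1" | n where "k = - int (Suc (Suc n))"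
    by (metis int_cases neg_int_cases less_Suc_eq_0_disj nat_int not_less_iff_gr_or_eq of_nat_1 One_nat_def
      not0_implies_Suc Suc_pred)
  then show ?thesis
  proof cases
    case 1
    then have "k + 1 = int (Suc n)" by simp
    then show ?thesis using 1 by (simp only: spow_of_nat) (simp add: 1)
  next
    case 2
    then show ?thesis using assms by (simp add: spow_def)
  next
    case 3
    then have k: "k + 1 = - int (Suc n)" by simp
    have "x * spow x k = x * x\<^sup>\<star> * x\<^sup>\<star> * (x\<^sup>\<star>) ^ n"
      by (simp only: 3 spow_uminus spow_of_nat power_Suc mult.assoc)
    also have "\<dots> = spow x (k + 1)"
      unfolding k spow_uminus spow_of_nat using assms by simp
    finally show ?thesis using 3 by simp
  qed
qed

lemma unitary_spow_add:
  assumes "v * v\<^sup>\<star> = 1" "v\<^sup>\<star> * v = 1"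
  shows "spow v (k + l) = spow v k * spow v l"
proof -
  have up: "spow v (k + 1) = v * spow v k" for k
    using mult_spow[of v 1 k] assms by simp
  have down: "spow v (k - 1) = v\<^sup>\<star> * spow v k" for k
  proof -
    have "v\<^sup>\<star> * spow v k = v\<^sup>\<star> * v * spow v (k - 1)" using up[of "k - 1"] by (simp add: mult.assoc)
    then show ?thesis using assms by simp
  qed
  show ?thesis
  proof (induction k rule: int_induct[where k = 0])
    case (step1 i)
    then show ?case using up[of "i + l"] up[of i] by (simp add: algebra_simps)
  next
    case (step2 i)
    then show ?case using down[of "i + l"] down[of i] by (simp add: algebra_simps)
  qed simp
qed

text \<open>A word in \<open>x\<close> and \<open>y\<close> survives only if every \<open>y\<close>
  stands before every \<open>x\<close>. It will be applied to the two summands of the coproduct of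
  \<open>c\<close>.\<close>

lemma power_add_annihilating:
  fixes x y :: "'a::ring_1"
  assumes "x * y = 0"
  shows "(x + y) ^ n = (\<Sum>i\<le>n. y ^ i * x ^ (n - i))"
proof (induction n)
  case (Suc n)
  have "x * (\<Sum>i\<le>n. y ^ i * x ^ (n - i)) = x ^ Suc n"
  proof -
    have "x * (y ^ i * x ^ (n - i)) = (if i = 0 then x ^ Suc n else 0)" if "i \<le> n" for i
      using that assms by (cases i) (simp_all flip: mult.assoc)
    then show ?thesis by (simp add: sum_distrib_left del: power_Suc)
  qed
  moreover have "y * (\<Sum>i\<le>n. y ^ i * x ^ (n - i)) = (\<Sum>i\<le>n. y ^ Suc i * x ^ (Suc n - Suc i))"
    by (simp add: sum_distrib_left mult.assoc)
  ultimately show ?case using Suc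
    by (simp only: power_Suc[of "x + y"] distrib_right sum.atMost_Suc_shift) simp
qed simp

text \<open>Relations without universality: besides the generators themselves, elements of the
  tensor square, the torus coordinates, the complex numbers and, with \<open>v = 1\<close>, the
  generators of \<open>C(SU\<^sub>0(2))\<close> are instances.\<close>

locale u02_relations =
  fixes a c v :: "'a::cstar_algebra"
  assumes av: "a * v = v * a" and cv: "c * v = v * c" and cc: "c * c\<^sup>\<star> = c\<^sup>\<star> * c"
    and vv: "v * v\<^sup>\<star> = 1" and vv': "v\<^sup>\<star> * v = 1"
    and ac: "a * c = 0" and ac': "a * c\<^sup>\<star> = 0" and aa: "a * a\<^sup>\<star> = 1"
    and sphere: "a\<^sup>\<star> * a + c\<^sup>\<star> * c = 1"
begin

definition pbw :: "nat \<Rightarrow> int \<Rightarrow> nat \<Rightarrow> int \<Rightarrow> 'a" where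
  "pbw r k s l = (a\<^sup>\<star>) ^ r * spow c k * a ^ s * spow v l"

lemmas v_add = unitary_spow_add[OF vv vv']

lemma commute_v:
  assumes "x * v = v * x"
  shows "x * spow v l = spow v l * x" "x\<^sup>\<star> * spow v l = spow v l * x\<^sup>\<star>"
proof -
  have power: "x * y ^ n = y ^ n * x" if "x * y = y * x" for y n
    using that by (metis power_commuting_commutes)
  have "x * v\<^sup>\<star> = v\<^sup>\<star> * v * x * v\<^sup>\<star>" by (simp add: vv')
  also have "\<dots> = v\<^sup>\<star> * x * (v * v\<^sup>\<star>)" using assms by (metis mult.assoc)
  finally have "x * v\<^sup>\<star> = v\<^sup>\<star> * x" by (simp add: vv)
  then show *: "x * spow v l = spow v l * x" for l
    using assms power by (simp add: spow_def)
  show "x\<^sup>\<star> * spow v l = spow v l * x\<^sup>\<star>"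
    using arg_cong[OF *[of "- l"], of star] by (simp add: star_mult star_spow)
qed

lemma a_power_v: "a ^ s * spow v l = spow v l * a ^ s"
  and a_star_power_v: "(a\<^sup>\<star>) ^ r * spow v l = spow v l * (a\<^sup>\<star>) ^ r"
  and c_spow_v: "spow c k * spow v l = spow v l * spow c k"
  using commute_v[OF av, of l] commute_v[OF cv, of l]
  by (metis power_commuting_commutes, metis power_commuting_commutes, metis power_commuting_commutes spow_def)

lemma ca: "c * a\<^sup>\<star> = 0" "c\<^sup>\<star> * a\<^sup>\<star> = 0"
  using arg_cong[OF ac', of star] arg_cong[OF ac, of star] by (simp_all add: star_mult star_star)

lemma c_projection: "c\<^sup>\<star> * c = 1 - a\<^sup>\<star> * a"
  using sphere by (simp add: algebra_simps)

text \<open>Since \<open>a\<close> annihilates \<open>c\<close> and \<open>c\<^sup>\<star>\<close>,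
  the complement \<open>1 - a\<^sup>\<star> * a\<close> acts on them as a unit. Hence
  \<open>c\<close> is a normal partial isometry with this projection as support.\<close>

lemma c_projection_absorb: "c * (c\<^sup>\<star> * c) = c" "c\<^sup>\<star> * (c\<^sup>\<star> * c) = c\<^sup>\<star>"
  "c\<^sup>\<star> * c * c = c" "c\<^sup>\<star> * c * c\<^sup>\<star> = c\<^sup>\<star>" "c\<^sup>\<star> * c * (c\<^sup>\<star> * c) = c\<^sup>\<star> * c"
proof -
  show 1: "c * (c\<^sup>\<star> * c) = c" "c\<^sup>\<star> * (c\<^sup>\<star> * c) = c\<^sup>\<star>"
    unfolding c_projection using ca by (simp_all add: right_diff_distrib flip: mult.assoc)
  show 2: "c\<^sup>\<star> * c * c = c" "c\<^sup>\<star> * c * c\<^sup>\<star> = c\<^sup>\<star>"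
    unfolding c_projection using ac ac' by (simp_all add: left_diff_distrib mult.assoc)
  show "c\<^sup>\<star> * c * (c\<^sup>\<star> * c) = c\<^sup>\<star> * c" using 1 by (simp add: mult.assoc)
qed

lemma c_mult_spow: "c * spow c k = (if k = -1 then 1 - a\<^sup>\<star> * a else spow c (k + 1))"
  using mult_spow[of c "c\<^sup>\<star> * c" k] by (simp add: cc c_projection_absorb c_projection[symmetric])

lemma c_star_mult_spow: "c\<^sup>\<star> * spow c k = (if k = 1 then 1 - a\<^sup>\<star> * a else spow c (k - 1))"
proof -
  have "c\<^sup>\<star> * spow (c\<^sup>\<star>) (- k) = (if - k = -1 then c\<^sup>\<star> * c else spow (c\<^sup>\<star>) (- k + 1))"
    by (rule mult_spow) (simp_all add: star_star c_projection_absorb)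
  moreover have "spow (c\<^sup>\<star>) (- k + 1) = spow c (k - 1)"
    using spow_uminus[of c "- k + 1"] by simp
  ultimately show ?thesis by (simp add: spow_uminus[symmetric] c_projection)
qed

lemma spow_c_projection:
  assumes "k \<noteq> 0"
  shows "spow c k * (c\<^sup>\<star> * c) = spow c k" "c\<^sup>\<star> * c * spow c k = spow c k"
proof -
  obtain n where "spow c k = c ^ Suc n \<or> spow c k = (c\<^sup>\<star>) ^ Suc n"
    using assms unfolding spow_def by (metis Suc_pred' int_nat_eq linorder_not_le nat_0_iff neg_le_0_iff_le
        not_gr_zero order_antisym_conv order.refl)
  moreover have "c ^ Suc n * (c\<^sup>\<star> * c) = c ^ Suc n" "(c\<^sup>\<star>) ^ Suc n * (c\<^sup>\<star> * c) = (c\<^sup>\<star>) ^ Suc n"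
    by (simp_all only: power_Suc2 mult.assoc[of _ _ "c\<^sup>\<star> * c"] c_projection_absorb)
  moreover have "c\<^sup>\<star> * c * c ^ Suc n = c ^ Suc n" "c\<^sup>\<star> * c * (c\<^sup>\<star>) ^ Suc n = (c\<^sup>\<star>) ^ Suc n"
    by (simp_all only: power_Suc mult.assoc[of "c\<^sup>\<star> * c" _ _, symmetric] c_projection_absorb)
  ultimately show "spow c k * (c\<^sup>\<star> * c) = spow c k" "c\<^sup>\<star> * c * spow c k = spow c k"
    by metis+
qed

lemma pbw_zero: "pbw 0 0 0 0 = 1"
  by (simp add: pbw_def)

lemma star_pbw: "(pbw r k s l)\<^sup>\<star> = pbw s (- k) r (- l)"
proof -
  have "(pbw r k s l)\<^sup>\<star> = spow v (- l) * ((a\<^sup>\<star>) ^ s * spow c (- k) * a ^ r)"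
    by (simp add: pbw_def star_mult star_power star_star star_spow mult.assoc)
  also have "\<dots> = (a\<^sup>\<star>) ^ s * spow v (- l) * spow c (- k) * a ^ r"
    by (simp add: mult.assoc[symmetric] a_star_power_v)
  also have "\<dots> = (a\<^sup>\<star>) ^ s * spow c (- k) * spow v (- l) * a ^ r"
    by (simp add: mult.assoc c_spow_v)
  also have "\<dots> = pbw s (- k) r (- l)"
    by (simp add: pbw_def mult.assoc a_power_v)
  finally show ?thesis .
qed

lemma v_mult_pbw: "spow v l' * pbw r k s l = pbw r k s (l' + l)"
proof -
  have "spow v l' * pbw r k s l = (a\<^sup>\<star>) ^ r * spow v l' * spow c k * a ^ s * spow v l"
    by (simp add: pbw_def mult.assoc[symmetric] a_star_power_v)
  also have "\<dots> = (a\<^sup>\<star>) ^ r * spow c k * spow v l' * a ^ s * spow v l"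
    by (simp add: mult.assoc c_spow_v)
  also have "\<dots> = (a\<^sup>\<star>) ^ r * spow c k * (spow v l' * a ^ s) * spow v l"
    by (simp only: mult.assoc)
  also have "\<dots> = (a\<^sup>\<star>) ^ r * spow c k * a ^ s * (spow v l' * spow v l)"
    by (simp only: a_power_v[symmetric] mult.assoc)
  finally show ?thesis by (simp add: pbw_def v_add)
qed

lemma a_star_power_mult_pbw: "(a\<^sup>\<star>) ^ n * pbw r k s l = pbw (n + r) k s l"
  by (simp add: pbw_def power_add mult.assoc)

lemma pbw_mult_a_power: "pbw r k s l * (a ^ n * spow v l') = pbw r k (s + n) (l + l')"
proof -
  have "pbw r k s l * (a ^ n * spow v l') = (a\<^sup>\<star>) ^ r * spow c k * a ^ s * (spow v l * a ^ n) * spow v l'"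
    by (simp add: pbw_def mult.assoc)
  also have "\<dots> = (a\<^sup>\<star>) ^ r * spow c k * a ^ s * a ^ n * (spow v l * spow v l')"
    by (simp add: a_power_v[symmetric] mult.assoc)
  finally show ?thesis by (simp add: pbw_def power_add v_add mult.assoc)
qed

text \<open>\<open>span\<close> is taken over the reals, so complex scalars are built into the
  generating set.\<close>

definition pbw_span :: "'a set" where
  "pbw_span = span {z *\<^sub>C pbw r k s l | z r k s l. True}"

lemma pbw_in_span: "pbw r k s l \<in> pbw_span"
proof -
  have "1 *\<^sub>C pbw r k s l \<in> pbw_span"
    unfolding pbw_span_def by (rule span_base) blast
  then show ?thesis by simp
qed

lemma pbw_span_linear:
  assumes "bounded_linear h" and "\<And>z r k s l. h (z *\<^sub>C pbw r k s l) \<in> pbw_span" and "x \<in> pbw_span"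
  shows "h x \<in> pbw_span"
  unfolding pbw_span_def
  by (rule linear_span_subset[OF bounded_linear.linear[OF assms(1)] _ assms(3)[unfolded pbw_span_def]])
    (use assms(2) in \<open>auto simp: pbw_span_def\<close>)

lemma pbw_span_scaleC: "x \<in> pbw_span \<Longrightarrow> z *\<^sub>C x \<in> pbw_span"
proof (rule pbw_span_linear[OF bounded_linear_scaleC])
  show "z *\<^sub>C z' *\<^sub>C pbw r k s l \<in> pbw_span" for z' r k s l
    unfolding scaleC_scaleC pbw_span_def by (rule span_base) blast
qed

text \<open>Left multiplication by a generator either keeps the normal order, cancels, or gives 0.
  The only case that leaves the set of monomials is \<open>c\<close> meeting a single
  \<open>c\<^sup>\<star>\<close> (or conversely): then \<open>1 - a\<^sup>\<star> * a\<close>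
  appears, a difference of two monomials.\<close>

lemma generator_mult_pbw:
  "a * pbw r k s l \<in> pbw_span" "a\<^sup>\<star> * pbw r k s l \<in> pbw_span"
  "c * pbw r k s l \<in> pbw_span" "c\<^sup>\<star> * pbw r k s l \<in> pbw_span"
  "v * pbw r k s l \<in> pbw_span" "v\<^sup>\<star> * pbw r k s l \<in> pbw_span"
proof -
  have zero: "0 \<in> pbw_span" by (simp add: pbw_span_def span_zero)
  have diff: "(1 - a\<^sup>\<star> * a) * a ^ s * spow v l \<in> pbw_span"
  proof -
    have "(1 - a\<^sup>\<star> * a) * a ^ s * spow v l = pbw 0 0 s l - pbw 1 0 (Suc s) l"
      by (simp add: pbw_def algebra_simps)
    then show ?thesis using pbw_in_span unfolding pbw_span_def by (simp add: span_diff)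
  qed
  have "a * pbw 0 k s l \<in> pbw_span"
  proof (cases "k = 0")
    case True
    then have "a * pbw 0 k s l = pbw 0 0 (Suc s) l" by (simp add: pbw_def mult.assoc)
    then show ?thesis using pbw_in_span by simp
  next
    case False
    have "a * (c\<^sup>\<star> * c) = 0" using ac' by (simp flip: mult.assoc)
    then have "a * spow c k = 0"
      using spow_c_projection(2)[OF False] by (metis mult.assoc mult_zero_left)
    then have "a * pbw 0 k s l = 0" by (simp add: pbw_def mult.assoc[symmetric])
    then show ?thesis using zero by simp
  qed
  moreover have "a * pbw (Suc r) k s l = pbw r k s l" for r
    using aa by (simp add: pbw_def mult.assoc[symmetric])
  ultimately show "a * pbw r k s l \<in> pbw_span" using pbw_in_span by (cases r) simp_all
  show "a\<^sup>\<star> * pbw r k s l \<in> pbw_span"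
    using a_star_power_mult_pbw[of 1 r k s l] pbw_in_span by simp
  have c0: "c * pbw (Suc r) k s l = 0" "c\<^sup>\<star> * pbw (Suc r) k s l = 0" for r
    using ca by (simp_all add: pbw_def mult.assoc[symmetric])
  have "c * pbw 0 k s l = (c * spow c k) * a ^ s * spow v l"
    "c\<^sup>\<star> * pbw 0 k s l = (c\<^sup>\<star> * spow c k) * a ^ s * spow v l"
    by (simp_all add: pbw_def mult.assoc)
  then have "c * pbw 0 k s l \<in> pbw_span" "c\<^sup>\<star> * pbw 0 k s l \<in> pbw_span"
    using diff pbw_in_span[of 0 "k + 1" s l] pbw_in_span[of 0 "k - 1" s l]
    by (simp_all add: c_mult_spow c_star_mult_spow pbw_def)
  then show "c * pbw r k s l \<in> pbw_span" "c\<^sup>\<star> * pbw r k s l \<in> pbw_span"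
    using c0 zero by (cases r; simp)+
  show "v * pbw r k s l \<in> pbw_span" "v\<^sup>\<star> * pbw r k s l \<in> pbw_span"
    using v_mult_pbw[of 1 r k s l] v_mult_pbw[of "-1" r k s l] pbw_in_span by (simp_all add: spow_def)
qed

text \<open>Words are built up from the right, one generator at a time. Asking for an inclusion of
  the range also covers \<open>SU\<^sub>0(2)\<close>, where no generator is sent to
  \<open>v = 1\<close>.\<close>

lemma free_eval_in_pbw_span:
  assumes "range f \<subseteq> {a, c, v}"
  shows "free_eval f x \<in> pbw_span"
proof -
  have gen: "g * y \<in> pbw_span" if "g \<in> {a, a\<^sup>\<star>, c, c\<^sup>\<star>, v, v\<^sup>\<star>}" "y \<in> pbw_span" for g y
    by (rule pbw_span_linear[OF bounded_linear_mult_right _ that(2)])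
      (use that(1) generator_mult_pbw pbw_span_scaleC in \<open>auto simp: scaleC_mult_right\<close>)
  have "(\<Prod>(i, b)\<leftarrow>xs. if b then (f i)\<^sup>\<star> else f i) \<in> pbw_span" for xs
  proof (induction xs)
    case Nil
    then show ?case using pbw_in_span[of 0 0 0 0] by (simp add: pbw_zero)
  next
    case (Cons x xs)
    obtain i b where x: "x = (i, b)" by fastforce
    have "f i \<in> {a, c, v}" using assms by blast
    then have "(if b then (f i)\<^sup>\<star> else f i) \<in> {a, a\<^sup>\<star>, c, c\<^sup>\<star>, v, v\<^sup>\<star>}" by auto
    from gen[OF this Cons] show ?case by (simp add: x)
  qed
  then have "word_eval f u \<in> pbw_span" for u by (simp add: word_eval_def)
  then have "Poly_Mapping.lookup x u *\<^sub>C word_eval f u \<in> pbw_span" for u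
    by (rule pbw_span_scaleC)
  then show ?thesis unfolding free_eval_alt pbw_span_def by (intro span_sum) blast
qed

end

locale u02_algebra = u02_relations +
  assumes dense: "closure pbw_span = UNIV"
begin

lemma functional_pbw_eqI:
  assumes \<phi>: "bounded_functional \<phi>" and \<psi>: "bounded_functional \<psi>"
    and eq: "\<And>r k s l. \<phi> (pbw r k s l) = \<psi> (pbw r k s l)"
  shows "\<phi> = \<psi>"
proof (rule continuous_eq_on_dense[OF dense])
  fix x assume x: "x \<in> pbw_span"
  show "\<phi> x = \<psi> x"
  proof (rule linear_eq_on_span[OF _ _ _ x[unfolded pbw_span_def]])
    show "linear \<phi>" "linear \<psi>"
      using functional_linear[OF \<phi>] functional_linear[OF \<psi>] by (simp_all add: bounded_linear.linear)
  qed (auto simp: functional_scaleC[OF \<phi>] functional_scaleC[OF \<psi>] eq)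
qed (intro continuous_on_functional[OF \<phi>] continuous_on_functional[OF \<psi>] continuous_on_id)+

end

section \<open>The coproduct on monomials and the values of idempotent states\<close>

context u02_algebra
begin

lemma a_star_v_star_power: "(a\<^sup>\<star> * v\<^sup>\<star>) ^ i = (a\<^sup>\<star>) ^ i * spow v (- int i)"
proof (induction i)
  case (Suc i)
  have v1: "spow v (-1) = v\<^sup>\<star>" by (simp add: spow_def)
  have "(a\<^sup>\<star> * v\<^sup>\<star>) ^ Suc i = a\<^sup>\<star> * (spow v (-1) * (a\<^sup>\<star>) ^ i) * spow v (- int i)"
    using Suc by (simp add: v1 mult.assoc)
  also have "\<dots> = (a\<^sup>\<star>) ^ Suc i * (spow v (-1) * spow v (- int i))"
    by (simp add: a_star_power_v[symmetric] mult.assoc)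
  also have "spow v (-1) * spow v (- int i) = spow v (- int (Suc i))"
    by (simp flip: v_add)
  finally show ?case .
qed simp

context
  fixes t :: "'a \<Rightarrow> 'a \<Rightarrow> 't::cstar_algebra" and \<Delta> :: "'a \<Rightarrow> 't"
  assumes t: "min_tensor t" and \<Delta>: "unital_star_hom \<Delta>"
    and \<Delta>a: "\<Delta> a = t a a" and \<Delta>c: "\<Delta> c = t c a + t (a\<^sup>\<star> * v\<^sup>\<star>) c" and \<Delta>v: "\<Delta> v = t v v"
begin

text \<open>Nonnegative powers of \<open>c\<close> are enough, because the star exchanges them with
  the negative ones and states are hermitian.\<close>

lemma coproduct_pbw:
  "\<Delta> (pbw r (int n) s l) =
    (\<Sum>i\<le>n. t (pbw (r + i) (int (n - i)) s (l - int i)) (pbw r (int i) (n - i + s) l))"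
proof -
  have ann: "t c a * t (a\<^sup>\<star> * v\<^sup>\<star>) c = 0"
    by (simp add: tensor_mult[OF t] ac tensor_zero_right[OF t])
  have leg1: "(a\<^sup>\<star>) ^ r * ((a\<^sup>\<star> * v\<^sup>\<star>) ^ i * c ^ m) * a ^ s * spow v l = pbw (r + i) (int m) s (l - int i)" for i m
  proof -
    have "(a\<^sup>\<star>) ^ r * ((a\<^sup>\<star> * v\<^sup>\<star>) ^ i * c ^ m) * a ^ s * spow v l =
        (a\<^sup>\<star>) ^ (r + i) * (spow v (- int i) * pbw 0 (int m) s l)"
      by (simp add: a_star_v_star_power pbw_def spow_of_nat power_add mult.assoc)
    then show ?thesis by (simp add: v_mult_pbw a_star_power_mult_pbw)
  qed
  have leg2: "(a\<^sup>\<star>) ^ r * (c ^ i * a ^ m) * a ^ s * spow v l = pbw r (int i) (m + s) l" for i m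
    by (simp add: pbw_def spow_of_nat power_add mult.assoc)
  have "\<Delta> (pbw r (int n) s l) = t ((a\<^sup>\<star>) ^ r) ((a\<^sup>\<star>) ^ r) * (t c a + t (a\<^sup>\<star> * v\<^sup>\<star>) c) ^ n
      * t (a ^ s) (a ^ s) * t (spow v l) (spow v l)"
    unfolding pbw_def spow_of_nat
    by (simp add: hom_mult[OF \<Delta>] hom_power[OF \<Delta>] hom_star[OF \<Delta>] hom_spow[OF \<Delta>] \<Delta>a \<Delta>c \<Delta>v
        tensor_power[OF t] tensor_star[OF t] tensor_spow[OF t])
  also have "\<dots> = (\<Sum>i\<le>n. t ((a\<^sup>\<star>) ^ r) ((a\<^sup>\<star>) ^ r) * (t ((a\<^sup>\<star> * v\<^sup>\<star>) ^ i) (c ^ i) * t (c ^ (n - i)) (a ^ (n - i)))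
      * t (a ^ s) (a ^ s) * t (spow v l) (spow v l))"
    unfolding power_add_annihilating[OF ann] tensor_power[OF t] sum_distrib_left sum_distrib_right ..
  also have "\<dots> = (\<Sum>i\<le>n. t (pbw (r + i) (int (n - i)) s (l - int i)) (pbw r (int i) (n - i + s) l))"
    unfolding tensor_mult[OF t] leg1 leg2 ..
  finally show ?thesis .
qed

lemma convolution_pbw:
  assumes \<phi>: "state \<phi>"
  shows "product_functional t \<phi> \<phi> (\<Delta> (pbw r (int n) s l)) =
    (\<Sum>i\<le>n. \<phi> (pbw (r + i) (int (n - i)) s (l - int i)) * \<phi> (pbw r (int i) (n - i + s) l))"
  using product_state[OF t \<phi> \<phi>]
  by (simp add: coproduct_pbw functional_sum[OF state_functional])

text \<open>For \<open>n > 0\<close> each term of the convolution has a factor with a nonzero power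
  of \<open>c\<close>, as \<open>i\<close> and \<open>n - i\<close> are not both 0. So the product
  functional vanishes there too, and only the one-term sums for \<open>n = 0\<close> impose a
  condition.\<close>

lemma idempotent_stateI:
  assumes \<phi>: "state \<phi>" and vanish: "\<And>r k s l. k \<noteq> 0 \<Longrightarrow> \<phi> (pbw r k s l) = 0"
    and idem: "\<And>r s l. \<phi> (pbw r 0 s l) * \<phi> (pbw r 0 s l) = \<phi> (pbw r 0 s l)"
  shows "idempotent_state t \<Delta> \<phi>"
proof -
  let ?\<omega> = "\<lambda>x. product_functional t \<phi> \<phi> (\<Delta> x)"
  have \<omega>: "state ?\<omega>" by (rule state_hom[OF \<Delta> product_state(1)[OF t \<phi> \<phi>]])
  have nonneg: "?\<omega> (pbw r (int n) s l) = \<phi> (pbw r (int n) s l)" for r n s l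
  proof (cases "n = 0")
    case True
    then show ?thesis using idem[of r s l] convolution_pbw[OF \<phi>, of r 0 s l] by simp
  next
    case False
    have "\<phi> (pbw (r + i) (int (n - i)) s (l - int i)) * \<phi> (pbw r (int i) (n - i + s) l) = 0" if "i \<le> n" for i
      using that False by (cases "i = 0") (simp_all add: vanish)
    then have "?\<omega> (pbw r (int n) s l) = 0" unfolding convolution_pbw[OF \<phi>] by (intro sum.neutral) auto
    then show ?thesis using False by (simp add: vanish)
  qed
  have "?\<omega> (pbw r k s l) = \<phi> (pbw r k s l)" for r k s l
  proof (cases "k \<ge> 0")
    case True
    then show ?thesis using nonneg[of r "nat k" s l] by simp
  next
    case False
    then have "?\<omega> ((pbw r k s l)\<^sup>\<star>) = \<phi> ((pbw r k s l)\<^sup>\<star>)"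
      using nonneg[of s "nat (- k)" r "- l"] by (simp add: star_pbw)
    then show ?thesis by (simp add: state_star[OF \<omega>] state_star[OF \<phi>])
  qed
  then have "?\<omega> = \<phi>" by (intro functional_pbw_eqI state_functional \<omega> \<phi>)
  then show ?thesis using \<phi> by (simp add: idempotent_state_def comp_def)
qed

text \<open>Both alternatives are recorded by integers, ready to be compared with torus states and
  with \<open>U02_Psi\<close>: \<open>(p, q)\<close> and \<open>(0, s)\<close> span the lattice of
  characters with value 1, and in the second case \<open>p\<close> generates the powers of
  \<open>v\<close> with value 1, \<open>p = 0\<close> meaning the whole circle.\<close>

theorem idempotent_state_values:
  assumes idem: "idempotent_state t \<Delta> \<phi>"
  obtains (torus) p s :: nat and q :: int
    where "\<And>r k j l. \<phi> (pbw r k j l) =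
      (if k = 0 \<and> int p dvd int j - int r \<and> int s dvd l - q * ((int j - int r) div int p) then 1 else 0)"
  | (Psi) n p :: nat
    where "\<And>r k j l. \<phi> (pbw r k j l) = (if k = 0 \<and> r = j \<and> j \<le> n \<and> int p dvd l then 1 else 0)"
proof -
  have \<phi>: "state \<phi>" and conv: "product_functional t \<phi> \<phi> (\<Delta> x) = \<phi> x" for x
    using idem by (auto simp: idempotent_state_def fun_eq_iff)
  define m where "m r s l = \<phi> (pbw r 0 s l)" for r s l
  \<comment> \<open>Without \<open>c\<close> the convolution has a single term, so the value equals
    its square.\<close>
  have m01: "m r s l = 0 \<or> m r s l = 1" for r s l
    using convolution_pbw[OF \<phi>, of r 0 s l] by (simp add: conv m_def)
  have m_one: "m 0 0 0 = 1" by (simp add: m_def pbw_zero state_one[OF \<phi>])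
  have m_star: "m r s l = m s r (- l)" for r s l
    using state_star[OF \<phi>, of "pbw r 0 s l"] m01[of r s l] by (auto simp: star_pbw m_def)
  have hermitian: "cnj (\<phi> (pbw r k s l)) = \<phi> (pbw s (- k) r (- l))" for r k s l
    using state_star[OF \<phi>, of "pbw r k s l"] by (simp add: star_pbw)

  let ?P = "c\<^sup>\<star> * c"
  have drop: "(a\<^sup>\<star>) ^ r * ?P * a ^ s * spow v l = pbw r 0 s l - pbw (Suc r) 0 (Suc s) l" for r s l
    unfolding c_projection pbw_def power_Suc2[of "a\<^sup>\<star>"] by (simp add: algebra_simps)
  \<comment> \<open>The squared length of \<open>?P * a ^ s\<close> is the drop of the diagonal
    values from \<open>s\<close> to \<open>Suc s\<close>.\<close>
  have kill_right: "\<phi> (x * (?P * a ^ s)) = 0" if "m s s 0 = m (Suc s) (Suc s) 0" for x s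
  proof (rule state_null_right[OF \<phi>])
    have "(?P * a ^ s)\<^sup>\<star> * (?P * a ^ s) = (a\<^sup>\<star>) ^ s * (?P * ?P) * a ^ s * spow v 0"
      by (simp add: star_mult star_star star_power mult.assoc)
    then show "\<phi> ((?P * a ^ s)\<^sup>\<star> * (?P * a ^ s)) = 0"
      using that by (simp only: c_projection_absorb drop state_diff[OF \<phi>] m_def diff_self)
  qed
  have P_v: "x * ?P * a ^ s * spow v l = x * spow v l * (?P * a ^ s)" for x s l
  proof -
    have "?P * v = v * ?P" using av commute_v(2)[OF av, of 1]
      by (simp add: c_projection algebra_simps spow_def)
        (metis mult.assoc)
    then have "?P * spow v l = spow v l * ?P" by (rule commute_v)
    moreover have "x * p * y * w = x * w * (p * y)" if "p * w = w * p" "y * w = w * y" for p y w :: 'a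
      using that by (metis mult.assoc)
    ultimately show ?thesis using a_power_v by blast
  qed
  \<comment> \<open>A nonzero power of \<open>c\<close> absorbs \<open>?P\<close> on its right,
    which exposes \<open>?P * a ^ s\<close> as the last factor.\<close>
  have pbw_P: "pbw r k s l = (a\<^sup>\<star>) ^ r * spow c k * spow v l * (?P * a ^ s)" if "k \<noteq> 0" for r k s l
  proof -
    have "pbw r k s l = (a\<^sup>\<star>) ^ r * spow c k * ?P * a ^ s * spow v l"
      by (simp only: pbw_def mult.assoc[of _ "spow c k" ?P] spow_c_projection(1)[OF that])
    then show ?thesis by (simp only: P_v)
  qed
  have vanish_right: "\<phi> (pbw r k s l) = 0" if "k \<noteq> 0" "m s s 0 = m (Suc s) (Suc s) 0" for r k s l
    using kill_right[OF that(2)] pbw_P[OF that(1)] by simp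
  have vanish_left: "\<phi> (pbw r k s l) = 0" if "k \<noteq> 0" "m r r 0 = m (Suc r) (Suc r) 0" for r k s l
    using vanish_right[of "- k" r s "- l"] hermitian[of r k s l] that by simp
  have shift: "m (Suc r) (Suc s) l = m r s l" if "m s s 0 = m (Suc s) (Suc s) 0" for r s l
    using kill_right[OF that, of "(a\<^sup>\<star>) ^ r * spow v l"]
    unfolding P_v[symmetric] drop state_diff[OF \<phi>] m_def by simp
  \<comment> \<open>For \<open>u = a ^ j * spow v l'\<close> the value of
    \<open>u\<^sup>\<star> * u\<close> is 0 or 1, hence at most 1; with value 1 at \<open>u\<close>
    itself this places \<open>u\<close> in the multiplicative domain.\<close>
  have absorb_right: "m r (s + j) (l + l') = m r s l" if "m 0 j l' = 1" for r s j l l'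
  proof -
    have u: "pbw 0 0 j l' = a ^ j * spow v l'" by (simp add: pbw_def)
    have "(a ^ j * spow v l')\<^sup>\<star> * (a ^ j * spow v l') = pbw j 0 j 0"
      using pbw_mult_a_power[of j 0 0 "- l'" j l'] star_pbw[of 0 0 j l'] u by simp
    then have "Re (\<phi> ((a ^ j * spow v l')\<^sup>\<star> * (a ^ j * spow v l'))) \<le> 1"
      using m01[of j j 0] by (auto simp: m_def)
    then show ?thesis
      using state_absorb_right[OF \<phi>, of "a ^ j * spow v l'" "pbw r 0 s l"] that
      by (simp add: m_def u pbw_mult_a_power)
  qed
  show ?thesis
  proof (cases "\<forall>r. m r r 0 = 1")
    case True
    \<comment> \<open>All diagonal values agree, so \<open>shift\<close> holds everywhere and
      \<open>m\<close> depends only on \<open>s - r\<close>; \<open>\<eta>\<close> uses the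
      representative in which one of the two exponents is 0.\<close>
    define \<eta> where "\<eta> j l = m (nat (- j)) (nat j) l" for j l
    have m_\<eta>: "m r s l = \<eta> (int s - int r) l" for r s l
    proof (induction r arbitrary: s)
      case (Suc r)
      show ?case
      proof (cases s)
        case (Suc s')
        then show ?thesis using shift[of s' r l] True Suc.IH[of s'] by simp
      qed (simp add: \<eta>_def Suc_as_int add.commute)
    qed (simp add: \<eta>_def)
    define L where "L = {(j, l). \<eta> j l = 1}"
    have zero: "(0, 0) \<in> L" using m_one by (simp add: L_def \<eta>_def)
    have uminus: "(- j, - l) \<in> L" if "(j, l) \<in> L" for j l
      using that m_star[of "nat (- j)" "nat j" l] by (simp add: L_def \<eta>_def)
    \<comment> \<open>Only nonnegative powers of \<open>a\<close> can be absorbed on the right;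
      negative \<open>k\<close> is reached afterwards through \<open>uminus\<close>.\<close>
    have add_pos: "(i + k, j + l) \<in> L" if "(i, j) \<in> L" "(k, l) \<in> L" "k \<ge> 0" for i j k l
    proof -
      have "int (nat i + nat k) - int (nat (- i)) = i + k" using \<open>k \<ge> 0\<close> by auto
      then have "\<eta> (i + k) (j + l) = m (nat (- i)) (nat i + nat k) (j + l)" by (simp add: m_\<eta>)
      also have "\<dots> = m (nat (- i)) (nat i) j"
        using that by (intro absorb_right) (simp add: L_def \<eta>_def)
      also have "\<dots> = 1" using that(1) by (simp add: L_def \<eta>_def)
      finally show ?thesis by (simp add: L_def)
    qed
    have add: "(i + k, j + l) \<in> L" if "(i, j) \<in> L" "(k, l) \<in> L" for i j k l
    proof (cases "k \<ge> 0")
      case False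
      then have "(- i + - k, - j + - l) \<in> L" using that by (intro add_pos uminus) auto
      from uminus[OF this] show ?thesis by (simp add: add.commute)
    qed (use add_pos that in blast)
    obtain p s :: nat and q :: int
      where L: "\<And>j l. (j, l) \<in> L \<longleftrightarrow> int p dvd j \<and> int s dvd l - q * (j div int p)"
      by (rule int2_subgroup_basis[of L]) (use zero add uminus in blast)+
    have val: "m r j l = (if (int j - int r, l) \<in> L then 1 else 0)" for r j l
      using m01[of r j l] by (auto simp: m_\<eta> L_def)
    have c_zero: "\<phi> (pbw r k j l) = 0" if "k \<noteq> 0" for r k j l
      using vanish_right[OF that] True by simp
    show ?thesis
    proof (rule torus[of p s q])
      show "\<phi> (pbw r k j l) = (if k = 0 \<and> int p dvd int j - int r \<and>
          int s dvd l - q * ((int j - int r) div int p) then 1 else 0)" for r k j l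
        using val[of r j l] c_zero[of k r j l] by (cases "k = 0") (simp_all add: L m_def)
    qed
  next
    case False
    then have ex: "\<exists>r. m r r 0 = 0" using m01 by blast
    \<comment> \<open>This is \<open>n + 1\<close> for the state \<open>\<psi>\<^sub>n\<close> to be
      found. As \<open>m 0 0 0 = 1\<close>, it is positive, so \<open>N - 1\<close> below is no
      truncated subtraction.\<close>
    define N where "N = (LEAST r. m r r 0 = 0)"
    have N: "m N N 0 = 0" using LeastI_ex[OF ex] by (simp add: N_def)
    have below: "m r r 0 = 1" if "r < N" for r
      using not_less_Least[of r "\<lambda>r. m r r 0 = 0"] that m01[of r r 0] by (auto simp: N_def)
    have "N > 0" using N m_one by (cases "N = 0") auto
    have zero_right: "\<phi> (pbw r k s l) = 0" if "s \<ge> N" for r k s l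
    proof -
      have "(a ^ N)\<^sup>\<star> * a ^ N = pbw N 0 N 0" by (simp add: pbw_def star_power)
      then have "\<phi> ((a ^ N)\<^sup>\<star> * a ^ N) = 0" using N by (simp add: m_def)
      then have "\<phi> (pbw r k (s - N) l * (a ^ N * spow v 0)) = 0"
        by (simp add: state_null_right[OF \<phi>])
      then show ?thesis unfolding pbw_mult_a_power using that by simp
    qed
    have zero_left: "\<phi> (pbw r k s l) = 0" if "r \<ge> N" for r k s l
      using zero_right[OF that, of s "- k" "- l"] hermitian[of r k s l] by simp
    have c_zero: "\<phi> (pbw r k s l) = 0" if "k \<noteq> 0" for r k s l
    proof -
      have main: "\<phi> (pbw r (int n) s l) = 0" if "n > 0" for r s n l
      proof -
        \<comment> \<open>Indices from \<open>N\<close> on lie in a kernel, and an index whose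
          successor is still below \<open>N\<close> sees equal diagonal values. What remains is the
          corner \<open>r = s = N - 1\<close>.\<close>
        consider "s \<ge> N" | "r \<ge> N" | "Suc s < N" | "Suc r < N" | "r < N" "s < N" "Suc r = N" "Suc s = N"
          by linarith
        then show ?thesis
        proof cases
          case 3
          then show ?thesis using that below by (intro vanish_right) simp_all
        next
          case 4
          then show ?thesis using that below by (intro vanish_left) simp_all
        next
          case 5
          \<comment> \<open>For \<open>i = 0\<close> the second factor contains
            \<open>a ^ (n + s)\<close> with \<open>n + s \<ge> N\<close>; for \<open>i > 0\<close>
            the first one contains \<open>(a\<^sup>\<star>) ^ (r + i)\<close> with
            \<open>r + i \<ge> N\<close>.\<close>
          have "\<phi> (pbw (r + i) (int (n - i)) s (l - int i)) * \<phi> (pbw r (int i) (n - i + s) l) = 0"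
            if "i \<le> n" for i
            using \<open>n > 0\<close> 5 by (cases "i = 0") (simp_all add: zero_left zero_right)
          then show ?thesis
            unfolding conv[of "pbw r (int n) s l", symmetric] convolution_pbw[OF \<phi>]
            by (intro sum.neutral) auto
        qed (use zero_right zero_left in blast)+
      qed
      show ?thesis
        using that main[of "nat k" r s l] main[of "nat (- k)" s r "- l"] hermitian[of r k s l]
        by (cases "k > 0") auto
    qed
    have diag: "m r (r + j) l = m 0 j l" if "r + j < N" for r j l
      using that
    proof (induction r)
      case (Suc r)
      then show ?case using shift[of "r + j" r l] below by simp
    qed simp
    have upper: "m r s l = 0" if "r < s" for r s l
    proof (cases "s < N")
      case True
      define j where "j = s - r"
      have eq: "m r s l = m 0 j l"
        using diag[of r j l] True that by (simp add: j_def)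
      show ?thesis
      proof (rule ccontr)
        assume "m r s l \<noteq> 0"
        then have one: "m 0 j l = 1" using eq m01[of r s l] that by (simp add: j_def)
        \<comment> \<open>Repeated absorption carries the value 1 to all multiples of
          \<open>j > 0\<close>; at \<open>i = N\<close> the exponent has reached the left
          kernel.\<close>
        have "m 0 (i * j) (int i * l) = 1" for i
        proof (induction i)
          case (Suc i)
          then show ?case using absorb_right[OF one, of 0 "i * j" "int i * l"]
            by (simp add: algebra_simps)
        qed (simp add: m_one)
        moreover have "N * j \<ge> N" using that by (simp add: j_def Suc_le_eq)
        ultimately show False using zero_right[of "N * j" 0 0 "int N * l"] by (auto simp: m_def)
      qed
    qed (simp add: zero_right m_def)
    have lower: "m r s l = 0" if "s < r" for r s l
      using upper[OF that, of "- l"] m_star[of s r "l"] m_star[of r s "l"] by simp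
    have zero': "0 \<in> {l. m 0 0 l = 1}" using m_one by simp
    have add': "i + j \<in> {l. m 0 0 l = 1}" if "i \<in> {l. m 0 0 l = 1}" "j \<in> {l. m 0 0 l = 1}" for i j
      using absorb_right[of 0 j 0 0 i] that by simp
    have uminus': "- i \<in> {l. m 0 0 l = 1}" if "i \<in> {l. m 0 0 l = 1}" for i
      using that m_star[of 0 0 i] by simp
    obtain p :: nat where p: "\<And>l. l \<in> {l. m 0 0 l = 1} \<longleftrightarrow> int p dvd l"
      using int_subgroup_cyclic[OF zero' add' uminus'] by blast
    have val: "m r j l = (if r = j \<and> j \<le> N - 1 \<and> int p dvd l then 1 else 0)" for r j l
    proof -
      consider "r < j" | "j < r" | "r = j" "r < N" | "r = j" "r \<ge> N" by linarith
      then show ?thesis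
      proof cases
        case 3
        then have "m r j l = m 0 0 l" using diag[of r 0 l] by simp
        then show ?thesis using p[of l] m01[of 0 0 l] 3 by auto
      next
        case 4
        then have "\<not> j \<le> N - 1" using \<open>N > 0\<close> by linarith
        then show ?thesis using 4 zero_right[of j] by (simp add: m_def)
      qed (use upper lower in auto)
    qed
    show ?thesis
    proof (rule Psi[of "N - 1" p])
      show "\<phi> (pbw r k j l) = (if k = 0 \<and> r = j \<and> j \<le> N - 1 \<and> int p dvd l then 1 else 0)" for r k j l
        using val[of r j l] c_zero[of k r j l] by (cases "k = 0") (simp_all add: m_def)
    qed
  qed
qed

end

end

section \<open>The states \<open>\<psi>\<^sub>n\<close> on \<open>C(SU\<^sub>0(2))\<close>\<close>

text \<open>The representation on \<open>\<ell>\<^sup>2(\<nat> \<times> \<int>)\<close> in which \<open>\<alpha>\<close> is the backward shift in the first variable and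
  \<open>\<gamma>\<close> is the bilateral shift in the second one, restricted to first coordinate 0. It is only needed
  on the dense subspace of finitely supported vectors; \<open>\<psi>\<^sub>n\<close> is the vector state at \<open>(n, 0)\<close>.\<close>

type_synonym vec = "nat \<times> int \<Rightarrow> complex"

fun su_op :: "SU02_gen \<times> bool \<Rightarrow> vec \<Rightarrow> vec" where
  "su_op (Galpha, False) f = (\<lambda>(i, k). f (Suc i, k))"
| "su_op (Galpha, True) f = (\<lambda>(i, k). if i = 0 then 0 else f (i - 1, k))"
| "su_op (Ggamma, False) f = (\<lambda>(i, k). if i = 0 then f (0, k - 1) else 0)"
| "su_op (Ggamma, True) f = (\<lambda>(i, k). if i = 0 then f (0, k + 1) else 0)"

definition su_word :: "SU02_gen star_word \<Rightarrow> vec \<Rightarrow> vec" where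
  "su_word u f = foldr su_op (letters u) f"

definition su_rep :: "SU02_gen free_star_algebra \<Rightarrow> vec \<Rightarrow> vec" where
  "su_rep x f = (\<lambda>i. \<Sum>u\<in>Poly_Mapping.keys x. Poly_Mapping.lookup x u * su_word u f i)"

definition fin_supp :: "vec \<Rightarrow> bool" where
  "fin_supp f \<longleftrightarrow> finite {i. f i \<noteq> 0}"

text \<open>As an unordered infinite sum, so that the adjoint relations of the shifts are mere
  reindexings; if one argument has finite support it reduces to a finite sum.\<close>

definition vinner :: "vec \<Rightarrow> vec \<Rightarrow> complex" where
  "vinner f g = (\<Sum>\<^sub>\<infinity>i. cnj (f i) * g i)"

definition vnorm :: "vec \<Rightarrow> real" where
  "vnorm f = sqrt (Re (vinner f f))"

lemma vinner_sum:
  assumes "finite K" "{i. f i \<noteq> 0} \<subseteq> K \<or> {i. g i \<noteq> 0} \<subseteq> K"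
  shows "vinner f g = (\<Sum>i\<in>K. cnj (f i) * g i)"
proof -
  have "vinner f g = (\<Sum>\<^sub>\<infinity>i\<in>K. cnj (f i) * g i)"
    unfolding vinner_def using assms(2) by (intro infsum_cong_neutral) auto
  then show ?thesis using assms(1) by simp
qed

lemma vinner_cnj: "cnj (vinner f g) = vinner g f"
  unfolding vinner_def by (simp flip: infsum_cnj add: mult.commute)

lemma vinner_self:
  assumes "finite K" "{i. f i \<noteq> 0} \<subseteq> K"
  shows "vinner f f = of_real ((L2_set (\<lambda>i. cmod (f i)) K)\<^sup>2)"
proof -
  have "vinner f f = (\<Sum>i\<in>K. of_real ((cmod (f i))\<^sup>2))"
    unfolding complex_norm_square using vinner_sum[OF assms(1), of f f] assms(2) by (simp add: mult.commute)
  also have "\<dots> = of_real ((L2_set (\<lambda>i. cmod (f i)) K)\<^sup>2)"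
    by (simp add: L2_set_def sum_nonneg)
  finally show ?thesis .
qed

lemma vnorm_L2:
  assumes "finite K" "{i. f i \<noteq> 0} \<subseteq> K"
  shows "vnorm f = L2_set (\<lambda>i. cmod (f i)) K"
  unfolding vnorm_def vinner_self[OF assms] by simp

lemma vinner_self_vnorm: "fin_supp f \<Longrightarrow> vinner f f = of_real ((vnorm f)\<^sup>2)"
  unfolding fin_supp_def using vinner_self[of "{i. f i \<noteq> 0}" f] vnorm_L2[of "{i. f i \<noteq> 0}" f] by simp

lemma vnorm_nonneg: "fin_supp f \<Longrightarrow> vnorm f \<ge> 0"
  unfolding fin_supp_def using vnorm_L2[of "{i. f i \<noteq> 0}" f] by simp

lemma vinner_cauchy_schwarz:
  assumes "fin_supp f" "fin_supp g"
  shows "cmod (vinner f g) \<le> vnorm f * vnorm g"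
proof -
  define K where "K = {i. f i \<noteq> 0} \<union> {i. g i \<noteq> 0}"
  have K: "finite K" "{i. f i \<noteq> 0} \<subseteq> K" "{i. g i \<noteq> 0} \<subseteq> K"
    using assms by (auto simp: K_def fin_supp_def)
  have "cmod (vinner f g) \<le> (\<Sum>i\<in>K. \<bar>cmod (f i)\<bar> * \<bar>cmod (g i)\<bar>)"
    using vinner_sum[OF K(1), of f g] K(2) by (auto intro!: sum_norm_le simp: norm_mult)
  also have "\<dots> \<le> vnorm f * vnorm g"
    using L2_set_mult_ineq[of "\<lambda>i. cmod (f i)" "\<lambda>i. cmod (g i)" K] by (simp add: vnorm_L2[OF K(1)] K)
  finally show ?thesis .
qed

lemma vnorm_zero [simp]: "vnorm (\<lambda>_. 0) = 0"
  by (simp add: vnorm_def vinner_def)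

lemma fin_supp_zero [simp]: "fin_supp (\<lambda>_. 0)"
  by (simp add: fin_supp_def)

lemma fin_supp_scale: "fin_supp f \<Longrightarrow> fin_supp (\<lambda>i. z * f i)"
  unfolding fin_supp_def by (rule finite_subset[rotated]) auto

lemma fin_supp_add: "fin_supp f \<Longrightarrow> fin_supp g \<Longrightarrow> fin_supp (\<lambda>i. f i + g i)"
  unfolding fin_supp_def by (rule finite_subset[of _ "{i. f i \<noteq> 0} \<union> {i. g i \<noteq> 0}"]) auto

lemma vnorm_scale: "fin_supp f \<Longrightarrow> vnorm (\<lambda>i. z * f i) = cmod z * vnorm f"
  unfolding fin_supp_def
  by (subst (1 2) vnorm_L2[of "{i. f i \<noteq> 0}"]) (auto simp: norm_mult L2_set_right_distrib)

lemma vnorm_triangle: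
  assumes "fin_supp f" "fin_supp g"
  shows "vnorm (\<lambda>i. f i + g i) \<le> vnorm f + vnorm g"
proof -
  define K where "K = {i. f i \<noteq> 0} \<union> {i. g i \<noteq> 0}"
  have K: "finite K" "{i. f i \<noteq> 0} \<subseteq> K" "{i. g i \<noteq> 0} \<subseteq> K" "{i. f i + g i \<noteq> 0} \<subseteq> K"
    using assms by (auto simp: K_def fin_supp_def)
  have "L2_set (\<lambda>i. cmod (f i + g i)) K \<le> L2_set (\<lambda>i. cmod (f i) + cmod (g i)) K"
    by (intro L2_set_mono norm_triangle_ineq) simp
  also have "\<dots> \<le> L2_set (\<lambda>i. cmod (f i)) K + L2_set (\<lambda>i. cmod (g i)) K"
    by (rule L2_set_triangle_ineq)
  finally show ?thesis by (simp add: vnorm_L2[OF K(1)] K)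
qed

lemma fin_supp_sum: "(\<And>u. u \<in> A \<Longrightarrow> fin_supp (h u)) \<Longrightarrow> fin_supp (\<lambda>i. \<Sum>u\<in>A. z u * h u i)"
  by (induction A rule: infinite_finite_induct) (auto intro!: fin_supp_add fin_supp_scale)

lemma vnorm_sum:
  "(\<And>u. u \<in> A \<Longrightarrow> fin_supp (h u)) \<Longrightarrow> vnorm (\<lambda>i. \<Sum>u\<in>A. z u * h u i) \<le> (\<Sum>u\<in>A. cmod (z u) * vnorm (h u))"
proof (induction A rule: infinite_finite_induct)
  case (insert x A)
  then have "vnorm (\<lambda>i. z x * h x i + (\<Sum>u\<in>A. z u * h u i)) \<le>
      vnorm (\<lambda>i. z x * h x i) + vnorm (\<lambda>i. \<Sum>u\<in>A. z u * h u i)"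
    by (intro vnorm_triangle fin_supp_scale fin_supp_sum) auto
  then show ?case using insert vnorm_scale[of "h x" "z x"] by simp
qed simp_all

lemma vinner_sum_right:
  assumes "fin_supp f"
  shows "vinner f (\<lambda>i. \<Sum>u\<in>A. z u * h u i) = (\<Sum>u\<in>A. z u * vinner f (h u))"
proof -
  have "vinner f g = (\<Sum>i\<in>{i. f i \<noteq> 0}. cnj (f i) * g i)" for g
    using assms by (intro vinner_sum) (auto simp: fin_supp_def)
  then show ?thesis
    by (simp add: sum_distrib_left sum.swap[of _ A] mult.left_commute)
qed

section \<open>Shift operators, their adjoints and norms\<close>

lemma su_op_linear: "su_op x (\<lambda>i. \<Sum>u\<in>A. z u * h u i) = (\<lambda>i. \<Sum>u\<in>A. z u * su_op x (h u) i)"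
  by (cases "(x, undefined :: vec)" rule: su_op.cases) (auto simp: fun_eq_iff)

lemma su_word_linear: "su_word w (\<lambda>i. \<Sum>u\<in>A. z u * h u i) = (\<lambda>i. \<Sum>u\<in>A. z u * su_word w (h u) i)"
proof -
  have "foldr su_op xs (\<lambda>i. \<Sum>u\<in>A. z u * h u i) = (\<lambda>i. \<Sum>u\<in>A. z u * foldr su_op xs (h u) i)" for xs
    by (induction xs) (simp_all add: su_op_linear)
  then show ?thesis by (simp add: su_word_def)
qed

lemma fin_supp_su_op:
  assumes "fin_supp f"
  shows "fin_supp (su_op x f)"
proof -
  let ?S = "{i. f i \<noteq> 0}"
  let ?T = "(\<lambda>(i, k). (i - 1, k)) ` ?S \<union> (\<lambda>(i, k). (i + 1, k)) ` ?S \<union>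
    (\<lambda>(i, k). (i, k - 1)) ` ?S \<union> (\<lambda>(i, k). (i, k + 1)) ` ?S"
  have "(i, k) \<in> ?T" if "su_op x f (i, k) \<noteq> 0" for i k
    using that
    by (cases "(x, f)" rule: su_op.cases) (force split: if_splits)+
  then have "{i. su_op x f i \<noteq> 0} \<subseteq> ?T" by auto
  moreover have "finite ?T" using assms by (simp add: fin_supp_def)
  ultimately show ?thesis unfolding fin_supp_def by (rule finite_subset)
qed

lemma fin_supp_su_word: "fin_supp f \<Longrightarrow> fin_supp (su_word u f)"
proof -
  assume "fin_supp f"
  then have "fin_supp (foldr su_op xs f)" for xs by (induction xs) (auto simp: fin_supp_su_op)
  then show ?thesis by (simp add: su_word_def)
qed

lemma fin_supp_su_rep: "fin_supp f \<Longrightarrow> fin_supp (su_rep x f)"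
  unfolding su_rep_def by (intro fin_supp_sum fin_supp_su_word)

text \<open>Each side is supported on the range of the respective shift, and shifting the summation
  index identifies the two sums: in the first coordinate for \<alpha>, in the second for
  \<gamma>.\<close>

lemma su_op_adjoint_aux:
  "vinner (su_op (g, True) f) h = vinner f (su_op (g, False) h)"
proof (cases g)
  case Galpha
  have "vinner (su_op (Galpha, True) f) h =
      (\<Sum>\<^sub>\<infinity>i\<in>range (\<lambda>(i, k). (Suc i, k)). cnj (su_op (Galpha, True) f i) * h i)"
    unfolding vinner_def
  proof (rule infsum_cong_neutral)
    fix x :: "nat \<times> int"
    assume x: "x \<in> UNIV - range (\<lambda>(i, k). (Suc i, k))"
    obtain i k where ik: "x = (i, k)" by fastforce
    with x have "i = 0" by (cases i) (auto simp: image_iff)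
    then show "cnj (su_op (Galpha, True) f x) * h x = 0" by (simp add: ik)
  qed auto
  also have "\<dots> = vinner f (su_op (Galpha, False) h)"
    unfolding vinner_def
    by (subst infsum_reindex) (auto simp: inj_on_def comp_def case_prod_unfold)
  finally show ?thesis using Galpha by simp
next
  case Ggamma
  have "vinner (su_op (Ggamma, True) f) h = (\<Sum>\<^sub>\<infinity>(i, k)\<in>{0::nat} \<times> UNIV. cnj (f (0, k + 1)) * h (0, k))"
    unfolding vinner_def by (intro infsum_cong_neutral) (auto split: if_splits)
  also have "\<dots> = (\<Sum>\<^sub>\<infinity>(i, k)\<in>{0::nat} \<times> UNIV. cnj (f (0, k)) * h (0, k - 1))"
    by (rule infsum_reindex_bij_witness[of _ "\<lambda>(i, k). (i, k - 1)" "\<lambda>(i, k). (i, k + 1)"]) auto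
  also have "\<dots> = vinner f (su_op (Ggamma, False) h)"
    unfolding vinner_def by (intro infsum_cong_neutral) (auto split: if_splits)
  finally show ?thesis using Ggamma by simp
qed

lemma su_op_adjoint: "vinner (su_op (g, \<not> b) f) h = vinner f (su_op (g, b) h)"
proof (cases b)
  case True
  have "vinner (su_op (g, False) f) h = cnj (vinner h (su_op (g, False) f))" by (simp add: vinner_cnj)
  also have "\<dots> = vinner f (su_op (g, True) h)" by (simp add: vinner_cnj flip: su_op_adjoint_aux)
  finally show ?thesis using True by simp
qed (simp add: su_op_adjoint_aux)

lemma su_word_adjoint: "vinner (su_word (word_star u) f) h = vinner f (su_word u h)"
proof -
  have "vinner (foldr su_op (rev (map (\<lambda>(i, b). (i, \<not> b)) xs)) f) h = vinner f (foldr su_op xs h)" for xs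
  proof (induction xs arbitrary: f)
    case (Cons x xs)
    then show ?case by (cases x) (simp add: su_op_adjoint)
  qed simp
  then show ?thesis by (simp add: su_word_def)
qed

lemma vnorm_su_op:
  assumes "fin_supp f"
  shows "vnorm (su_op x f) \<le> vnorm f"
proof -
  obtain g b where x: "x = (g, b)" by fastforce
  \<comment> \<open>All four operators are partial isometries: the adjoint times the operator is the
    projection to the coordinates in \<open>A\<close>.\<close>
  have mask: "\<exists>A. su_op (g, \<not> b) (su_op (g, b) f) = (\<lambda>i. if i \<in> A then f i else 0)"
  proof -
    have "su_op (Galpha, True) (su_op (Galpha, False) f) = (\<lambda>i. if i \<in> {i. fst i \<noteq> 0} then f i else 0)"
      "su_op (Galpha, False) (su_op (Galpha, True) f) = (\<lambda>i. if i \<in> UNIV then f i else 0)"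
      "su_op (Ggamma, True) (su_op (Ggamma, False) f) = (\<lambda>i. if i \<in> {i. fst i = 0} then f i else 0)"
      "su_op (Ggamma, False) (su_op (Ggamma, True) f) = (\<lambda>i. if i \<in> {i. fst i = 0} then f i else 0)"
      by (auto simp: fun_eq_iff)
    then show ?thesis by (cases g; cases b) (simp_all only: simp_thms; blast)+
  qed
  then obtain A where A: "su_op (g, \<not> b) (su_op (g, b) f) = (\<lambda>i. if i \<in> A then f i else 0)" by blast
  define K where "K = {i. f i \<noteq> 0}"
  have K: "finite K" "{i. f i \<noteq> 0} \<subseteq> K" using assms by (simp_all add: K_def fin_supp_def)
  have "vinner (su_op x f) (su_op x f) = vinner f (su_op (g, \<not> b) (su_op (g, b) f))"
    using su_op_adjoint[of g "\<not> b" f "su_op (g, b) f"] by (simp add: x)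
  also have "\<dots> = (\<Sum>i\<in>K. cnj (f i) * (if i \<in> A then f i else 0))"
    unfolding A using K by (intro vinner_sum) auto
  finally have "Re (vinner (su_op x f) (su_op x f)) = (\<Sum>i\<in>K. Re (cnj (f i) * (if i \<in> A then f i else 0)))"
    by simp
  also have "\<dots> = (\<Sum>i\<in>K. if i \<in> A then (cmod (f i))\<^sup>2 else 0)"
    by (intro sum.cong refl) (auto simp: cmod_power2 simp flip: power2_eq_square)
  also have "\<dots> \<le> (\<Sum>i\<in>K. (cmod (f i))\<^sup>2)" by (intro sum_mono) auto
  also have "\<dots> = Re (vinner f f)"
    using vinner_self[OF K] by (simp add: L2_set_def sum_nonneg)
  finally show ?thesis unfolding vnorm_def by simp
qed

lemma vnorm_su_word: "fin_supp f \<Longrightarrow> vnorm (su_word u f) \<le> vnorm f"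
proof -
  assume f: "fin_supp f"
  then have fs: "fin_supp (foldr su_op xs f)" for xs by (induction xs) (auto simp: fin_supp_su_op)
  have "vnorm (foldr su_op xs f) \<le> vnorm f" for xs
    by (induction xs) (auto intro: order_trans[OF vnorm_su_op[OF fs]])
  then show ?thesis by (simp add: su_word_def)
qed

lemma su_rep_add: "su_rep (x + y) f = (\<lambda>i. su_rep x f i + su_rep y f i)"
  unfolding su_rep_def by (intro ext sum_keys_add) (simp_all add: distrib_right)

lemma su_rep_single: "su_rep (Poly_Mapping.single u z) f = (\<lambda>i. z * su_word u f i)"
  unfolding su_rep_def by (intro ext sum_keys_single) simp

lemma su_rep_diff: "su_rep (x - y) f = (\<lambda>i. su_rep x f i - su_rep y f i)"
  using su_rep_add[of "x - y" y f] by (simp add: fun_eq_iff)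

lemma su_rep_one: "su_rep 1 f = f"
  using su_rep_single[of 0 1 f] unfolding single_one by (simp add: su_word_def zero_star_word_def)

lemma su_rep_mult: "su_rep (x * y) f = su_rep x (su_rep y f)"
proof
  fix i
  have add: "su_word u (\<lambda>i. g i + g' i) i = su_word u g i + su_word u g' i" for u g g'
    using fun_cong[OF su_word_linear[of u "\<lambda>_. 1" "\<lambda>b. if b then g else g'" UNIV], of i]
    by (simp add: UNIV_bool add.commute)
  have scale: "su_word u (\<lambda>i. z * g i) i = z * su_word u g i" for u z g
    using su_word_linear[of u "\<lambda>_. z" "\<lambda>_. g" "{()}"] by simp
  show "su_rep (x * y) f i = su_rep x (su_rep y f) i"
  proof (rule poly_mapping_additive_eqI[where x = x])
    fix u z
    show "su_rep (Poly_Mapping.single u z * y) f i = su_rep (Poly_Mapping.single u z) (su_rep y f) i"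
      by (rule poly_mapping_additive_eqI[where x = y])
        (simp_all add: distrib_left su_rep_add mult_single su_rep_single su_word_def
          plus_star_word_def scale[unfolded su_word_def] add[unfolded su_word_def])
  qed (simp_all add: distrib_right su_rep_add)
qed

lemma su_rep_power: "su_rep (x ^ n) f = (su_rep x ^^ n) f"
  by (induction n) (simp_all add: su_rep_one su_rep_mult)

lemma su_rep_scaleC: "su_rep (free_scaleC z x) f = (\<lambda>i. z * su_rep x f i)"
  by (simp add: free_scaleC_def su_rep_mult su_rep_single su_word_def zero_star_word_def)

lemma su_rep_gen: "su_rep (free_gen g) f = su_op (g, False) f"
  by (simp add: free_gen_def su_rep_single su_word_def)

lemma su_rep_gen_star: "su_rep (free_star (free_gen g)) f = su_op (g, True) f"
  by (simp add: free_gen_def free_star_single su_rep_single su_word_def)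

lemma su_rep_adjoint:
  assumes "fin_supp f" "fin_supp h"
  shows "vinner (su_rep (free_star x) f) h = vinner f (su_rep x h)"
proof (rule poly_mapping_additive_eqI[where x = x])
  have add: "vinner k (\<lambda>i. g i + g' i) = vinner k g + vinner k g'" if "fin_supp k" for k g g'
    using vinner_sum_right[OF that, of "\<lambda>_. 1" "\<lambda>b. if b then g else g'" UNIV]
    by (simp add: UNIV_bool add.commute)
  have scale: "vinner k (\<lambda>i. z * g i) = z * vinner k g" if "fin_supp k" for k z g
    using vinner_sum_right[OF that, of "\<lambda>_. z" "\<lambda>_. g" "{()}"] by simp
  show "vinner f (su_rep (x + y) h) = vinner f (su_rep x h) + vinner f (su_rep y h)" for x y
    using add[OF assms(1)] by (simp add: su_rep_add)
  have "vinner h (su_rep (free_star (x + y)) f) =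
      vinner h (su_rep (free_star x) f) + vinner h (su_rep (free_star y) f)" for x y
    using add[OF assms(2)] by (simp add: su_rep_add free_star_add)
  then show "vinner (su_rep (free_star (x + y)) f) h =
      vinner (su_rep (free_star x) f) h + vinner (su_rep (free_star y) f) h" for x y
    by (metis complex_cnj_add vinner_cnj)
  fix u z
  have "vinner (su_rep (free_star (Poly_Mapping.single u z)) f) h =
      cnj (vinner h (\<lambda>i. cnj z * su_word (word_star u) f i))"
    by (simp add: free_star_single su_rep_single vinner_cnj)
  also have "\<dots> = z * vinner (su_word (word_star u) f) h"
    by (simp add: scale[OF assms(2)] vinner_cnj)
  also have "\<dots> = vinner f (su_rep (Poly_Mapping.single u z) h)"
    by (simp add: su_word_adjoint su_rep_single scale[OF assms(1)])
  finally show "vinner (su_rep (free_star (Poly_Mapping.single u z)) f) h =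
      vinner f (su_rep (Poly_Mapping.single u z) h)" .
qed

section \<open>The operator norm on finitely supported vectors as a C*-seminorm\<close>

definition su_seminorm :: "SU02_gen free_star_algebra \<Rightarrow> real" where
  "su_seminorm x = Sup {vnorm (su_rep x f) | f. fin_supp f \<and> vnorm f \<le> 1}"

lemma vnorm_su_rep_bound:
  assumes "fin_supp f"
  shows "vnorm (su_rep x f) \<le> (\<Sum>u\<in>Poly_Mapping.keys x. cmod (Poly_Mapping.lookup x u)) * vnorm f"
proof -
  have "vnorm (su_rep x f) \<le>
      (\<Sum>u\<in>Poly_Mapping.keys x. cmod (Poly_Mapping.lookup x u) * vnorm (su_word u f))"
    unfolding su_rep_def using assms by (intro vnorm_sum fin_supp_su_word)
  also have "\<dots> \<le> (\<Sum>u\<in>Poly_Mapping.keys x. cmod (Poly_Mapping.lookup x u) * vnorm f)"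
    using assms by (intro sum_mono mult_left_mono vnorm_su_word) auto
  finally show ?thesis by (simp add: sum_distrib_right)
qed

lemma su_seminorm_upper:
  assumes "fin_supp f"
  shows "vnorm (su_rep x f) \<le> su_seminorm x * vnorm f"
proof -
  let ?B = "\<Sum>u\<in>Poly_Mapping.keys x. cmod (Poly_Mapping.lookup x u)"
  have le1: "vnorm (su_rep x g) \<le> su_seminorm x" if "fin_supp g" "vnorm g \<le> 1" for g
    unfolding su_seminorm_def
  proof (rule cSup_upper)
    show "bdd_above {vnorm (su_rep x f) |f. fin_supp f \<and> vnorm f \<le> 1}"
    proof (rule bdd_aboveI[where M = ?B])
      fix y assume "y \<in> {vnorm (su_rep x f) |f. fin_supp f \<and> vnorm f \<le> 1}"
      then obtain f where f: "y = vnorm (su_rep x f)" "fin_supp f" "vnorm f \<le> 1" by blast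
      have "?B * vnorm f \<le> ?B * 1" using f by (intro mult_left_mono sum_nonneg) auto
      then show "y \<le> ?B" using vnorm_su_rep_bound[OF f(2), of x] f(1) by linarith
    qed
  qed (use that in blast)
  show ?thesis
  proof (cases "vnorm f = 0")
    case True
    then show ?thesis using vnorm_su_rep_bound[OF assms, of x] by simp
  next
    case False
    then have pos: "vnorm f > 0" using vnorm_nonneg[OF assms] by simp
    define g where "g i = of_real (inverse (vnorm f)) * f i" for i
    have "fin_supp g" unfolding g_def by (rule fin_supp_scale[OF assms])
    moreover have "vnorm g = 1" unfolding g_def vnorm_scale[OF assms] using pos by (simp add: norm_inverse)
    moreover have "su_rep x g = (\<lambda>i. of_real (inverse (vnorm f)) * su_rep x f i)"
      unfolding g_def[abs_def] using su_rep_mult[of x "free_scaleC (of_real (inverse (vnorm f))) 1" f]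
        su_rep_mult[of "free_scaleC (of_real (inverse (vnorm f))) 1" x f]
      by (simp add: su_rep_scaleC su_rep_one) (simp add: su_rep_def sum_distrib_left
          su_word_linear[of _ "\<lambda>_. inverse (complex_of_real (vnorm f))" "\<lambda>_. f" "{()}", simplified] mult.left_commute)
    ultimately have "inverse (vnorm f) * vnorm (su_rep x f) \<le> su_seminorm x"
      using le1[of g] vnorm_scale[OF fin_supp_su_rep[OF assms], of "of_real (inverse (vnorm f))" x] pos
      by (simp add: norm_inverse)
    then show ?thesis using pos by (simp add: field_simps)
  qed
qed

lemma su_seminorm_least:
  assumes "\<And>f. fin_supp f \<Longrightarrow> vnorm f \<le> 1 \<Longrightarrow> vnorm (su_rep x f) \<le> B"
  shows "su_seminorm x \<le> B"
  unfolding su_seminorm_def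
proof (rule cSup_least)
  have "vnorm (su_rep x (\<lambda>_. 0)) \<in> {vnorm (su_rep x f) |f. fin_supp f \<and> vnorm f \<le> 1}"
    by (intro CollectI exI[of _ "\<lambda>_. 0"]) simp
  then show "{vnorm (su_rep x f) |f. fin_supp f \<and> vnorm f \<le> 1} \<noteq> {}" by blast
qed (use assms in blast)

lemma su_seminorm_nonneg: "su_seminorm x \<ge> 0"
proof -
  define e :: vec where "e i = (if i = (0, 0) then 1 else 0)" for i
  have "{i. e i \<noteq> 0} = {(0, 0)}" by (auto simp: e_def)
  then have e: "fin_supp e" "vnorm e = 1"
    using vnorm_L2[of "{(0, 0)}" e] by (simp_all add: fin_supp_def L2_set_def e_def)
  show ?thesis
    using su_seminorm_upper[OF e(1), of x] vnorm_nonneg[OF fin_supp_su_rep[OF e(1)], of x] e(2) by simp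
qed

lemma su_seminorm_le:
  assumes "fin_supp f" "vnorm f \<le> 1"
  shows "vnorm (su_rep x f) \<le> su_seminorm x"
  using su_seminorm_upper[OF assms(1), of x] mult_left_mono[OF assms(2) su_seminorm_nonneg[of x]] by simp

text \<open>The usual Hilbert space argument; the adjoint relation and Cauchy--Schwarz are available
  on finitely supported vectors, which the representation preserves, so no completion is
  involved.\<close>

lemma cstar_seminorm_su_seminorm: "cstar_seminorm su_seminorm"
  unfolding cstar_seminorm_def
proof (intro conjI allI)
  fix x y :: "SU02_gen free_star_algebra" and z :: complex
  show "su_seminorm (x + y) \<le> su_seminorm x + su_seminorm y"
  proof (rule su_seminorm_least)
    fix f assume f: "fin_supp f" "vnorm f \<le> 1"
    show "vnorm (su_rep (x + y) f) \<le> su_seminorm x + su_seminorm y"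
      unfolding su_rep_add
      using vnorm_triangle[OF fin_supp_su_rep[OF f(1), of x] fin_supp_su_rep[OF f(1), of y]]
        su_seminorm_le[OF f, of x] su_seminorm_le[OF f, of y] by linarith
  qed
  show mult: "su_seminorm (x * y) \<le> su_seminorm x * su_seminorm y" for x y
  proof (rule su_seminorm_least)
    fix f assume f: "fin_supp f" "vnorm f \<le> 1"
    show "vnorm (su_rep (x * y) f) \<le> su_seminorm x * su_seminorm y"
      unfolding su_rep_mult
      using su_seminorm_upper[OF fin_supp_su_rep[OF f(1), of y], of x]
        mult_left_mono[OF su_seminorm_le[OF f, of y] su_seminorm_nonneg[of x]] by linarith
  qed
  have scale: "su_seminorm (free_scaleC z x) \<le> cmod z * su_seminorm x" for z x
  proof (rule su_seminorm_least)
    fix f assume f: "fin_supp f" "vnorm f \<le> 1"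
    show "vnorm (su_rep (free_scaleC z x) f) \<le> cmod z * su_seminorm x"
      unfolding su_rep_scaleC vnorm_scale[OF fin_supp_su_rep[OF f(1)]]
      by (intro mult_left_mono su_seminorm_le f) simp
  qed
  show "su_seminorm (free_scaleC z x) = cmod z * su_seminorm x"
  proof (cases "z = 0")
    case True
    then show ?thesis using scale[of z x] su_seminorm_nonneg[of "free_scaleC z x"] by simp
  next
    case False
    have "free_scaleC (inverse z) (free_scaleC z x) = x"
      using False by (simp add: free_scaleC_def mult_single flip: mult.assoc)
    then have "su_seminorm x \<le> inverse (cmod z) * su_seminorm (free_scaleC z x)"
      using scale[of "inverse z" "free_scaleC z x"] by (simp add: norm_inverse)
    then show ?thesis using scale[of z x] False by (intro antisym) (auto simp: field_simps)
  qed
  \<comment> \<open>For \<open>g = su_rep (free_star x) f\<close> the adjoint relation gives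
    \<open>(vnorm g)\<^sup>2 \<le> su_seminorm x * vnorm g\<close>.\<close>
  have star_le: "su_seminorm (free_star x) \<le> su_seminorm x"
  proof (rule su_seminorm_least)
    fix f assume f: "fin_supp f" "vnorm f \<le> 1"
    let ?g = "su_rep (free_star x) f"
    have g: "fin_supp ?g" by (rule fin_supp_su_rep[OF f(1)])
    have "(vnorm ?g)\<^sup>2 = cmod (vinner ?g ?g)"
      unfolding vinner_self_vnorm[OF g] by (simp add: norm_power)
    also have "vinner ?g ?g = vinner f (su_rep x ?g)" by (rule su_rep_adjoint[OF f(1) g])
    also have "cmod \<dots> \<le> vnorm f * vnorm (su_rep x ?g)"
      by (rule vinner_cauchy_schwarz[OF f(1) fin_supp_su_rep[OF g]])
    also have "\<dots> \<le> 1 * (su_seminorm x * vnorm ?g)"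
      using f(2) by (intro mult_mono su_seminorm_upper g vnorm_nonneg fin_supp_su_rep) auto
    finally show "vnorm ?g \<le> su_seminorm x"
      using vnorm_nonneg[OF g] su_seminorm_nonneg[of x] by (cases "vnorm ?g = 0") (auto simp: power2_eq_square)
  qed
  show "su_seminorm (free_star x * x) = (su_seminorm x)\<^sup>2"
  proof (rule antisym)
    show "su_seminorm (free_star x * x) \<le> (su_seminorm x)\<^sup>2"
      using mult[of "free_star x" x] mult_right_mono[OF star_le su_seminorm_nonneg[of x]]
      by (simp add: power2_eq_square)
    have "su_seminorm x \<le> sqrt (su_seminorm (free_star x * x))"
    proof (rule su_seminorm_least, rule real_le_rsqrt)
      fix f assume f: "fin_supp f" "vnorm f \<le> 1"
      let ?g = "su_rep x f"
      have g: "fin_supp ?g" by (rule fin_supp_su_rep[OF f(1)])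
      have "(vnorm ?g)\<^sup>2 = cmod (vinner ?g ?g)"
        unfolding vinner_self_vnorm[OF g] by (simp add: norm_power)
      also have "vinner ?g ?g = vinner (su_rep (free_star x) ?g) f"
        by (rule su_rep_adjoint[OF g f(1), symmetric])
      also have "cmod \<dots> \<le> vnorm (su_rep (free_star x) ?g) * vnorm f"
        by (rule vinner_cauchy_schwarz[OF fin_supp_su_rep[OF g] f(1)])
      also have "\<dots> \<le> su_seminorm (free_star x * x) * 1"
        using su_seminorm_le[OF f, of "free_star x * x"] f
        by (intro mult_mono vnorm_nonneg su_seminorm_nonneg) (auto simp: su_rep_mult)
      finally show "(vnorm ?g)\<^sup>2 \<le> su_seminorm (free_star x * x)" by simp
    qed
    then show "(su_seminorm x)\<^sup>2 \<le> su_seminorm (free_star x * x)"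
      using power_mono[OF _ su_seminorm_nonneg, of x "sqrt (su_seminorm (free_star x * x))" 2]
        su_seminorm_nonneg[of "free_star x * x"] by simp
  qed
qed

lemma su_seminorm_relations:
  assumes "r \<in> SU02_relations"
  shows "su_seminorm r = 0"
proof -
  have "su_rep r f = (\<lambda>_. 0)" for f
    using assms unfolding SU02_relations_def Let_def
    by (auto simp: su_rep_diff su_rep_add su_rep_mult su_rep_one su_rep_gen su_rep_gen_star fun_eq_iff)
  then have "su_seminorm r \<le> 0" by (intro su_seminorm_least) simp
  then show ?thesis using su_seminorm_nonneg[of r] by simp
qed

text \<open>\<open>\<alpha> ^ s\<close> lowers the basis vector at \<open>(n, 0)\<close> to
  \<open>(n - s, 0)\<close>, or kills it if \<open>s > n\<close>. A nonzero power \<open>k\<close>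
  of \<gamma> kills it or moves it to second coordinate \<open>k\<close>, and raising by
  \<open>r\<close> leads back to \<open>(n, 0)\<close> only if \<open>k = 0\<close> and
  \<open>r = s\<close>.\<close>

lemma su_value:
  assumes e: "e = (\<lambda>i. if i = (n, 0) then 1 else 0)"
  shows "((su_op (Galpha, True) ^^ r)
      (((if 0 \<le> k then su_op (Ggamma, False) ^^ nat k else su_op (Ggamma, True) ^^ nat (- k))
        ((su_op (Galpha, False) ^^ s) e)))) (n, 0) = (if r = s \<and> s \<le> n \<and> k = 0 then 1 else 0)"
proof -
  have alpha: "(su_op (Galpha, False) ^^ s) f = (\<lambda>(i, k). f (i + s, k))" for f s
    by (induction s) (auto simp: fun_eq_iff)
  have alpha': "(su_op (Galpha, True) ^^ r) f = (\<lambda>(i, k). if i < r then 0 else f (i - r, k))" for f r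
    by (induction r) (auto simp: fun_eq_iff)
  have gamma: "(su_op (Ggamma, False) ^^ m) f = (\<lambda>(i, k). if i = 0 then f (0, k - int m) else 0)"
    if "m > 0" for m f
    using that by (induction m rule: nat_induct_non_zero) (auto simp: fun_eq_iff algebra_simps)
  have gamma': "(su_op (Ggamma, True) ^^ m) f = (\<lambda>(i, k). if i = 0 then f (0, k + int m) else 0)"
    if "m > 0" for m f
    using that by (induction m rule: nat_induct_non_zero) (auto simp: fun_eq_iff algebra_simps)
  consider "k = 0" | "k > 0" | "k < 0" by linarith
  then show ?thesis
    by cases (auto simp: alpha alpha' gamma gamma' e)
qed

text \<open>The vector functional at \<open>e\<close> is bounded by \<open>su_seminorm\<close>, a
  C*-seminorm vanishing on the relations, hence by the universal norm. It therefore descends to the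
  algebra, and it is positive as a vector functional.\<close>

lemma SU02_state_exists:
  fixes \<alpha> \<gamma> :: "'b::cstar_algebra"
  assumes "C_SU02 \<alpha> \<gamma>"
  shows "\<exists>\<psi>. state \<psi> \<and> (\<forall>r s k. \<psi> ((\<alpha>\<^sup>\<star>) ^ r * spow \<gamma> k * \<alpha> ^ s) = (if r = s \<and> s \<le> n \<and> k = 0 then 1 else 0))"
proof -
  define f where "f i = (case i of Galpha \<Rightarrow> \<alpha> | Ggamma \<Rightarrow> \<gamma>)" for i
  have univ: "universal_cstar SU02_relations f"
    using assms by (simp add: C_SU02_def f_def[abs_def])
  have dense: "closure (range (free_eval f)) = UNIV" by (rule universal_dense[OF univ])
  have "\<forall>p. cstar_seminorm p \<and> (\<forall>r\<in>SU02_relations. p r = 0) \<longrightarrow> (\<forall>x. p x \<le> norm (free_eval f x))"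
    using univ by (simp add: universal_cstar_def)
  from this[THEN spec, of su_seminorm]
  have le: "su_seminorm x \<le> norm (free_eval f x)" for x
    using cstar_seminorm_su_seminorm su_seminorm_relations by blast
  define e :: vec where "e = (\<lambda>i. if i = (n, 0) then 1 else 0)"
  have supp: "{i. e i \<noteq> 0} = {(n, 0)}" by (auto simp: e_def)
  have e: "fin_supp e" "vnorm e = 1"
    using vnorm_L2[of "{(n, 0)}" e] supp by (simp_all add: fin_supp_def L2_set_def e_def)
  have inner_e: "vinner e g = g (n, 0)" for g
    using vinner_sum[of "{(n, 0)}" e g] supp by (simp add: e_def)
  define F where "F x = su_rep x e (n, 0)" for x
  have F_bound: "cmod (F x) \<le> norm (free_eval f x)" for x
  proof -
    have "cmod (F x) \<le> vnorm e * vnorm (su_rep x e)"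
      unfolding F_def inner_e[symmetric] by (rule vinner_cauchy_schwarz[OF e(1) fin_supp_su_rep[OF e(1)]])
    then show ?thesis using su_seminorm_le[OF e(1), of x] e(2) le[of x] by simp
  qed
  obtain \<psi> where st: "state \<psi>" and \<psi>F: "\<And>x. \<psi> (free_eval f x) = F x"
  proof (rule state_factor[of "free_eval f" "(+)" free_scaleC F 1])
    fix x
    have x: "fin_supp (su_rep x e)" by (rule fin_supp_su_rep[OF e(1)])
    have "F (free_star x * x) = cnj (vinner (su_rep (free_star x) (su_rep x e)) e)"
      by (simp add: F_def su_rep_mult vinner_cnj inner_e)
    also have "\<dots> = of_real ((vnorm (su_rep x e))\<^sup>2)"
      by (simp add: su_rep_adjoint[OF x e(1)] vinner_self_vnorm[OF x])
    finally have "F (free_star x * x) \<in> \<real>\<^sub>\<ge>\<^sub>0" by (simp del: of_real_power)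
    then show "\<exists>y. (free_eval f x)\<^sup>\<star> * free_eval f x = free_eval f y \<and> F y \<in> \<real>\<^sub>\<ge>\<^sub>0"
      by (intro exI[of _ "free_star x * x"]) (simp add: free_eval_mult free_eval_star)
  qed (simp_all add: dense free_eval_add free_eval_scaleC free_eval_one F_bound,
      simp_all add: F_def su_rep_add su_rep_scaleC su_rep_one e_def)
  have "\<psi> ((\<alpha>\<^sup>\<star>) ^ r * spow \<gamma> k * \<alpha> ^ s) = (if r = s \<and> s \<le> n \<and> k = 0 then 1 else 0)" for r k s
  proof -
    have pow: "free_eval f (x ^ m) = free_eval f x ^ m" for x m
      by (induction m) (simp_all add: free_eval_one free_eval_mult)
    define w where "w = free_star (free_gen Galpha) ^ r *
      (if 0 \<le> k then free_gen Ggamma ^ nat k else free_star (free_gen Ggamma) ^ nat (- k)) *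
      free_gen Galpha ^ s"
    have "free_eval f w = (\<alpha>\<^sup>\<star>) ^ r * spow \<gamma> k * \<alpha> ^ s"
      by (simp add: w_def free_eval_mult pow free_eval_star free_eval_gen spow_def f_def)
    moreover have "su_rep (free_gen g) = su_op (g, False)" "su_rep (free_star (free_gen g)) = su_op (g, True)" for g
      by (simp_all add: fun_eq_iff su_rep_gen su_rep_gen_star)
    then have "F w = (if r = s \<and> s \<le> n \<and> k = 0 then 1 else 0)"
      unfolding F_def w_def su_rep_mult su_value[OF e_def, of r k s, symmetric]
      by (simp add: su_rep_power if_distrib[of su_rep] if_distribR)
    ultimately show ?thesis using \<psi>F[of w] by simp
  qed
  then show ?thesis using st by blast
qed

section \<open>Haar measures on the circle\<close>

lemma circle_eq_iff: "x = y \<longleftrightarrow> circle_val x = circle_val y"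
  by (simp add: circle_val_inject)

lemma circle_val_to_circle: "cmod z = 1 \<Longrightarrow> circle_val (to_circle z) = z"
  by (simp add: to_circle_inverse)

lemma circle_val_nonzero [simp]: "circle_val z \<noteq> 0"
  using circle_val_norm[of z] by (metis norm_zero zero_neq_one)

lemma continuous_on_to_circle:
  assumes "continuous_on A f" "\<And>x. x \<in> A \<Longrightarrow> cmod (f x) = 1"
  shows "continuous_on A (\<lambda>x. to_circle (f x))"
proof -
  have "((\<lambda>y. to_circle (f y)) \<longlongrightarrow> to_circle (f x)) (at x within A)" if x: "x \<in> A" for x
    unfolding tendsto_iff dist_circle_def
  proof (intro allI impI)
    fix e :: real assume "e > 0"
    then have "\<forall>\<^sub>F y in at x within A. dist (f y) (f x) < e"
      using assms(1) x by (simp add: continuous_on_def tendsto_iff)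
    moreover have "\<forall>\<^sub>F y in at x within A. y \<in> A"
      by (simp add: eventually_at_topological) blast
    ultimately show "\<forall>\<^sub>F y in at x within A. dist (circle_val (to_circle (f y))) (circle_val (to_circle (f x))) < e"
      by eventually_elim (simp add: circle_val_to_circle assms(2) x)
  qed
  then show ?thesis by (simp add: continuous_on_def)
qed

lemma compact_circle: "compact (UNIV :: circle set)"
proof -
  have "compact (to_circle ` sphere 0 1)"
    by (intro compact_continuous_image continuous_on_to_circle continuous_intros) auto
  moreover have "to_circle ` sphere 0 1 = UNIV"
    by (metis (no_types, lifting) UNIV_eq_I circle_val_inverse circle_val_norm image_eqI mem_sphere_0)
  ultimately show ?thesis by simp
qed

text \<open>Makes the Borel sets of the torus those of the product measure space, as Fubini
  arguments require. The circle carries the metric of the plane, so preimages of a countable basis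
  there do.\<close>

instance circle :: second_countable_topology
proof
  obtain B :: "complex set set" where B: "countable B" "topological_basis B"
    using ex_countable_basis by blast
  have "topological_basis ((\<lambda>U. circle_val -` U) ` B)"
    unfolding topological_basis_def
  proof (intro conjI allI impI)
    have "open (circle_val -` U)" if "U \<in> B" for U
      using topological_basis_open[OF B(2) that] continuous_on_circle_val[OF continuous_on_id]
      by (simp add: open_vimage)
    then show "\<forall>b\<in>(\<lambda>U. circle_val -` U) ` B. open b" by blast
  next
    fix S :: "circle set" assume S: "open S"
    have *: "\<exists>U\<in>B. z \<in> circle_val -` U \<and> circle_val -` U \<subseteq> S" if z: "z \<in> S" for z
    proof -
      obtain e where "e > 0" and e: "\<And>y. dist y z < e \<Longrightarrow> y \<in> S"
        using S z unfolding open_dist by blast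
      obtain U where "U \<in> B" "circle_val z \<in> U" "U \<subseteq> ball (circle_val z) e"
        using topological_basisE[OF B(2) open_ball, of "circle_val z" "circle_val z" e] \<open>e > 0\<close> by auto
      then show ?thesis
        using e by (intro bexI[of _ U]) (auto simp: dist_circle_def dist_commute subset_iff)
    qed
    have "S = \<Union>{V \<in> (\<lambda>U. circle_val -` U) ` B. V \<subseteq> S}"
    proof (intro equalityI subsetI)
      fix z assume "z \<in> S"
      from * [OF this] obtain U where "U \<in> B" "z \<in> circle_val -` U" "circle_val -` U \<subseteq> S" by blast
      then show "z \<in> \<Union>{V \<in> (\<lambda>U. circle_val -` U) ` B. V \<subseteq> S}"
        by (intro UnionI[of "circle_val -` U"]) simp_all
    qed auto
    then show "\<exists>B'\<subseteq>(\<lambda>U. circle_val -` U) ` B. \<Union> B' = S"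
      by (intro exI[of _ "{V \<in> (\<lambda>U. circle_val -` U) ` B. V \<subseteq> S}"]) auto
  qed
  then show "\<exists>B :: circle set set. countable B \<and> open = generate_topology B"
    using B(1) topological_basis_imp_subbasis by (intro exI[of _ "(\<lambda>U. circle_val -` U) ` B"]) auto
qed

lemma haar_measure_ofD:
  assumes "haar_measure_of G H \<mu>"
  shows "sets \<mu> = sets borel" "space \<mu> = UNIV" "prob_space \<mu>" "emeasure \<mu> H = 1"
    "\<And>h. h \<in> H \<Longrightarrow> distr \<mu> borel (\<lambda>x. h \<otimes>\<^bsub>G\<^esub> x) = \<mu>"
  using assms sets_eq_imp_space_eq[of \<mu> borel] by (auto simp: haar_measure_of_def)

lemma haar_AE:
  assumes "haar_measure_of G H \<mu>" "H \<in> sets borel"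
  shows "AE x in \<mu>. x \<in> H"
proof -
  interpret prob_space \<mu> by (rule haar_measure_ofD[OF assms(1)])
  have "prob H = 1" using haar_measure_ofD(4)[OF assms(1)] by (simp add: measure_def)
  then show ?thesis using assms haar_measure_ofD(1)[OF assms(1)] by (intro AE_prob_1) auto
qed

lemma integrable_continuous_bounded:
  fixes f :: "'a::topological_space \<Rightarrow> complex"
  assumes "prob_space \<mu>" "sets \<mu> = sets borel" "continuous_on UNIV f" "\<And>x. cmod (f x) \<le> B"
  shows "integrable \<mu> f"
proof -
  interpret prob_space \<mu> by fact
  have "f \<in> borel_measurable \<mu>"
    using borel_measurable_continuous_onI[OF assms(3)] measurable_cong_sets[OF assms(2) refl] by blast
  then show ?thesis using assms(4) by (intro integrable_const_bound[where B = B]) auto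
qed

text \<open>If \<open>\<xi> h \<noteq> 1\<close> for some \<open>h\<close> in \<open>H\<close>,
  invariance shows that the integral equals \<open>\<xi> h\<close> times itself, so it is 0.
  Otherwise \<open>\<xi> = 1\<close> almost everywhere, since the measure is concentrated on
  \<open>H\<close>.\<close>

lemma haar_integral_character:
  fixes \<xi> :: "'a::topological_space \<Rightarrow> complex"
  assumes haar: "haar_measure_of G H \<mu>" and H: "H \<in> sets borel"
    and trans: "\<And>h. h \<in> H \<Longrightarrow> continuous_on UNIV (\<lambda>x. h \<otimes>\<^bsub>G\<^esub> x)"
    and cont: "continuous_on UNIV \<xi>"
    and mult: "\<And>h x. h \<in> H \<Longrightarrow> \<xi> (h \<otimes>\<^bsub>G\<^esub> x) = \<xi> h * \<xi> x"
  shows "(\<integral>x. \<xi> x \<partial>\<mu>) = (if \<forall>h\<in>H. \<xi> h = 1 then 1 else 0)"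
proof (cases "\<forall>h\<in>H. \<xi> h = 1")
  case True
  interpret prob_space \<mu> by (rule haar_measure_ofD[OF haar])
  have "(\<integral>x. \<xi> x \<partial>\<mu>) = (\<integral>x. 1 \<partial>\<mu>)"
    using haar_AE[OF haar H] True measurable_cong_sets[OF haar_measure_ofD(1)[OF haar] refl]
      borel_measurable_continuous_onI[OF cont]
    by (intro integral_cong_AE) auto
  then show ?thesis using True by (simp add: prob_space)
next
  case False
  then obtain h where h: "h \<in> H" "\<xi> h \<noteq> 1" by blast
  have meas: "(\<lambda>x. h \<otimes>\<^bsub>G\<^esub> x) \<in> measurable \<mu> borel"
    using borel_measurable_continuous_onI[OF trans[OF h(1)]]
      measurable_cong_sets[OF haar_measure_ofD(1)[OF haar] refl] by blast
  have "(\<integral>x. \<xi> x \<partial>\<mu>) = (\<integral>x. \<xi> x \<partial>distr \<mu> borel (\<lambda>x. h \<otimes>\<^bsub>G\<^esub> x))"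
    by (simp add: haar_measure_ofD(5)[OF haar h(1)])
  also have "\<dots> = (\<integral>x. \<xi> (h \<otimes>\<^bsub>G\<^esub> x) \<partial>\<mu>)"
    by (rule integral_distr[OF meas borel_measurable_continuous_onI[OF cont]])
  also have "\<dots> = \<xi> h * (\<integral>x. \<xi> x \<partial>\<mu>)" by (simp add: mult[OF h(1)])
  finally show ?thesis using h False by auto
qed

text \<open>Both measures equal their convolution, by Fubini.\<close>

lemma haar_measure_unique:
  fixes \<mu> \<nu> :: "'a::second_countable_topology measure"
  assumes \<mu>: "haar_measure_of G H \<mu>" and \<nu>: "haar_measure_of G H \<nu>" and H: "H \<in> sets borel"
    and comm: "\<And>x y. x \<otimes>\<^bsub>G\<^esub> y = y \<otimes>\<^bsub>G\<^esub> x"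
    and cont: "continuous_on UNIV (\<lambda>z. fst z \<otimes>\<^bsub>G\<^esub> snd z)"
  shows "\<mu> = \<nu>"
proof (rule measure_eqI)
  show "sets \<mu> = sets \<nu>" using haar_measure_ofD(1)[OF \<mu>] haar_measure_ofD(1)[OF \<nu>] by simp
  interpret M: prob_space \<mu> by (rule haar_measure_ofD[OF \<mu>])
  interpret N: prob_space \<nu> by (rule haar_measure_ofD[OF \<nu>])
  interpret P: pair_sigma_finite \<mu> \<nu> ..
  fix A assume "A \<in> sets \<mu>"
  then have A: "A \<in> sets borel" using haar_measure_ofD(1)[OF \<mu>] by simp
  have trans: "(\<lambda>x. h \<otimes>\<^bsub>G\<^esub> x) \<in> borel_measurable borel" for h
    by (rule borel_measurable_continuous_onI) (rule continuous_on_compose2[OF cont, of _ "\<lambda>x. (h, x)", simplified], auto intro!: continuous_intros)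
  have pair: "(\<lambda>z. fst z \<otimes>\<^bsub>G\<^esub> snd z) \<in> borel_measurable (\<mu> \<Otimes>\<^sub>M \<nu>)"
  proof -
    have "sets (\<mu> \<Otimes>\<^sub>M \<nu>) = sets (borel :: ('a \<times> 'a) measure)"
      unfolding borel_prod[where 'a = 'a and 'b = 'a, symmetric]
      by (rule sets_pair_measure_cong[OF haar_measure_ofD(1)[OF \<mu>] haar_measure_ofD(1)[OF \<nu>]])
    then show ?thesis
      using borel_measurable_continuous_onI[OF cont] measurable_cong_sets by blast
  qed
  have inv: "(\<integral>\<^sup>+ x. indicator A (h \<otimes>\<^bsub>G\<^esub> x) \<partial>\<kappa>) = emeasure \<kappa> A"
    if "haar_measure_of G H \<kappa>" "h \<in> H" for \<kappa> h
  proof -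
    have "emeasure \<kappa> A = (\<integral>\<^sup>+ x. indicator A x \<partial>distr \<kappa> borel (\<lambda>x. h \<otimes>\<^bsub>G\<^esub> x))"
      using A haar_measure_ofD[OF that(1)] that(2) by simp
    also have "\<dots> = (\<integral>\<^sup>+ x. indicator A (h \<otimes>\<^bsub>G\<^esub> x) \<partial>\<kappa>)"
      using A trans[of h] haar_measure_ofD(1)[OF that(1)]
      by (intro nn_integral_distr) (auto cong: measurable_cong_sets)
    finally show ?thesis by simp
  qed
  have "emeasure \<mu> A = (\<integral>\<^sup>+ y. emeasure \<mu> A \<partial>\<nu>)" by (simp add: N.emeasure_space_1)
  \<comment> \<open>Almost every \<open>y\<close> lies in \<open>H\<close>; commutativity turns the
    right translate into a left one, for which \<open>\<mu>\<close> is invariant.\<close>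
  also have "\<dots> = (\<integral>\<^sup>+ y. (\<integral>\<^sup>+ x. indicator A (x \<otimes>\<^bsub>G\<^esub> y) \<partial>\<mu>) \<partial>\<nu>)"
    using haar_AE[OF \<nu> H] by (intro nn_integral_cong_AE) (auto simp: inv[OF \<mu>] comm)
  also have "\<dots> = (\<integral>\<^sup>+ x. (\<integral>\<^sup>+ y. indicator A (x \<otimes>\<^bsub>G\<^esub> y) \<partial>\<nu>) \<partial>\<mu>)"
    using measurable_compose[OF pair borel_measurable_indicator[OF A]]
    by (intro P.Fubini') (simp add: case_prod_unfold)
  also have "\<dots> = (\<integral>\<^sup>+ x. emeasure \<nu> A \<partial>\<mu>)"
    using haar_AE[OF \<mu> H] by (intro nn_integral_cong_AE) (auto simp: inv[OF \<nu>])
  also have "\<dots> = emeasure \<nu> A" by (simp add: M.emeasure_space_1)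
  finally show "emeasure \<mu> A = emeasure \<nu> A" .
qed

lemma circle_group_mult: "x \<otimes>\<^bsub>circle_group\<^esub> y = circle_mult x y"
  by (simp add: circle_group_def)

lemma circle_mult_commute: "circle_mult x y = circle_mult y x"
  by (simp add: circle_eq_iff circle_mult.rep_eq mult.commute)

lemma circle_mult_assoc: "circle_mult (circle_mult x y) z = circle_mult x (circle_mult y z)"
  by (simp add: circle_eq_iff circle_mult.rep_eq)

lemma circle_mult_one [simp]: "circle_mult circle_one x = x" "circle_mult x circle_one = x"
  by (simp_all add: circle_eq_iff circle_mult.rep_eq circle_one.rep_eq)

section \<open>Integer powers and closed subgroups of the circle\<close>

definition circle_powi :: "circle \<Rightarrow> int \<Rightarrow> circle" where
  "circle_powi z k = to_circle (circle_val z powi k)"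

lemma circle_val_powi [simp]: "circle_val (circle_powi z k) = circle_val z powi k"
  unfolding circle_powi_def by (rule circle_val_to_circle) (simp add: norm_power_int)

lemma continuous_on_circle_val_powi [continuous_intros]:
  "continuous_on A f \<Longrightarrow> continuous_on A (\<lambda>x. circle_val (f x) powi k)"
  by (intro continuous_on_power_int continuous_intros) auto

lemma continuous_on_circle_powi [continuous_intros]:
  "continuous_on A f \<Longrightarrow> continuous_on A (\<lambda>x. circle_powi (f x) k)"
  unfolding circle_powi_def by (intro continuous_on_to_circle continuous_intros) (auto simp: norm_power_int)

text \<open>The closed subgroups of the circle, with the whole circle for index 0, so that the annihilator
  of the subgroup with index \<open>p\<close> is \<open>p\<int>\<close> in all cases.\<close>

definition root_group :: "nat \<Rightarrow> circle set" where
  "root_group p = circle_subgroup (if p = 0 then \<infinity> else enat p)"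

lemma root_group_0: "root_group 0 = UNIV"
  by (simp add: root_group_def circle_subgroup_def)

lemma mem_root_group: "z \<in> root_group p \<longleftrightarrow> circle_val z ^ p = 1"
  by (simp add: root_group_def circle_subgroup_def)

lemma closed_root_group: "closed (root_group p)"
proof -
  have "root_group p = {z. circle_val z ^ p = 1}" by (auto simp: mem_root_group)
  moreover have "closed {z. circle_val z ^ p = 1}" by (intro closed_Collect_eq continuous_intros)
  ultimately show ?thesis by simp
qed

lemma root_group_mult: "x \<in> root_group p \<Longrightarrow> y \<in> root_group p \<Longrightarrow> circle_mult x y \<in> root_group p"
  by (simp add: mem_root_group circle_mult.rep_eq power_mult_distrib)

lemma root_group_one: "circle_one \<in> root_group p"
  by (simp add: mem_root_group circle_one.rep_eq)

lemma root_group_powi: "x \<in> root_group p \<Longrightarrow> circle_powi x k \<in> root_group p"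
  unfolding mem_root_group circle_val_powi
  by (metis mult.commute power_int_mult power_int_of_nat power_int_1_left)

lemma root_group_annihilator: "(\<forall>z\<in>root_group p. circle_val z powi l = 1) \<longleftrightarrow> int p dvd l"
proof
  assume *: "\<forall>z\<in>root_group p. circle_val z powi l = 1"
  show "int p dvd l"
  proof (cases "p = 0")
    case True
    show ?thesis
    proof (rule ccontr)
      assume "\<not> int p dvd l"
      then have l: "l \<noteq> 0" by auto
      \<comment> \<open>Chosen so that its \<open>l\<close>-th power is -1.\<close>
      define z where "z = to_circle (cis (pi / of_int l))"
      have "circle_val z powi l = cis (of_int l * (pi / of_int l))"
        by (simp add: z_def circle_val_to_circle cis_power_int)
      also have "\<dots> = -1" using l by simp
      finally show False using * True by (auto simp: root_group_0)
    qed
  next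
    case False
    \<comment> \<open>A primitive \<open>p\<close>-th root of unity: its \<open>j\<close>-th power
      is 1 only if \<open>p\<close> divides \<open>j\<close>.\<close>
    define z where "z = to_circle (exp (2 * of_real pi * \<i> / of_nat p))"
    have z: "circle_val z = exp (2 * of_real pi * \<i> / of_nat p)"
      unfolding z_def by (rule circle_val_to_circle) (simp add: norm_exp_eq_Re)
    have pow: "circle_val z ^ j = exp (2 * of_real pi * \<i> * of_nat j / of_nat p)" for j
      by (simp add: z mult.commute flip: exp_of_nat_mult)
    have "z \<in> root_group p"
      unfolding mem_root_group pow using False by (subst complex_root_unity_eq_1) auto
    then have "circle_val z powi l = 1" using * by blast
    then have "circle_val z ^ nat \<bar>l\<bar> = 1"
      by (cases "l \<ge> 0") (auto simp: power_int_def power_inverse)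
    then have "p dvd nat \<bar>l\<bar>"
      unfolding pow using False by (subst (asm) complex_root_unity_eq_1) auto
    then show ?thesis by (simp add: int_dvd_int_iff[symmetric])
  qed
next
  assume "int p dvd l"
  then obtain k where "l = int p * k" by (auto simp: dvd_def)
  then show "\<forall>z\<in>root_group p. circle_val z powi l = 1"
    by (simp add: mem_root_group power_int_mult)
qed

lemma finite_root_group:
  assumes "p > 0"
  shows "finite (root_group p)"
proof -
  have "finite (circle_val ` root_group p)"
    by (rule finite_subset[OF _ finite_roots_unity[of p]]) (use assms in \<open>auto simp: mem_root_group\<close>)
  then show ?thesis by (rule finite_imageD) (simp add: inj_on_def circle_val_inject)
qed

lemma circle_mult_continuous: "continuous_on UNIV (circle_mult h)"
  using continuous_on_circle_mult[OF continuous_on_const continuous_on_id] .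

text \<open>The uniform distribution, which multiplication by a group element permutes. Pushing it
  forward along the identity replaces the discrete sigma-algebra of a \<open>pmf\<close> by the
  Borel sets.\<close>

lemma circle_haar_exists_finite:
  assumes "p > 0"
  shows "haar_measure_of circle_group (root_group p) (distr (measure_pmf (pmf_of_set (root_group p))) borel (\<lambda>x. x))"
    (is "haar_measure_of _ ?H ?\<mu>")
  unfolding haar_measure_of_def
proof (intro conjI ballI)
  have fin: "finite ?H" "?H \<noteq> {}" using finite_root_group[OF assms] root_group_one by auto
  show "prob_space ?\<mu>" by (intro measure_pmf.prob_space_distr) simp
  have "emeasure ?\<mu> ?H = emeasure (measure_pmf (pmf_of_set ?H)) ?H"
    using closed_root_group by (subst emeasure_distr) auto
  also have "\<dots> = 1" using fin by (simp add: measure_pmf.emeasure_eq_measure measure_pmf_of_set)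
  finally show "emeasure ?\<mu> ?H = 1" .
  fix h assume h: "h \<in> ?H"
  have "bij_betw (circle_mult h) ?H ?H"
  proof (rule bij_betwI[where g = "circle_mult (circle_powi h (-1))"])
    show "circle_mult h \<in> ?H \<rightarrow> ?H" "circle_mult (circle_powi h (- 1)) \<in> ?H \<rightarrow> ?H"
      using h root_group_mult root_group_powi by auto
  qed (auto simp: circle_eq_iff circle_mult.rep_eq)
  then have "map_pmf (circle_mult h) (pmf_of_set ?H) = pmf_of_set ?H"
    using fin by (intro map_pmf_of_set_bij_betw) auto
  then have "?\<mu> = distr (measure_pmf (map_pmf (circle_mult h) (pmf_of_set ?H))) borel (\<lambda>x. x)" by simp
  also have "\<dots> = distr (measure_pmf (pmf_of_set ?H)) borel (circle_mult h)"
    unfolding map_pmf_rep_eq by (subst distr_distr) (auto simp: comp_def)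
  also have "\<dots> = distr ?\<mu> borel (circle_mult h)"
    using borel_measurable_continuous_onI[OF circle_mult_continuous]
    by (subst distr_distr) (auto simp: comp_def)
  finally show "distr ?\<mu> borel (\<lambda>x. h \<otimes>\<^bsub>circle_group\<^esub> x) = ?\<mu>" by (simp add: circle_group_mult)
qed simp

text \<open>The image of Lebesgue measure on the half-open unit interval under
  \<open>t \<mapsto> cis (2 * pi * t)\<close>. Multiplication by \<open>h\<close> becomes
  translation by \<open>\<tau>\<close> modulo 1.\<close>

lemma circle_haar_exists_UNIV:
  "\<exists>\<mu>. haar_measure_of circle_group UNIV \<mu>"
proof -
  define e where "e t = to_circle (cis (2 * pi * t))" for t :: real
  have e_val: "circle_val (e t) = cis (2 * pi * t)" for t by (simp add: e_def circle_val_to_circle)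
  have "continuous_on UNIV e"
    unfolding e_def[abs_def] by (intro continuous_on_to_circle continuous_intros) auto
  then have e_meas: "e \<in> borel_measurable borel" by (rule borel_measurable_continuous_onI)
  define U where "U = uniform_measure lborel {0..<1::real}"
  interpret U: prob_space U unfolding U_def by (intro prob_space_uniform_measure) auto
  have sets_U: "sets U = sets borel" by (simp add: U_def)
  have e_U: "e \<in> borel_measurable U" using e_meas measurable_cong_sets[OF sets_U refl] by blast
  define \<mu> where "\<mu> = distr U borel e"
  have \<mu>: "emeasure \<mu> A = emeasure lborel ({t. e t \<in> A} \<inter> {0..<1})" if A: "A \<in> sets borel" for A
  proof -
    have m: "{t. e t \<in> A} \<in> sets borel" using measurable_sets[OF e_meas A] by (simp add: vimage_def)
    have "emeasure \<mu> A = emeasure U {t. e t \<in> A}"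
      using A e_U by (simp add: \<mu>_def emeasure_distr vimage_def U_def)
    then show ?thesis using m by (simp add: U_def emeasure_uniform_measure Int_commute divide_ennreal_def)
  qed
  have "haar_measure_of circle_group UNIV \<mu>"
    unfolding haar_measure_of_def
  proof (intro conjI ballI)
    show "sets \<mu> = sets borel" by (simp add: \<mu>_def)
    show "prob_space \<mu>" unfolding \<mu>_def by (rule U.prob_space_distr[OF e_U])
    then show "emeasure \<mu> UNIV = 1" using prob_space.emeasure_space_1[of \<mu>] by (simp add: \<mu>_def)
    fix h
    define \<tau> where "\<tau> = Arg2pi (circle_val h) / (2 * pi)"
    have \<tau>: "0 \<le> \<tau>" "\<tau> < 1" using Arg2pi_ge_0[of "circle_val h"] Arg2pi_lt_2pi[of "circle_val h"]
      by (simp_all add: \<tau>_def)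
    have h_val: "circle_val h = cis (2 * pi * \<tau>)"
      using complex_norm_eq_1_exp[of "circle_val h"] by (simp add: \<tau>_def cis_conv_exp)
    have shift: "circle_mult h (e t) = e (t + \<tau>)" for t
      by (simp add: circle_eq_iff circle_mult.rep_eq h_val e_val cis_mult distrib_left add.commute)
    have period: "e (t + 1) = e t" for t
      by (simp add: circle_eq_iff e_val distrib_left flip: cis_mult)
    show "distr \<mu> borel (\<lambda>x. h \<otimes>\<^bsub>circle_group\<^esub> x) = \<mu>"
      unfolding circle_group_mult
    proof (rule measure_eqI)
      fix A assume "A \<in> sets (distr \<mu> borel (circle_mult h))"
      then have A: "A \<in> sets borel" by simp
      have h_meas: "circle_mult h \<in> borel_measurable borel"
        by (rule borel_measurable_continuous_onI[OF circle_mult_continuous])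
      define B where "B = {t. e t \<in> A}"
      have B: "B \<in> sets borel" using measurable_sets[OF e_meas A] by (simp add: B_def vimage_def)
      have translate: "emeasure lborel {t. t + c \<in> S} = emeasure lborel S" if "S \<in> sets borel" for S and c :: real
      proof -
        have "emeasure lborel S = emeasure (distr lborel borel ((+) c)) S" by (simp add: lborel_distr_plus)
        also have "\<dots> = emeasure lborel {t. t + c \<in> S}"
          using that by (subst emeasure_distr) (auto simp: vimage_def add.commute)
        finally show ?thesis by simp
      qed
      have "emeasure (distr \<mu> borel (circle_mult h)) A = emeasure \<mu> (circle_mult h -` A)"
        using A h_meas by (subst emeasure_distr) (auto simp: \<mu>_def)
      also have "\<dots> = emeasure lborel ({t. t + \<tau> \<in> B} \<inter> {0..<1})"
        using measurable_sets[OF h_meas A] by (simp add: \<mu> shift B_def)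
      also have "{t. t + \<tau> \<in> B} \<inter> {0..<1} = {t. t + \<tau> \<in> B \<inter> {\<tau>..<\<tau> + 1}}" by auto
      also have "emeasure lborel \<dots> = emeasure lborel (B \<inter> {\<tau>..<\<tau> + 1})"
        using B by (intro translate) auto
      \<comment> \<open>The translated interval is cut at 1, and by periodicity the part beyond 1 is
        moved back to fill the gap from 0 to \<open>\<tau>\<close>.\<close>
      also have "B \<inter> {\<tau>..<\<tau> + 1} = (B \<inter> {\<tau>..<1}) \<union> (B \<inter> {1..<\<tau> + 1})" using \<tau> by auto
      also have "emeasure lborel \<dots> = emeasure lborel (B \<inter> {\<tau>..<1}) + emeasure lborel (B \<inter> {1..<\<tau> + 1})"
        using B by (intro plus_emeasure[symmetric]) auto
      also have "emeasure lborel (B \<inter> {1..<\<tau> + 1}) = emeasure lborel {t. t + 1 \<in> B \<inter> {1..<\<tau> + 1}}"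
        using B by (intro translate[symmetric]) auto
      also have "{t. t + 1 \<in> B \<inter> {1..<\<tau> + 1}} = B \<inter> {0..<\<tau>}" by (auto simp: B_def period)
      also have "emeasure lborel (B \<inter> {\<tau>..<1}) + emeasure lborel (B \<inter> {0..<\<tau>}) =
          emeasure lborel ((B \<inter> {\<tau>..<1}) \<union> (B \<inter> {0..<\<tau>}))"
        using B by (intro plus_emeasure) auto
      also have "(B \<inter> {\<tau>..<1}) \<union> (B \<inter> {0..<\<tau>}) = B \<inter> {0..<1}" using \<tau> by auto
      finally show "emeasure (distr \<mu> borel (circle_mult h)) A = emeasure \<mu> A" by (simp add: \<mu>[OF A] B_def)
    qed (simp add: \<mu>_def)
  qed
  then show ?thesis by blast
qed

definition circle_haar :: "nat \<Rightarrow> circle measure" where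
  "circle_haar p = (THE \<mu>. haar_measure_of circle_group (root_group p) \<mu>)"

lemma circle_haar: "haar_measure_of circle_group (root_group p) (circle_haar p)"
  unfolding circle_haar_def
proof (rule theI')
  have "\<exists>\<mu>. haar_measure_of circle_group (root_group p) \<mu>"
    using circle_haar_exists_finite[of p] circle_haar_exists_UNIV root_group_0 by (cases "p = 0") auto
  moreover have "\<mu> = \<nu>" if "haar_measure_of circle_group (root_group p) \<mu>"
    "haar_measure_of circle_group (root_group p) \<nu>" for \<mu> \<nu>
  proof (rule haar_measure_unique[OF that])
    show "root_group p \<in> sets borel" using closed_root_group by simp
    show "continuous_on UNIV (\<lambda>z. fst z \<otimes>\<^bsub>circle_group\<^esub> snd z)"
      unfolding circle_group_mult by (intro continuous_intros)
  qed (simp add: circle_group_mult circle_mult_commute)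
  ultimately show "\<exists>!\<mu>. haar_measure_of circle_group (root_group p) \<mu>" by blast
qed

lemmas circle_haar_sets = haar_measure_ofD(1)[OF circle_haar]
  and circle_haar_prob = haar_measure_ofD(3)[OF circle_haar]

lemma circle_haar_integral: "(\<integral>z. circle_val z powi l \<partial>circle_haar p) = (if int p dvd l then 1 else 0)"
  using haar_integral_character[OF circle_haar[of p], of "\<lambda>z. circle_val z powi l"] closed_root_group
  by (simp add: circle_group_mult circle_mult_continuous circle_mult.rep_eq power_int_mult_distrib
      root_group_annihilator continuous_intros)

lemma integral_bcontfun_state:
  fixes \<mu> :: "'a::metric_space measure"
  assumes "prob_space \<mu>" and sets: "sets \<mu> = sets borel"
  shows "state (\<lambda>f :: 'a \<Rightarrow>\<^sub>C complex. \<integral>x. apply_bcontfun f x \<partial>\<mu>)"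
proof -
  interpret prob_space \<mu> by fact
  have int: "integrable \<mu> (apply_bcontfun f)" for f :: "'a \<Rightarrow>\<^sub>C complex"
    using assms by (rule integrable_continuous_bounded) (auto intro: norm_bounded)
  have "bounded_linear (\<lambda>f :: 'a \<Rightarrow>\<^sub>C complex. \<integral>x. apply_bcontfun f x \<partial>\<mu>)"
  proof (rule bounded_linear_intro[where K = 1])
    fix f :: "'a \<Rightarrow>\<^sub>C complex"
    have "cmod (\<integral>x. apply_bcontfun f x \<partial>\<mu>) \<le> (\<integral>x. cmod (apply_bcontfun f x) \<partial>\<mu>)"
      by (rule integral_norm_bound)
    also have "\<dots> \<le> norm f"
      using int[of f] by (intro integral_le_const integrable_norm) (auto simp: norm_bounded)
    finally show "cmod (\<integral>x. apply_bcontfun f x \<partial>\<mu>) \<le> norm f * 1" by simp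
  qed (simp_all add: plus_bcontfun.rep_eq scaleR_bcontfun.rep_eq int)
  moreover have "(\<integral>x. apply_bcontfun (f\<^sup>\<star> * f) x \<partial>\<mu>) \<in> \<real>\<^sub>\<ge>\<^sub>0" for f :: "'a \<Rightarrow>\<^sub>C complex"
  proof -
    have "(\<integral>x. apply_bcontfun (f\<^sup>\<star> * f) x \<partial>\<mu>) = (\<integral>x. complex_of_real ((cmod (apply_bcontfun f x))\<^sup>2) \<partial>\<mu>)"
      unfolding complex_norm_square
      by (simp add: times_bcontfun.rep_eq star_bcontfun.rep_eq star_complex_def mult.commute)
    also have "\<dots> = of_real (\<integral>x. (cmod (apply_bcontfun f x))\<^sup>2 \<partial>\<mu>)"
      by (rule integral_complex_of_real)
    finally show ?thesis by (simp del: of_real_power)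
  qed
  ultimately show ?thesis
    by (simp add: state_def bounded_functional_def scaleC_bcontfun.rep_eq scaleC_complex_def
        one_bcontfun.rep_eq prob_space)
qed

section \<open>The idempotent states of \<open>C(U(1))\<close>\<close>

abbreviation circle_index :: "nat \<Rightarrow> enat" where
  "circle_index p \<equiv> if p = 0 then \<infinity> else enat p"

lemma circle_index_surj:
  assumes "m \<noteq> 0"
  obtains p where "m = circle_index p"
proof (cases m)
  case (enat k)
  then show ?thesis using assms that[of k] by (cases "k = 0") (auto simp: zero_enat_def)
next
  case infinity
  then show ?thesis using that[of 0] by simp
qed

lemma circle_state_alt: "circle_state (circle_index p) f = (\<integral>z. apply_bcontfun f z \<partial>circle_haar p)"
  by (simp only: circle_state_def circle_haar_def root_group_def)

lemma circle_state_state: "state (circle_state (circle_index p))"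
  unfolding circle_state_alt[abs_def]
  by (rule integral_bcontfun_state[OF circle_haar_prob circle_haar_sets])

lemma apply_spow_unimodular:
  fixes f :: "('x::metric_space) \<Rightarrow>\<^sub>C complex"
  assumes "cmod (apply_bcontfun f z) = 1"
  shows "apply_bcontfun (spow f l) z = apply_bcontfun f z powi l"
proof -
  have power: "apply_bcontfun (g ^ n) z = apply_bcontfun g z ^ n" for g :: "'x \<Rightarrow>\<^sub>C complex" and n
    by (induction n) (simp_all add: one_bcontfun.rep_eq times_bcontfun.rep_eq)
  have "inverse (apply_bcontfun f z) = cnj (apply_bcontfun f z)"
    using assms by (intro inverse_unique) (simp add: complex_norm_square[symmetric])
  then show ?thesis
    by (simp add: spow_def power power_int_def star_bcontfun.rep_eq star_complex_def)
qed

lemma apply_circle_coord_spow: "apply_bcontfun (spow circle_coord l) z = circle_val z powi l"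
  using apply_spow_unimodular[of circle_coord z l] by (simp add: circle_coord.rep_eq)

lemma circle_state_coord: "circle_state (circle_index p) (spow circle_coord l) = (if int p dvd l then 1 else 0)"
  by (simp only: circle_state_alt apply_circle_coord_spow circle_haar_integral)

section \<open>Density of elementary tensors in the functions on the torus\<close>

definition circle_tensors :: "((circle \<times> circle) \<Rightarrow>\<^sub>C complex) set" where
  "circle_tensors = range (\<lambda>(f, g). circle_tensor f g)"

lemma circle_tensor_in_span: "circle_tensor f g \<in> span circle_tensors"
  unfolding circle_tensors_def by (rule span_base) (auto simp: image_iff)

lemma circle_tensors_mult:
  assumes "F \<in> span circle_tensors" "G \<in> span circle_tensors"
  shows "F * G \<in> span circle_tensors"
proof (rule linear_span_subset[OF _ _ assms(1), of "\<lambda>F. F * G"])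
  fix F assume "F \<in> circle_tensors"
  then obtain f g where F: "F = circle_tensor f g" by (auto simp: circle_tensors_def)
  show "F * G \<in> span circle_tensors"
  proof (rule linear_span_subset[OF _ _ assms(2), of "\<lambda>G. F * G"])
    fix G assume "G \<in> circle_tensors"
    then obtain f' g' where G: "G = circle_tensor f' g'" by (auto simp: circle_tensors_def)
    have "F * G = circle_tensor (f * f') (g * g')"
      by (rule bcontfun_eqI) (simp add: F G times_bcontfun.rep_eq)
    then show "F * G \<in> span circle_tensors" by (simp add: circle_tensor_in_span)
  qed (simp add: bounded_linear.linear bounded_linear_mult_right)
qed (simp add: bounded_linear.linear bounded_linear_mult_left)

lemma circle_tensors_scaleC:
  assumes "F \<in> span circle_tensors"
  shows "z *\<^sub>C F \<in> span circle_tensors"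
proof (rule linear_span_subset[OF _ _ assms])
  fix F assume "F \<in> circle_tensors"
  then obtain f g where F: "F = circle_tensor f g" by (auto simp: circle_tensors_def)
  have "z *\<^sub>C F = circle_tensor (z *\<^sub>C f) g"
    by (rule bcontfun_eqI) (simp add: F scaleC_bcontfun.rep_eq scaleC_complex_def)
  then show "z *\<^sub>C F \<in> span circle_tensors" by (simp add: circle_tensor_in_span)
qed (simp add: bounded_linear.linear bounded_linear_scaleC)

text \<open>Stone--Weierstrass for the ring \<open>R\<close> of real functions whose complex
  versions lie in the span of elementary tensors. Real and imaginary parts of the two coordinates
  separate points.\<close>

lemma circle_tensors_real_dense:
  fixes f :: "circle \<times> circle \<Rightarrow> real"
  assumes cont: "continuous_on UNIV f" and "e > 0"
  obtains G g where "G \<in> span circle_tensors" "\<And>z. apply_bcontfun G z = of_real (g z)"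
    "\<And>z. \<bar>f z - g z\<bar> < e"
proof -
  define R where "R = {f. \<exists>G\<in>span circle_tensors. \<forall>z. apply_bcontfun G z = complex_of_real (f z)}"
  interpret function_ring_on R UNIV
  proof
    show "compact (UNIV :: (circle \<times> circle) set)"
      using compact_Times[OF compact_circle compact_circle] by simp
  next
    fix f assume "f \<in> R"
    then obtain G where "\<And>z. apply_bcontfun G z = complex_of_real (f z)" by (auto simp: R_def)
    then have "f = (\<lambda>z. Re (apply_bcontfun G z))" by simp
    then show "continuous_on UNIV f"
      using continuous_on_Re[OF continuous_on_apply_bcontfun[of UNIV G]] by simp
  next
    fix f g assume "f \<in> R" "g \<in> R"
    then obtain F G where F: "F \<in> span circle_tensors" "\<And>z. apply_bcontfun F z = complex_of_real (f z)"
      and G: "G \<in> span circle_tensors" "\<And>z. apply_bcontfun G z = complex_of_real (g z)"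
      by (auto simp: R_def)
    show "(\<lambda>x. f x + g x) \<in> R" unfolding R_def
      using F G by (intro CollectI bexI[of _ "F + G"]) (auto simp: plus_bcontfun.rep_eq span_add)
    show "(\<lambda>x. f x * g x) \<in> R" unfolding R_def
      using F G by (intro CollectI bexI[of _ "F * G"]) (auto simp: times_bcontfun.rep_eq circle_tensors_mult)
  next
    fix r
    show "(\<lambda>_. r) \<in> R" unfolding R_def
      by (intro CollectI bexI[of _ "circle_tensor (of_real r *\<^sub>C 1) 1"])
        (auto simp: one_bcontfun.rep_eq scaleC_bcontfun.rep_eq scaleC_complex_def circle_tensor_in_span)
  next
    fix x y :: "circle \<times> circle" assume "x \<noteq> y"
    \<comment> \<open>The real and the imaginary part of the coordinate function, written as
      elements of the C*-algebra.\<close>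
    define u w where "u = (1 / 2) *\<^sub>C (circle_coord + circle_coord\<^sup>\<star>)"
      and "w = (- \<i> / 2) *\<^sub>C (circle_coord - circle_coord\<^sup>\<star>)"
    have u: "apply_bcontfun u z = of_real (Re (circle_val z))"
      and w: "apply_bcontfun w z = of_real (Im (circle_val z))" for z
      by (simp_all add: u_def w_def scaleC_bcontfun.rep_eq plus_bcontfun.rep_eq minus_bcontfun.rep_eq
          star_bcontfun.rep_eq circle_coord.rep_eq scaleC_complex_def star_complex_def complex_eq_iff)
    have "(\<lambda>z. Re (circle_val (fst z))) \<in> R" "(\<lambda>z. Im (circle_val (fst z))) \<in> R"
      "(\<lambda>z. Re (circle_val (snd z))) \<in> R" "(\<lambda>z. Im (circle_val (snd z))) \<in> R"
      unfolding R_def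
      by (intro CollectI bexI[of _ "circle_tensor u 1"], simp_all add: u one_bcontfun.rep_eq circle_tensor_in_span,
        intro bexI[of _ "circle_tensor w 1"], simp_all add: w one_bcontfun.rep_eq circle_tensor_in_span,
        intro bexI[of _ "circle_tensor 1 u"], simp_all add: u one_bcontfun.rep_eq circle_tensor_in_span,
        intro bexI[of _ "circle_tensor 1 w"], simp_all add: w one_bcontfun.rep_eq circle_tensor_in_span)
    then show "\<exists>f\<in>R. f x \<noteq> f y"
      using \<open>x \<noteq> y\<close> by (metis circle_eq_iff complex_eq_iff prod_eq_iff)
  qed
  obtain g where "g \<in> R" "\<And>z. \<bar>f z - g z\<bar> < e"
    using Stone_Weierstrass_basic[OF cont \<open>e > 0\<close>] by blast
  then show ?thesis using that by (auto simp: R_def)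
qed

lemma circle_tensors_dense: "closure (span circle_tensors) = UNIV"
proof -
  have "F \<in> closure (span circle_tensors)" for F
    unfolding closure_approachable
  proof (intro allI impI)
    fix e :: real assume "e > 0"
    \<comment> \<open>Two errors below \<open>e / 3\<close> leave room for the supremum norm, which
      turns the strict pointwise bounds into a weak one.\<close>
    then have e3: "e / 3 > 0" by simp
    have F: "continuous_on UNIV (apply_bcontfun F)" by (rule continuous_on_apply_bcontfun)
    obtain G g where G: "G \<in> span circle_tensors" "\<And>z. apply_bcontfun G z = of_real (g z)"
      "\<And>z. \<bar>Re (apply_bcontfun F z) - g z\<bar> < e / 3"
      using circle_tensors_real_dense[OF continuous_on_Re[OF F] e3] by blast
    obtain H h where H: "H \<in> span circle_tensors" "\<And>z. apply_bcontfun H z = of_real (h z)"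
      "\<And>z. \<bar>Im (apply_bcontfun F z) - h z\<bar> < e / 3"
      using circle_tensors_real_dense[OF continuous_on_Im[OF F] e3] by blast
    have "norm (G + \<i> *\<^sub>C H - F) \<le> 2 * e / 3"
    proof (rule norm_bound)
      fix z
      have "norm (apply_bcontfun (G + \<i> *\<^sub>C H - F) z) \<le>
          \<bar>Re (apply_bcontfun (G + \<i> *\<^sub>C H - F) z)\<bar> + \<bar>Im (apply_bcontfun (G + \<i> *\<^sub>C H - F) z)\<bar>"
        by (rule cmod_le)
      also have "\<dots> \<le> e / 3 + e / 3"
        using G(3)[of z] H(3)[of z]
        by (intro add_mono)
          (simp_all add: minus_bcontfun.rep_eq plus_bcontfun.rep_eq scaleC_bcontfun.rep_eq
            scaleC_complex_def G(2) H(2) abs_minus_commute less_imp_le)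
      finally show "norm (apply_bcontfun (G + \<i> *\<^sub>C H - F) z) \<le> 2 * e / 3" by simp
    qed
    then have "dist (G + \<i> *\<^sub>C H) F < e" using \<open>e > 0\<close> by (simp add: dist_norm)
    moreover have "G + \<i> *\<^sub>C H \<in> span circle_tensors"
      using G(1) H(1) by (intro span_add circle_tensors_scaleC)
    ultimately show "\<exists>y\<in>span circle_tensors. dist y F < e" by blast
  qed
  then show ?thesis by blast
qed

text \<open>The product functional is identified directly as integration against the product
  measure, by density of the span of elementary tensors. Fubini and invariance under almost every
  \<open>x\<close> then give the convolution.\<close>

lemma circle_state_idempotent:
  "idempotent_state circle_tensor circle_coproduct (circle_state (circle_index p))"
proof -
  let ?\<mu> = "circle_haar p" and ?\<phi> = "circle_state (circle_index p)"
  interpret M: prob_space ?\<mu> by (rule circle_haar_prob)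
  interpret P: pair_prob_space ?\<mu> ?\<mu> ..
  have sets: "sets (?\<mu> \<Otimes>\<^sub>M ?\<mu>) = sets borel"
    unfolding borel_prod[where 'a = circle and 'b = circle, symmetric]
    by (rule sets_pair_measure_cong[OF circle_haar_sets circle_haar_sets])
  define \<omega> where "\<omega> F = (\<integral>z. apply_bcontfun F z \<partial>(?\<mu> \<Otimes>\<^sub>M ?\<mu>))" for F :: "(circle \<times> circle) \<Rightarrow>\<^sub>C complex"
  have bf: "bounded_functional \<omega>"
    unfolding \<omega>_def[abs_def] by (rule state_functional[OF integral_bcontfun_state[OF P.prob_space_axioms sets]])
  have iter: "\<omega> F = (\<integral>x. (\<integral>y. apply_bcontfun F (x, y) \<partial>?\<mu>) \<partial>?\<mu>)" for F
  proof -
    have "integrable (?\<mu> \<Otimes>\<^sub>M ?\<mu>) (apply_bcontfun F)"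
      by (rule integrable_continuous_bounded[OF P.prob_space_axioms sets]) (auto intro: norm_bounded)
    then show ?thesis
      unfolding \<omega>_def using P.integral_fst[of "\<lambda>x y. apply_bcontfun F (x, y)"] by simp
  qed
  have tensor: "\<omega> (circle_tensor f g) = ?\<phi> f * ?\<phi> g" for f g
    by (simp add: iter circle_state_alt del: if_split_asm)
  have "product_functional circle_tensor ?\<phi> ?\<phi> = \<omega>"
    unfolding product_functional_def
  proof (rule the_equality)
    fix \<omega>' assume \<omega>': "bounded_functional \<omega>' \<and> (\<forall>f g. \<omega>' (circle_tensor f g) = ?\<phi> f * ?\<phi> g)"
    show "\<omega>' = \<omega>"
    proof (rule continuous_eq_on_dense[OF circle_tensors_dense])
      fix F assume F: "F \<in> span circle_tensors"
      have "linear \<omega>'" "linear \<omega>"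
        using \<omega>' bf by (blast intro: bounded_linear.linear functional_linear)+
      then show "\<omega>' F = \<omega> F"
        by (rule linear_eq_on_span[OF _ _ _ F]) (use \<omega>' tensor in \<open>auto simp: circle_tensors_def\<close>)
    qed (intro continuous_on_functional[OF conjunct1[OF \<omega>']] continuous_on_functional[OF bf]
        continuous_on_id)+
  qed (use bf tensor in blast)
  moreover have "\<omega> (circle_coproduct f) = ?\<phi> f" for f
  proof -
    have inner: "(\<integral>y. apply_bcontfun f (circle_mult x y) \<partial>?\<mu>) = ?\<phi> f" if "x \<in> root_group p" for x
    proof -
      have meas: "circle_mult x \<in> measurable ?\<mu> borel"
        using borel_measurable_continuous_onI[OF circle_mult_continuous]
          measurable_cong_sets[OF circle_haar_sets refl] by blast
      have "?\<phi> f = (\<integral>y. apply_bcontfun f y \<partial>distr ?\<mu> borel (circle_mult x))"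
        using haar_measure_ofD(5)[OF circle_haar that] by (simp only: circle_state_alt circle_group_mult)
      also have "\<dots> = (\<integral>y. apply_bcontfun f (circle_mult x y) \<partial>?\<mu>)"
        by (intro integral_distr meas borel_measurable_continuous_onI continuous_on_apply_bcontfun)
      finally show ?thesis by simp
    qed
    have "\<omega> (circle_coproduct f) = (\<integral>x. (\<integral>y. apply_bcontfun f (circle_mult x y) \<partial>?\<mu>) \<partial>?\<mu>)"
      by (simp add: iter)
    also have "\<dots> = (\<integral>x. ?\<phi> f \<partial>?\<mu>)"
    proof (rule integral_cong_AE)
      show "AE x in ?\<mu>. (\<integral>y. apply_bcontfun f (circle_mult x y) \<partial>?\<mu>) = ?\<phi> f"
        using haar_AE[OF circle_haar borel_closed[OF closed_root_group]] by eventually_elim (rule inner)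
      have "(\<lambda>z. apply_bcontfun (circle_coproduct f) z) \<in> borel_measurable (?\<mu> \<Otimes>\<^sub>M ?\<mu>)"
        using borel_measurable_continuous_onI[OF continuous_on_apply_bcontfun]
          measurable_cong_sets[OF sets refl] by blast
      then show "(\<lambda>x. \<integral>y. apply_bcontfun f (circle_mult x y) \<partial>?\<mu>) \<in> borel_measurable ?\<mu>"
        using M.borel_measurable_lebesgue_integral[of "\<lambda>x y. apply_bcontfun f (circle_mult x y)" ?\<mu>]
        by (simp add: case_prod_unfold)
    qed simp
    finally show ?thesis by (simp add: M.prob_space)
  qed
  ultimately show ?thesis
    unfolding idempotent_state_def using circle_state_state by (simp add: fun_eq_iff)
qed

section \<open>Haar measures of closed subgroups of the torus\<close>

lemma torus_group_mult:
  "x \<otimes>\<^bsub>torus_group\<^esub> y = (circle_mult (fst x) (fst y), circle_mult (snd x) (snd y))"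
  by (cases x; cases y) (simp add: torus_group_def circle_group_mult)

lemma torus_mult_continuous: "continuous_on UNIV (\<lambda>x. h \<otimes>\<^bsub>torus_group\<^esub> x)"
  unfolding torus_group_mult by (intro continuous_intros)

lemma group_torus: "group torus_group"
proof -
  have "group circle_group"
  proof (rule groupI)
    fix x assume "x \<in> carrier circle_group"
    show "\<exists>y\<in>carrier circle_group. y \<otimes>\<^bsub>circle_group\<^esub> x = \<one>\<^bsub>circle_group\<^esub>"
      by (rule bexI[of _ "circle_powi x (-1)"])
        (auto simp: circle_group_def circle_eq_iff circle_mult.rep_eq circle_one.rep_eq)
  qed (auto simp: circle_group_def circle_mult_assoc)
  then show ?thesis unfolding torus_group_def by (intro DirProd_group)
qed

lemma torus_one: "\<one>\<^bsub>torus_group\<^esub> = (circle_one, circle_one)"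
  by (simp add: torus_group_def circle_group_def)

lemma torus_carrier: "carrier torus_group = UNIV"
  by (simp add: torus_group_def circle_group_def)

definition torus_character :: "int \<Rightarrow> int \<Rightarrow> circle \<times> circle \<Rightarrow> complex" where
  "torus_character j l z = circle_val (fst z) powi j * circle_val (snd z) powi l"

lemma continuous_on_torus_character: "continuous_on A (torus_character j l)"
  unfolding torus_character_def by (intro continuous_intros)

lemma torus_character_mult:
  "torus_character j l (x \<otimes>\<^bsub>torus_group\<^esub> y) = torus_character j l x * torus_character j l y"
  by (simp add: torus_character_def torus_group_mult circle_mult.rep_eq power_int_mult_distrib)

lemma torus_haar_integral:
  assumes "haar_measure_of torus_group H \<rho>" "closed H"
  shows "(\<integral>z. torus_character j l z \<partial>\<rho>) \<in> {0, 1}"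
  using haar_integral_character[OF assms(1) borel_closed[OF assms(2)] torus_mult_continuous
    continuous_on_torus_character torus_character_mult, of j l] by simp

text \<open>\<open>\<rho>\<close> is the image of the Haar measure of the product of \<open>root_group p\<close> and
  \<open>root_group (p' * s)\<close> under the homomorphism \<open>T\<close>, whose image is the annihilator of the lattice
  spanned by \<open>(p, q)\<close> and \<open>(0, s)\<close>.\<close>

lemma torus_haar_exists:
  fixes p s :: nat and q :: int
  obtains H \<rho> where "subgroup H torus_group" "closed H" "haar_measure_of torus_group H \<rho>"
    "\<And>j l. (\<integral>z. torus_character j l z \<partial>\<rho>) =
      (if int p dvd j \<and> int s dvd l - q * (j div int p) then 1 else 0)"
proof -
  \<comment> \<open>For \<open>p = 0\<close> the first factor alone forces \<open>j = 0\<close>, and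
    the exponent 1 keeps the second coordinate of \<open>T\<close> from being constantly 1.\<close>
  define p' where "p' = (if p = 0 then 1 else p)"
  define T where "T = (\<lambda>(x, u). (circle_mult x (circle_powi u (- q)), circle_powi u (int p')))"
  let ?A = "root_group p" and ?B = "root_group (p' * s)"
  let ?\<mu> = "circle_haar p" and ?\<nu> = "circle_haar (p' * s)"
  interpret M: prob_space ?\<mu> by (rule circle_haar_prob)
  interpret N: prob_space ?\<nu> by (rule circle_haar_prob)
  interpret P: pair_prob_space ?\<mu> ?\<nu> ..
  interpret G: group torus_group by (rule group_torus)
  have sets: "sets (?\<mu> \<Otimes>\<^sub>M ?\<nu>) = sets borel"
    unfolding borel_prod[where 'a = circle and 'b = circle, symmetric]
    by (rule sets_pair_measure_cong[OF circle_haar_sets circle_haar_sets])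
  have T_cont: "continuous_on UNIV T"
    unfolding T_def case_prod_unfold by (intro continuous_intros)
  then have T_meas: "T \<in> measurable (?\<mu> \<Otimes>\<^sub>M ?\<nu>) borel"
    using borel_measurable_continuous_onI measurable_cong_sets[OF sets refl] by blast
  have T_mult: "T (circle_mult x y, circle_mult u w) = T (x, u) \<otimes>\<^bsub>torus_group\<^esub> T (y, w)" for x y u w
    by (simp add: T_def torus_group_mult circle_eq_iff circle_mult.rep_eq power_int_mult_distrib
        power_mult_distrib)
  define H where "H = T ` (?A \<times> ?B)"
  define \<rho> where "\<rho> = distr (?\<mu> \<Otimes>\<^sub>M ?\<nu>) borel T"
  have "compact ?A" "compact ?B"
    using compact_Int_closed[OF compact_circle closed_root_group] by simp_all
  then have H_closed: "closed H"
    unfolding H_def by (intro compact_imp_closed compact_continuous_image compact_Times)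
      (auto intro: continuous_on_subset[OF T_cont])
  have "subgroup H torus_group"
  proof (rule G.subgroupI)
    show "H \<noteq> {}" using root_group_one by (auto simp: H_def)
    show "x \<otimes>\<^bsub>torus_group\<^esub> y \<in> H" if "x \<in> H" "y \<in> H" for x y
      using that root_group_mult unfolding H_def by (force simp flip: T_mult)
    show "inv\<^bsub>torus_group\<^esub> x \<in> H" if "x \<in> H" for x
    proof -
      obtain y u where x: "x = T (y, u)" "y \<in> ?A" "u \<in> ?B" using \<open>x \<in> H\<close> by (auto simp: H_def)
      let ?x' = "T (circle_powi y (-1), circle_powi u (-1))"
      have "circle_mult (circle_powi w (-1)) w = circle_one" for w
        by (simp add: circle_eq_iff circle_mult.rep_eq circle_one.rep_eq)
      then have "?x' \<otimes>\<^bsub>torus_group\<^esub> x = T (circle_one, circle_one)"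
        unfolding x T_mult[symmetric] by simp
      also have "\<dots> = \<one>\<^bsub>torus_group\<^esub>"
        by (simp add: T_def torus_one circle_eq_iff circle_one.rep_eq circle_mult.rep_eq)
      finally have "inv\<^bsub>torus_group\<^esub> x = ?x'"
        by (intro G.inv_equality) (auto simp: torus_carrier)
      then show ?thesis using x root_group_powi by (auto simp: H_def)
    qed
  qed (simp add: torus_carrier)
  moreover have "haar_measure_of torus_group H \<rho>"
    unfolding haar_measure_of_def
  proof (intro conjI ballI)
    show "sets \<rho> = sets borel" by (simp add: \<rho>_def)
    show prob: "prob_space \<rho>" unfolding \<rho>_def by (rule P.prob_space_distr[OF T_meas])
    have AB: "?A \<in> sets ?\<mu>" "?B \<in> sets ?\<nu>"
      using closed_root_group by (auto simp: circle_haar_sets)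
    have "1 = emeasure (?\<mu> \<Otimes>\<^sub>M ?\<nu>) (?A \<times> ?B)"
      using AB haar_measure_ofD(4)[OF circle_haar] by (simp add: N.emeasure_pair_measure_Times)
    also have "\<dots> \<le> emeasure (?\<mu> \<Otimes>\<^sub>M ?\<nu>) (T -` H \<inter> space (?\<mu> \<Otimes>\<^sub>M ?\<nu>))"
    proof (rule emeasure_mono)
      show "?A \<times> ?B \<subseteq> T -` H \<inter> space (?\<mu> \<Otimes>\<^sub>M ?\<nu>)"
        using haar_measure_ofD(2)[OF circle_haar] by (auto simp: H_def space_pair_measure)
      show "T -` H \<inter> space (?\<mu> \<Otimes>\<^sub>M ?\<nu>) \<in> sets (?\<mu> \<Otimes>\<^sub>M ?\<nu>)"
        using H_closed by (intro measurable_sets[OF T_meas]) simp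
    qed
    also have "\<dots> = emeasure \<rho> H"
      using H_closed by (simp add: \<rho>_def emeasure_distr[OF T_meas])
    finally show "emeasure \<rho> H = 1"
      using prob_space.emeasure_le_1[OF prob, of H] by (intro antisym) auto
    fix h assume "h \<in> H"
    then obtain y u where h: "h = T (y, u)" "y \<in> ?A" "u \<in> ?B" by (auto simp: H_def)
    have y_meas: "circle_mult y \<in> measurable ?\<mu> borel" and u_meas: "circle_mult u \<in> measurable ?\<nu> borel"
      using borel_measurable_continuous_onI[OF circle_mult_continuous]
        measurable_cong_sets[OF circle_haar_sets refl] by blast+
    have y_inv: "distr ?\<mu> borel (circle_mult y) = ?\<mu>" and u_inv: "distr ?\<nu> borel (circle_mult u) = ?\<nu>"
      using haar_measure_ofD(5)[OF circle_haar] h by (simp_all add: circle_group_mult)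
    have "?\<mu> \<Otimes>\<^sub>M ?\<nu> = distr (?\<mu> \<Otimes>\<^sub>M ?\<nu>) (borel \<Otimes>\<^sub>M borel) (\<lambda>(x, w). (circle_mult y x, circle_mult u w))"
      using pair_measure_distr[OF y_meas u_meas] by (simp add: y_inv u_inv N.sigma_finite_measure_axioms)
    then have inv: "distr (?\<mu> \<Otimes>\<^sub>M ?\<nu>) borel (\<lambda>(x, w). (circle_mult y x, circle_mult u w)) = ?\<mu> \<Otimes>\<^sub>M ?\<nu>"
      by (simp add: borel_prod)
    have pair_meas: "(\<lambda>(x, w). (circle_mult y x, circle_mult u w)) \<in> measurable (?\<mu> \<Otimes>\<^sub>M ?\<nu>) borel"
      unfolding borel_prod[symmetric] using y_meas u_meas by measurable
    \<comment> \<open>Since \<open>T\<close> is multiplicative, translation by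
      \<open>h = T (y, u)\<close> lifts to translation by \<open>(y, u)\<close>, under which the
      product measure is invariant.\<close>
    have "distr \<rho> borel (\<lambda>x. h \<otimes>\<^bsub>torus_group\<^esub> x) = distr (?\<mu> \<Otimes>\<^sub>M ?\<nu>) borel (\<lambda>z. h \<otimes>\<^bsub>torus_group\<^esub> T z)"
      unfolding \<rho>_def using T_meas borel_measurable_continuous_onI[OF torus_mult_continuous]
      by (subst distr_distr) (auto simp: comp_def)
    also have "\<dots> = distr (?\<mu> \<Otimes>\<^sub>M ?\<nu>) borel (T \<circ> (\<lambda>(x, w). (circle_mult y x, circle_mult u w)))"
      by (rule arg_cong[of _ _ "distr _ _"]) (auto simp: fun_eq_iff h T_mult)
    also have "\<dots> = distr (distr (?\<mu> \<Otimes>\<^sub>M ?\<nu>) borel (\<lambda>(x, w). (circle_mult y x, circle_mult u w))) borel T"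
      using pair_meas borel_measurable_continuous_onI[OF T_cont] by (subst distr_distr) auto
    also have "\<dots> = \<rho>" by (simp add: inv \<rho>_def)
    finally show "distr \<rho> borel (\<lambda>x. h \<otimes>\<^bsub>torus_group\<^esub> x) = \<rho>" .
  qed
  moreover have "(\<integral>z. torus_character j l z \<partial>\<rho>) =
      (if int p dvd j \<and> int s dvd l - q * (j div int p) then 1 else 0)" for j l
  proof -
    let ?f = "\<lambda>x u. circle_val x powi j * circle_val u powi (int p' * l - q * j)"
    have T_char: "torus_character j l (T (x, u)) = ?f x u" for x u
    proof -
      have "torus_character j l (T (x, u)) =
          circle_val x powi j * (circle_val u powi (- q * j) * circle_val u powi (int p' * l))"
        by (simp only: torus_character_def T_def prod.case fst_conv snd_conv circle_mult.rep_eq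
            circle_val_powi power_int_mult_distrib power_int_mult mult.assoc)
      also have "circle_val u powi (- q * j) * circle_val u powi (int p' * l) =
          circle_val u powi (- q * j + int p' * l)"
        by (rule power_int_add[symmetric]) simp
      finally show ?thesis by (simp add: algebra_simps)
    qed
    have int: "integrable (?\<mu> \<Otimes>\<^sub>M ?\<nu>) (\<lambda>z. torus_character j l (T z))"
      by (rule integrable_continuous_bounded[OF P.prob_space_axioms sets, where B = 1])
        (rule continuous_on_compose2[OF continuous_on_torus_character T_cont],
          auto simp: torus_character_def norm_mult norm_power_int)
    have "(\<integral>z. torus_character j l z \<partial>\<rho>) = (\<integral>z. torus_character j l (T z) \<partial>(?\<mu> \<Otimes>\<^sub>M ?\<nu>))"
      unfolding \<rho>_def
      by (intro integral_distr T_meas borel_measurable_continuous_onI continuous_on_torus_character)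
    also have "\<dots> = (\<integral>x. (\<integral>u. ?f x u \<partial>?\<nu>) \<partial>?\<mu>)"
    proof -
      have eq: "(\<lambda>z. torus_character j l (T z)) = (\<lambda>(x, u). ?f x u)" by (auto simp: T_char)
      show ?thesis unfolding eq by (rule P.integral_fst[OF int[unfolded eq], symmetric])
    qed
    also have "\<dots> = (if int p dvd j then 1 else 0) * (if int (p' * s) dvd int p' * l - q * j then 1 else 0)"
      by (simp only: integral_mult_right_zero integral_mult_left_zero circle_haar_integral)
    also have "\<dots> = (if int p dvd j \<and> int s dvd l - q * (j div int p) then 1 else 0)"
    proof (cases "int p dvd j")
      case True
      then obtain j' where j': "j = int p * j'" by (auto simp: dvd_def)
      have "int (p' * s) dvd int p' * l - q * j \<longleftrightarrow> int s dvd l - q * (j div int p)"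
      proof (cases "p = 0")
        case False
        have "int p * l - q * j = int p * (l - q * j')" by (simp add: j' algebra_simps)
        then show ?thesis using False by (simp add: p'_def j')
      qed (use j' in \<open>simp add: p'_def\<close>)
      then show ?thesis using True by simp
    qed simp
    finally show ?thesis .
  qed
  ultimately show ?thesis using H_closed that by blast
qed

lemma haar_trivial: "haar_measure_of torus_group {\<one>\<^bsub>torus_group\<^esub>} (return borel \<one>\<^bsub>torus_group\<^esub>)"
  unfolding haar_measure_of_def
proof (intro conjI ballI)
  show "prob_space (return borel \<one>\<^bsub>torus_group\<^esub>)" by (rule prob_space_return) simp
  fix h assume "h \<in> {\<one>\<^bsub>torus_group\<^esub>}"
  then have "(\<lambda>x. h \<otimes>\<^bsub>torus_group\<^esub> x) = (\<lambda>x. x)"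
    by (auto simp: torus_group_mult torus_one)
  then show "distr (return borel \<one>\<^bsub>torus_group\<^esub>) borel (\<lambda>x. h \<otimes>\<^bsub>torus_group\<^esub> x) = return borel \<one>\<^bsub>torus_group\<^esub>"
    by (simp add: distr_id2)
qed simp_all

section \<open>The presentations and their canonical homomorphisms\<close>

lemma spow_one [simp]: "spow 1 k = 1"
  by (simp add: spow_def)

lemma spow_zero_left: "spow 0 k = (if k = 0 then 1 else 0)"
  by (auto simp: spow_def power_0_left)

lemma U02_relations_iff:
  "(\<forall>r\<in>U02_relations. free_eval f r = 0) \<longleftrightarrow> u02_relations (f Ga) (f Gc) (f Gv)"
  unfolding U02_relations_def Let_def u02_relations_def
  by (auto simp: free_eval_add free_eval_diff free_eval_mult free_eval_star free_eval_gen free_eval_one)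

text \<open>With \<open>v = 1\<close> the relations that involve \<open>v\<close> become trivial, so
  the results for \<open>U\<^sub>0(2)\<close>, the coproduct formula included, apply to
  \<open>SU\<^sub>0(2)\<close>.\<close>

lemma SU02_relations_iff:
  "(\<forall>r\<in>SU02_relations. free_eval f r = 0) \<longleftrightarrow> u02_relations (f Galpha) (f Ggamma) 1"
  unfolding SU02_relations_def Let_def u02_relations_def
  by (auto simp: free_eval_add free_eval_diff free_eval_mult free_eval_star free_eval_gen free_eval_one)

lemma (in u02_relations) u02_algebraI:
  assumes "universal_cstar R f" "range f \<subseteq> {a, c, v}"
  shows "u02_algebra a c v"
proof -
  have "range (free_eval f) \<subseteq> pbw_span"
    using free_eval_in_pbw_span[OF assms(2)] by blast
  then have "closure pbw_span = UNIV"
    using closure_mono universal_dense[OF assms(1)] by blast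
  then show ?thesis by unfold_locales
qed

lemma U02_algebra:
  assumes "C_U02 a c v"
  shows "u02_algebra a c v"
proof -
  let ?f = "\<lambda>i. case i of Ga \<Rightarrow> a | Gc \<Rightarrow> c | Gv \<Rightarrow> v"
  have univ: "universal_cstar U02_relations ?f" using assms by (simp add: C_U02_def)
  then have "\<forall>r\<in>U02_relations. free_eval ?f r = 0" by (simp add: universal_cstar_def)
  then interpret u02_relations a c v by (simp add: U02_relations_iff)
  show ?thesis by (rule u02_algebraI[OF univ]) (auto split: U02_gen.split)
qed

lemma SU02_algebra:
  assumes "C_SU02 \<alpha> \<gamma>"
  shows "u02_algebra \<alpha> \<gamma> 1"
proof -
  let ?f = "\<lambda>i. case i of Galpha \<Rightarrow> \<alpha> | Ggamma \<Rightarrow> \<gamma>"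
  have univ: "universal_cstar SU02_relations ?f" using assms by (simp add: C_SU02_def)
  then have "\<forall>r\<in>SU02_relations. free_eval ?f r = 0" by (simp add: universal_cstar_def)
  then interpret u02_relations \<alpha> \<gamma> 1 by (simp add: SU02_relations_iff)
  show ?thesis by (rule u02_algebraI[OF univ]) (auto split: SU02_gen.split)
qed

lemma U02_hom_ex1:
  fixes a c v :: "'a::cstar_algebra" and a' c' v' :: "'b::cstar_algebra"
  assumes "C_U02 a c v" and "u02_relations a' c' v'"
  shows "\<exists>!h. unital_star_hom h \<and> h a = a' \<and> h c = c' \<and> h v = v'"
proof -
  let ?g = "\<lambda>i. case i of Ga \<Rightarrow> a' | Gc \<Rightarrow> c' | Gv \<Rightarrow> v'"
  have all: "(\<forall>i. P i) \<longleftrightarrow> P Ga \<and> P Gc \<and> P Gv" for P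
    by (metis U02_gen.exhaust)
  have "\<forall>r\<in>U02_relations. free_eval ?g r = 0" using assms by (simp add: U02_relations_iff)
  then show ?thesis
    using universal_hom_ex1[OF assms(1)[unfolded C_U02_def], of ?g] by (simp add: all)
qed

lemma SU02_hom_ex1:
  fixes \<alpha> \<gamma> :: "'a::cstar_algebra" and \<alpha>' \<gamma>' :: "'b::cstar_algebra"
  assumes "C_SU02 \<alpha> \<gamma>" and "u02_relations \<alpha>' \<gamma>' 1"
  shows "\<exists>!h. unital_star_hom h \<and> h \<alpha> = \<alpha>' \<and> h \<gamma> = \<gamma>'"
proof -
  let ?g = "\<lambda>i. case i of Galpha \<Rightarrow> \<alpha>' | Ggamma \<Rightarrow> \<gamma>'"
  have all: "(\<forall>i. P i) \<longleftrightarrow> P Galpha \<and> P Ggamma" for P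
    by (metis SU02_gen.exhaust)
  have "\<forall>r\<in>SU02_relations. free_eval ?g r = 0" using assms by (simp add: SU02_relations_iff)
  then show ?thesis
    using universal_hom_ex1[OF assms(1)[unfolded C_SU02_def], of ?g] by (simp add: all)
qed

context u02_relations
begin

text \<open>The cross terms of \<open>?C * ?C\<^sup>\<star>\<close> and
  \<open>?C\<^sup>\<star> * ?C\<close> vanish because \<open>a\<close> annihilates \<open>c\<close>
  and \<open>c\<^sup>\<star>\<close>. Inserting \<open>?P = 1 - ?Q\<close>, both products become
  \<open>1 - t ?Q ?Q\<close>, which gives normality and the sphere relation at once.\<close>

lemma coproduct_relations:
  fixes t :: "'a \<Rightarrow> 'a \<Rightarrow> 't::cstar_algebra"
  assumes t: "min_tensor t"
  shows "u02_relations (t a a) (t c a + t (a\<^sup>\<star> * v\<^sup>\<star>) c) (t v v)"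
proof -
  let ?C = "t c a + t (a\<^sup>\<star> * v\<^sup>\<star>) c" and ?P = "c\<^sup>\<star> * c" and ?Q = "a\<^sup>\<star> * a"
  have av_star: "a\<^sup>\<star> * v\<^sup>\<star> = v\<^sup>\<star> * a\<^sup>\<star>"
    using arg_cong[OF av, of star] by (simp add: star_mult)
  have av_star': "v * (a\<^sup>\<star> * v\<^sup>\<star>) = a\<^sup>\<star>"
    unfolding av_star by (simp add: vv flip: mult.assoc)
  have C_star: "?C\<^sup>\<star> = t (c\<^sup>\<star>) (a\<^sup>\<star>) + t (v * a) (c\<^sup>\<star>)"
    by (simp add: star_add tensor_star[OF t] star_mult star_star)
  have z1: "(a\<^sup>\<star> * v\<^sup>\<star>) * (v * a) = ?Q" by (metis mult.assoc mult.right_neutral vv')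
  have z2: "(v * a) * (a\<^sup>\<star> * v\<^sup>\<star>) = 1" by (metis aa mult.assoc mult.right_neutral vv)
  have z3: "c\<^sup>\<star> * (a\<^sup>\<star> * v\<^sup>\<star>) = 0" using ca by (simp flip: mult.assoc)
  have z4: "v * a * c = 0" using ac by (simp add: mult.assoc)
  have CC': "?C * ?C\<^sup>\<star> = t ?P 1 + t ?Q ?P"
    unfolding C_star
    by (simp add: distrib_left distrib_right tensor_mult[OF t] aa ac' ca cc z1 tensor_zero_right[OF t])
  have C'C: "?C\<^sup>\<star> * ?C = t ?P ?Q + t 1 ?P"
    unfolding C_star
    by (simp add: distrib_left distrib_right tensor_mult[OF t] z2 z3 z4 tensor_zero_left[OF t])
  have P: "?P = 1 - ?Q" by (rule c_projection)
  show ?thesis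
  proof
    show "t a a * t v v = t v v * t a a" by (simp add: tensor_mult[OF t] av)
    show "?C * t v v = t v v * ?C"
      by (simp add: distrib_left distrib_right tensor_mult[OF t] av cv av_star')
        (simp add: mult.assoc vv')
    show "?C * ?C\<^sup>\<star> = ?C\<^sup>\<star> * ?C"
      unfolding CC' C'C P by (simp add: tensor_diff_left[OF t] tensor_diff_right[OF t])
    show "t v v * (t v v)\<^sup>\<star> = 1" "(t v v)\<^sup>\<star> * t v v = 1" "t a a * (t a a)\<^sup>\<star> = 1"
      by (simp_all add: tensor_star[OF t] tensor_mult[OF t] vv vv' aa tensor_one[OF t])
    show "t a a * ?C = 0"
      by (simp add: distrib_left tensor_mult[OF t] ac tensor_zero_left[OF t] tensor_zero_right[OF t])
    show "t a a * ?C\<^sup>\<star> = 0"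
      unfolding C_star
      by (simp add: distrib_left tensor_mult[OF t] ac' tensor_zero_left[OF t] tensor_zero_right[OF t])
    show "(t a a)\<^sup>\<star> * t a a + ?C\<^sup>\<star> * ?C = 1"
      unfolding C'C P
      by (simp add: tensor_star[OF t] tensor_mult[OF t] tensor_diff_left[OF t] tensor_diff_right[OF t]
          tensor_one[OF t])
  qed
qed

end

lemma U02_coproduct:
  assumes "C_U02 a c v" "min_tensor t"
  shows "unital_star_hom (U02_coproduct t a c v)" "U02_coproduct t a c v a = t a a"
    "U02_coproduct t a c v c = t c a + t (a\<^sup>\<star> * v\<^sup>\<star>) c" "U02_coproduct t a c v v = t v v"
proof -
  interpret u02_algebra a c v by (rule U02_algebra[OF assms(1)])
  show "unital_star_hom (U02_coproduct t a c v)" "U02_coproduct t a c v a = t a a"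
    "U02_coproduct t a c v c = t c a + t (a\<^sup>\<star> * v\<^sup>\<star>) c" "U02_coproduct t a c v v = t v v"
    using theI'[OF U02_hom_ex1[OF assms(1) coproduct_relations[OF assms(2)]]]
    unfolding U02_coproduct_def by blast+
qed

lemma SU02_coproduct:
  assumes "C_SU02 \<alpha> \<gamma>" "min_tensor t"
  shows "unital_star_hom (SU02_coproduct t \<alpha> \<gamma>)" "SU02_coproduct t \<alpha> \<gamma> \<alpha> = t \<alpha> \<alpha>"
    "SU02_coproduct t \<alpha> \<gamma> \<gamma> = t \<gamma> \<alpha> + t (\<alpha>\<^sup>\<star>) \<gamma>"
proof -
  interpret u02_algebra \<alpha> \<gamma> 1 by (rule SU02_algebra[OF assms(1)])
  have "u02_relations (t \<alpha> \<alpha>) (t \<gamma> \<alpha> + t (\<alpha>\<^sup>\<star>) \<gamma>) 1"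
    using coproduct_relations[OF assms(2)] by (simp add: tensor_one[OF assms(2)])
  then show "unital_star_hom (SU02_coproduct t \<alpha> \<gamma>)" "SU02_coproduct t \<alpha> \<gamma> \<alpha> = t \<alpha> \<alpha>"
    "SU02_coproduct t \<alpha> \<gamma> \<gamma> = t \<gamma> \<alpha> + t (\<alpha>\<^sup>\<star>) \<gamma>"
    using theI'[OF SU02_hom_ex1[OF assms(1), of "t \<alpha> \<alpha>" "t \<gamma> \<alpha> + t (\<alpha>\<^sup>\<star>) \<gamma>"]]
    unfolding SU02_coproduct_def by blast+
qed

lemma U02_to_torus:
  assumes "C_U02 a c v"
  shows "unital_star_hom (U02_to_torus a c v)" "U02_to_torus a c v a = torus_coord1"
    "U02_to_torus a c v c = 0" "U02_to_torus a c v v = torus_coord2"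
proof -
  have unit: "f * f\<^sup>\<star> = 1" "f\<^sup>\<star> * f = 1" if "\<And>z. cmod (apply_bcontfun f z) = 1"
    for f :: "(circle \<times> circle) \<Rightarrow>\<^sub>C complex"
    using that
    by (auto intro!: bcontfun_eqI simp: times_bcontfun.rep_eq star_bcontfun.rep_eq one_bcontfun.rep_eq
        star_complex_def mult.commute[of "cnj _"] simp flip: complex_norm_square)
  have "u02_relations torus_coord1 0 torus_coord2"
  proof
    show "torus_coord1 * torus_coord2 = torus_coord2 * torus_coord1"
      by (rule bcontfun_eqI) (simp add: times_bcontfun.rep_eq)
  qed (simp_all add: unit)
  then show "unital_star_hom (U02_to_torus a c v)" "U02_to_torus a c v a = torus_coord1"
    "U02_to_torus a c v c = 0" "U02_to_torus a c v v = torus_coord2"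
    using theI'[OF U02_hom_ex1[OF assms, of torus_coord1 0 torus_coord2]]
    unfolding U02_to_torus_def by blast+
qed

lemma U02_counit:
  assumes "C_U02 a c v"
  shows "unital_star_hom (U02_counit a c v)" "U02_counit a c v a = 1"
    "U02_counit a c v c = 0" "U02_counit a c v v = 1"
proof -
  have "u02_relations (1 :: complex) 0 1" by standard simp_all
  then show "unital_star_hom (U02_counit a c v)" "U02_counit a c v a = 1"
    "U02_counit a c v c = 0" "U02_counit a c v v = 1"
    using theI'[OF U02_hom_ex1[OF assms, of "1 :: complex" 0 1]]
    unfolding U02_counit_def by blast+
qed

lemma U02_identification:
  fixes t :: "'b::cstar_algebra \<Rightarrow> (circle \<Rightarrow>\<^sub>C complex) \<Rightarrow> 't::cstar_algebra"
  assumes "C_U02 a c v" "C_SU02 \<alpha> \<gamma>" and t: "min_tensor t"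
  defines "\<theta> \<equiv> U02_identification t a c v \<alpha> \<gamma>"
  shows "unital_star_hom \<theta>" "\<theta> a = t \<alpha> 1" "\<theta> c = t \<gamma> 1" "\<theta> v = t 1 circle_coord"
proof -
  interpret u02_algebra \<alpha> \<gamma> 1 by (rule SU02_algebra[OF assms(2)])
  have unit: "circle_coord * circle_coord\<^sup>\<star> = 1" "circle_coord\<^sup>\<star> * circle_coord = 1"
    by (auto intro!: bcontfun_eqI simp: times_bcontfun.rep_eq star_bcontfun.rep_eq one_bcontfun.rep_eq
        star_complex_def circle_coord.rep_eq mult.commute[of "cnj _"] simp flip: complex_norm_square)
  have "u02_relations (t \<alpha> 1) (t \<gamma> 1) (t 1 circle_coord)"
    by standard
      (simp_all add: tensor_mult[OF t] tensor_star[OF t] cc ac ac' aa sphere unit tensor_one[OF t]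
        tensor_zero_left[OF t] flip: tensor_add_left[OF t])
  then show "unital_star_hom \<theta>" "\<theta> a = t \<alpha> 1" "\<theta> c = t \<gamma> 1" "\<theta> v = t 1 circle_coord"
    using theI'[OF U02_hom_ex1[OF assms(1), of "t \<alpha> 1" "t \<gamma> 1" "t 1 circle_coord"]]
    unfolding \<theta>_def U02_identification_def by blast+
qed

section \<open>The two families of states\<close>

lemma (in u02_relations) hom_pbw:
  assumes "unital_star_hom h"
  shows "h (pbw r k s l) = ((h a)\<^sup>\<star>) ^ r * spow (h c) k * h a ^ s * spow (h v) l"
  by (simp add: pbw_def hom_mult[OF assms] hom_power[OF assms] hom_star[OF assms] hom_spow[OF assms])

lemma SU02_state:
  fixes \<alpha> \<gamma> :: "'b::cstar_algebra"
  assumes "C_SU02 \<alpha> \<gamma>"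
  shows "state (SU02_state \<alpha> \<gamma> n)"
    and "SU02_state \<alpha> \<gamma> n ((\<alpha>\<^sup>\<star>) ^ r * spow \<gamma> k * \<alpha> ^ s) = (if r = s \<and> s \<le> n \<and> k = 0 then 1 else 0)"
proof -
  interpret u02_algebra \<alpha> \<gamma> 1 by (rule SU02_algebra[OF assms])
  let ?P = "\<lambda>\<psi>. state \<psi> \<and>
     (\<forall>r s k. \<psi> ((\<alpha>\<^sup>\<star>) ^ r * spow \<gamma> k * \<alpha> ^ s) = (if r = s \<and> s \<le> n \<and> k = 0 then 1 else 0))"
  have "\<exists>!\<psi>. ?P \<psi>"
  proof (rule ex_ex1I)
    show "\<exists>\<psi>. ?P \<psi>" by (rule SU02_state_exists[OF assms])
    show "\<psi> = \<psi>'" if "?P \<psi>" "?P \<psi>'" for \<psi> \<psi>'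
      using that by (intro functional_pbw_eqI) (auto simp: state_functional pbw_def)
  qed
  from theI'[OF this] show "state (SU02_state \<alpha> \<gamma> n)"
    "SU02_state \<alpha> \<gamma> n ((\<alpha>\<^sup>\<star>) ^ r * spow \<gamma> k * \<alpha> ^ s) = (if r = s \<and> s \<le> n \<and> k = 0 then 1 else 0)"
    unfolding SU02_state_def by blast+
qed

lemma SU02_state_idempotent:
  assumes "C_SU02 \<alpha> \<gamma>" "min_tensor t"
  shows "idempotent_state t (SU02_coproduct t \<alpha> \<gamma>) (SU02_state \<alpha> \<gamma> n)"
proof -
  interpret u02_algebra \<alpha> \<gamma> 1 by (rule SU02_algebra[OF assms(1)])
  show ?thesis
  proof (rule idempotent_stateI[OF assms(2) SU02_coproduct(1,2)[OF assms]])
    show "SU02_coproduct t \<alpha> \<gamma> \<gamma> = t \<gamma> \<alpha> + t (\<alpha>\<^sup>\<star> * 1\<^sup>\<star>) \<gamma>"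
      using SU02_coproduct(3)[OF assms] by simp
    show "SU02_coproduct t \<alpha> \<gamma> 1 = t 1 1"
      using hom_one[OF SU02_coproduct(1)[OF assms]] by (simp add: tensor_one[OF assms(2)])
  qed (use SU02_state[OF assms(1), of n] SU02_state(2)[OF assms(1), of n _ 0] in \<open>simp_all add: pbw_def\<close>)
qed

context
  fixes a c v :: "'a::cstar_algebra"
  assumes U: "C_U02 a c v"
begin

interpretation u02_algebra a c v by (rule U02_algebra[OF U])

lemma torus_state_state:
  assumes "prob_space \<rho>" "sets \<rho> = sets borel"
  shows "state (torus_state a c v \<rho>)"
  unfolding torus_state_def[abs_def]
  by (rule state_hom[OF U02_to_torus(1)[OF U] integral_bcontfun_state[OF assms]])

lemma torus_state_pbw:
  "torus_state a c v \<rho> (pbw r k s l) =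
    (if k = 0 then \<integral>z. torus_character (int s - int r) l z \<partial>\<rho> else 0)"
proof -
  have spow1: "torus_coord1\<^sup>\<star> ^ r = spow torus_coord1 (- int r)" "torus_coord1 ^ s = spow torus_coord1 (int s)"
    by (simp_all only: spow_uminus spow_of_nat)
  have "apply_bcontfun (U02_to_torus a c v (pbw r k s l)) z =
      (if k = 0 then torus_character (int s - int r) l z else 0)" for z
  proof -
    have "circle_val (fst z) powi (- int r) * circle_val (fst z) powi int s = circle_val (fst z) powi (int s - int r)"
      by (subst power_int_add[symmetric]) simp_all
    then show ?thesis
      by (simp add: hom_pbw[OF U02_to_torus(1)[OF U]] U02_to_torus[OF U] spow1 spow_zero_left
          apply_spow_unimodular times_bcontfun.rep_eq one_bcontfun.rep_eq torus_character_def)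
  qed
  then show ?thesis by (simp add: torus_state_def)
qed

lemma torus_state_return_one:
  "torus_state a c v (return borel \<one>\<^bsub>torus_group\<^esub>) = U02_counit a c v"
proof (rule functional_pbw_eqI)
  show "bounded_functional (torus_state a c v (return borel \<one>\<^bsub>torus_group\<^esub>))"
    by (intro state_functional torus_state_state prob_space_return) simp_all
  show "bounded_functional (U02_counit a c v)"
    using U02_counit(1)[OF U] by (simp add: unital_star_hom_def bounded_functional_def scaleC_complex_def)
  fix r k s l
  have "(\<integral>z. torus_character j l z \<partial>return borel \<one>\<^bsub>torus_group\<^esub>) = 1" for j
    using borel_measurable_continuous_onI[OF continuous_on_torus_character]
    by (subst integral_return) (auto simp: torus_character_def torus_one circle_one.rep_eq)
  then show "torus_state a c v (return borel \<one>\<^bsub>torus_group\<^esub>) (pbw r k s l) = U02_counit a c v (pbw r k s l)"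
    by (simp add: torus_state_pbw hom_pbw[OF U02_counit(1)[OF U]] U02_counit[OF U] spow_zero_left
        star_complex_def)
qed

context
  fixes \<alpha> \<gamma> :: "'b::cstar_algebra" and t :: "'b \<Rightarrow> (circle \<Rightarrow>\<^sub>C complex) \<Rightarrow> 't::cstar_algebra"
  assumes SU: "C_SU02 \<alpha> \<gamma>" and t: "min_tensor t"
begin

lemmas Psi_product = product_state[OF t SU02_state(1)[OF SU] circle_state_state]

lemma U02_Psi_state: "state (U02_Psi t a c v \<alpha> \<gamma> n (circle_index p))"
  unfolding U02_Psi_def comp_def
  by (rule state_hom[OF U02_identification(1)[OF U SU t] Psi_product(1)])

lemma U02_Psi_pbw:
  "U02_Psi t a c v \<alpha> \<gamma> n (circle_index p) (pbw r k s l) =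
    (if k = 0 \<and> r = s \<and> s \<le> n \<and> int p dvd l then 1 else 0)"
proof -
  have "U02_identification t a c v \<alpha> \<gamma> (pbw r k s l) =
      t ((\<alpha>\<^sup>\<star>) ^ r * spow \<gamma> k * \<alpha> ^ s) (spow circle_coord l)"
    by (simp add: hom_pbw[OF U02_identification(1)[OF U SU t]] U02_identification[OF U SU t]
        tensor_star[OF t] tensor_power[OF t] tensor_spow[OF t] tensor_mult[OF t])
  then show ?thesis
    unfolding U02_Psi_def comp_def
    by (simp only: Psi_product(2) SU02_state(2)[OF SU] circle_state_coord) auto
qed

end

end

theorem theorem6p3:
  fixes a c v :: "'a::cstar_algebra"
    and \<alpha> \<gamma> :: "'b::cstar_algebra"
    and tU :: "'a \<Rightarrow> 'a \<Rightarrow> 'tU::cstar_algebra"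
    and tSU :: "'b \<Rightarrow> 'b \<Rightarrow> 'tSU::cstar_algebra"
    and t :: "'b \<Rightarrow> (circle \<Rightarrow>\<^sub>C complex) \<Rightarrow> 't::cstar_algebra"
  assumes "C_U02 a c v" and "C_SU02 \<alpha> \<gamma>"
    and "min_tensor tU" and "min_tensor tSU" and "min_tensor t"
  shows
    "(\<forall>\<phi>. idempotent_state tU (U02_coproduct tU a c v) \<phi> \<longleftrightarrow>
        (\<exists>H \<rho>. subgroup H torus_group \<and> closed H \<and> haar_measure_of torus_group H \<rho> \<and>
           \<phi> = torus_state a c v \<rho>) \<or>
        (\<exists>n m. m \<noteq> 0 \<and> \<phi> = U02_Psi t a c v \<alpha> \<gamma> n m)) \<and>
     (\<forall>H \<rho> r s k l. subgroup H torus_group \<and> closed H \<and> haar_measure_of torus_group H \<rho> \<longrightarrow>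
        torus_state a c v \<rho> ((a\<^sup>\<star>) ^ r * spow c k * a ^ s * spow v l) =
          (if k = 0
           then \<integral>z. circle_val (fst z) powi (int s - int r) * circle_val (snd z) powi l \<partial>\<rho>
           else 0)) \<and>
     (\<exists>\<rho>. haar_measure_of torus_group {\<one>\<^bsub>torus_group\<^esub>} \<rho> \<and> torus_state a c v \<rho> = U02_counit a c v) \<and>
     (\<forall>m. m \<noteq> 0 \<longrightarrow> idempotent_state circle_tensor circle_coproduct (circle_state m)) \<and>
     (\<forall>n. idempotent_state tSU (SU02_coproduct tSU \<alpha> \<gamma>) (SU02_state \<alpha> \<gamma> n) \<and>
        (\<forall>r s k. SU02_state \<alpha> \<gamma> n ((\<alpha>\<^sup>\<star>) ^ r * spow \<gamma> k * \<alpha> ^ s) =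
           (if r = s \<and> s \<le> n \<and> k = 0 then 1 else 0)))"
proof (intro conjI allI impI)
  interpret u02_algebra a c v by (rule U02_algebra[OF assms(1)])
  note U = assms(1) and SU = assms(2) and tU = assms(3) and t = assms(5)
  note \<Delta> = U02_coproduct[OF U tU]
  fix \<phi>
  show "idempotent_state tU (U02_coproduct tU a c v) \<phi> \<longleftrightarrow>
      (\<exists>H \<rho>. subgroup H torus_group \<and> closed H \<and> haar_measure_of torus_group H \<rho> \<and>
         \<phi> = torus_state a c v \<rho>) \<or>
      (\<exists>n m. m \<noteq> 0 \<and> \<phi> = U02_Psi t a c v \<alpha> \<gamma> n m)" (is "?idem \<longleftrightarrow> ?torus \<or> ?Psi")
  proof
    assume idem: ?idem
    then have \<phi>: "bounded_functional \<phi>" by (simp add: idempotent_state_def state_functional)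
    show "?torus \<or> ?Psi"
    proof (rule idempotent_state_values[OF tU \<Delta> idem])
      fix p s :: nat and q :: int
      assume val: "\<And>r k j l. \<phi> (pbw r k j l) =
        (if k = 0 \<and> int p dvd int j - int r \<and> int s dvd l - q * ((int j - int r) div int p) then 1 else 0)"
      \<comment> \<open>The subgroup is made from the lattice data; equal values on all monomials
        then identify the two states.\<close>
      obtain H \<rho> where H: "subgroup H torus_group" "closed H" "haar_measure_of torus_group H \<rho>"
        and int: "\<And>j l. (\<integral>z. torus_character j l z \<partial>\<rho>) =
          (if int p dvd j \<and> int s dvd l - q * (j div int p) then 1 else 0)"
        using torus_haar_exists by blast
      have "\<phi> = torus_state a c v \<rho>"
        using H(3) by (intro functional_pbw_eqI \<phi> state_functional torus_state_state[OF U])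
          (simp_all add: haar_measure_ofD torus_state_pbw[OF U] val int)
      then show ?thesis using H by blast
    next
      fix n p :: nat
      assume val: "\<And>r k j l. \<phi> (pbw r k j l) = (if k = 0 \<and> r = j \<and> j \<le> n \<and> int p dvd l then 1 else 0)"
      have "\<phi> = U02_Psi t a c v \<alpha> \<gamma> n (circle_index p)"
        by (intro functional_pbw_eqI \<phi> state_functional U02_Psi_state[OF U SU t])
          (simp only: U02_Psi_pbw[OF U SU t] val)
      moreover have "circle_index p \<noteq> 0" by (simp add: zero_enat_def)
      ultimately show ?thesis by blast
    qed
  next
    assume "?torus \<or> ?Psi"
    then show ?idem
    proof
      assume ?torus
      then obtain H \<rho> where H: "closed H" "haar_measure_of torus_group H \<rho>"
        and \<phi>: "\<phi> = torus_state a c v \<rho>" by blast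
      have "\<phi> (pbw r 0 s l) \<in> {0, 1}" for r s l
        unfolding \<phi> torus_state_pbw[OF U] using torus_haar_integral[OF H(2,1)] by simp
      then have "\<phi> (pbw r 0 s l) * \<phi> (pbw r 0 s l) = \<phi> (pbw r 0 s l)" for r s l
        by (metis insertE mult_1 mult_zero_left singletonD)
      moreover have "\<phi> (pbw r k s l) = 0" if "k \<noteq> 0" for r k s l
        using that by (simp add: \<phi> torus_state_pbw[OF U])
      moreover have "state \<phi>"
        unfolding \<phi> using H(2) by (intro torus_state_state[OF U]) (simp_all add: haar_measure_ofD)
      ultimately show ?idem by (intro idempotent_stateI[OF tU \<Delta>])
    next
      assume ?Psi
      then obtain n m where "m \<noteq> 0" and \<phi>: "\<phi> = U02_Psi t a c v \<alpha> \<gamma> n m" by blast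
      obtain p where m: "m = circle_index p" using \<open>m \<noteq> 0\<close> by (rule circle_index_surj)
      show ?idem
        unfolding \<phi> m
        by (rule idempotent_stateI[OF tU \<Delta> U02_Psi_state[OF U SU t]])
          (simp_all only: U02_Psi_pbw[OF U SU t], simp_all)
    qed
  qed
next
  fix H \<rho> r s k l
  interpret u02_algebra a c v by (rule U02_algebra[OF assms(1)])
  show "torus_state a c v \<rho> ((a\<^sup>\<star>) ^ r * spow c k * a ^ s * spow v l) =
      (if k = 0 then \<integral>z. circle_val (fst z) powi (int s - int r) * circle_val (snd z) powi l \<partial>\<rho> else 0)"
    using torus_state_pbw[OF assms(1), of \<rho> r k s l] by (simp add: pbw_def torus_character_def[abs_def])
next
  show "\<exists>\<rho>. haar_measure_of torus_group {\<one>\<^bsub>torus_group\<^esub>} \<rho> \<and> torus_state a c v \<rho> = U02_counit a c v"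
    using haar_trivial torus_state_return_one[OF assms(1)] by blast
next
  fix m :: enat assume "m \<noteq> 0"
  then obtain p where "m = circle_index p" by (rule circle_index_surj)
  then show "idempotent_state circle_tensor circle_coproduct (circle_state m)"
    using circle_state_idempotent[of p] by (simp only:)
next
  fix n
  show "idempotent_state tSU (SU02_coproduct tSU \<alpha> \<gamma>) (SU02_state \<alpha> \<gamma> n)"
    by (rule SU02_state_idempotent[OF assms(2,4)])
next
  fix n r s k
  show "SU02_state \<alpha> \<gamma> n ((\<alpha>\<^sup>\<star>) ^ r * spow \<gamma> k * \<alpha> ^ s) = (if r = s \<and> s \<le> n \<and> k = 0 then 1 else 0)"
    by (rule SU02_state(2)[OF assms(2)])
qed

end
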